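(* For $n\ge4$, let $\mathcal{A}$ be the cluster algebra of type $D_n$ with the special frozen variables coming from the polygon model. Then the set $$K(D_n)=\{E_i\mid i=1,\dots,n\}\cup\{u^{\mathrm{diam}}\}\subseteq\mathbb{Z}^{\mathcal{V}\cup\mathcal{W}}$$ is a basis of the lineality space of the Gröbner cone $\mathcal{C}_{\mathcal{A}}$ of $\mathcal{A}$.
   Context: **Cluster algebras and Gröbner cone.** Cluster algebras are of geometric type over a field $\mathbb{K}$ of characteristic zero, generated as $\mathbb{K}$-algebras by all cluster variables and all frozen variables (frozen variables are not inverted). Let $\mathcal{V}$ be the (finite) set of cluster variables and $\mathcal{W}$ the set of frozen variables. Let $\mathbb{K}[\mathbf{z}]=\mathbb{K}[z_v\mid v\in\mathcal{V}\cup\mathcal{W}]$, let $I_{\mathcal{A}}$ be the kernel of $\mathbb{K}[\mathbf{z}]\to\mathcal{A}$, $z_v\mapsto v$, and let $I_{\mathcal{A}}^{\times}$ be the ideal generated by all $z_vz_w$ with $v,w\in\mathcal{V}$ not in a common cluster. For $\omega\in\mathbb{R}^{\mathcal{V}\cup\mathcal{W}}$, $\mathrm{In}_\omega(f)$ is the sum of the terms of $f$ of maximal $\omega$-weight and $\mathrm{In}_\omega(I)=\langle\mathrm{In}_\omega(f):f\in I\rangle$. The Gröbner cone $\mathcal{C}_{\mathcal{A}}$ is the closure of $\{\omega\in\mathbb{R}^{\mathcal{V}\cup\mathcal{W}}:\mathrm{In}_\omega(I_{\mathcal{A}})=I_{\mathcal{A}}^{\times}\}$. **Polygon model for $D_n$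 (Fomin–Zelevinsky).** $N=2n$; $\mathbf{P}_{N}$ is a regular $N$-gon with vertices $1,\dots,N$ (modulo $N$) labeled counterclockwise; $[i,j]$ is the edge or diagonal with endpoints $i,j$ (diagonals join non-adjacent vertices); $\overline i$ is the vertex antipodal to $i$ and $\overline{[i,j]}=[\overline i,\overline j]$. Each diameter comes in two colors: blue, denoted $[a,\overline a]$, and red, denoted $\widehat{[a,\overline a]}$. Two diameters cross only if they have different colors and different endpoints. $\mathcal{A}$ is the cluster algebra of type $D_n$ whose cluster variables $x_l=x_{\overline l}$ correspond to pairs $\{l,\overline l\}$ of non-diameter diagonals and to colored diameters, and whose frozen variables correspond to pairs $\{l,\overline l\}$ of edges; clusters correspond to colored symmetric triangulations (maximal sets of mutually non-crossing diagonal pairs and colored diameters). The exchange relations are exactly: $x_{[a,c]}x_{[b,d]}=x_{[a,b]}x_{[c,d]}+x_{[a,d]}x_{[b,c]}$ for $a,b,c,d,\overline a$ in counterclockwise order; $x_{[a,c]}x_{[a,\overline b]}=x_{[a,b]}x_{[a,\overline c]}+x_{[a,\overline a]}x_{\widehat{[a,\overline a]}}x_{[b,c]}$ for $a,b,c,\overline a$ in counterclockwise order; $x_{[a,\overline a]}x_{\widehat{[b,\overline b]}}=x_{[a,b]}+x_{[a,\overline b]}$ for $a,b,\overline a$ in counterclockwise order; and, for $a,b,c,\overline a$ in counterclockwise order, $x_{[a,\overline a]}x_{[b,\overline c]}=x_{[a,b]}x_{[c,\overline c]}+x_{[a,\overline c]}x_{[b,\overline b]}$ and $x_{\widehat{[a,\overline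 a]}}x_{[b,\overline c]}=x_{[a,b]}x_{\widehat{[c,\overline c]}}+x_{[a,\overline c]}x_{\widehat{[b,\overline b]}}$. **Vectors.** $e_l$ (for a colored diameter $l$) and $e_L$ (for a diagonal or edge pair $L=\{l,\overline l\}$) are the standard basis vectors of $\mathbb{R}^{\mathcal{V}\cup\mathcal{W}}$. For a vertex $i$, $E_i=e_{[i,\overline i]}+e_{\widehat{[i,\overline i]}}+\sum e_L$, the sum over all non-diameter diagonal pairs and edge pairs $L=\{l,\overline l\}$ such that $i$ is an endpoint of $l$ or $\overline l$. Finally $u^{\mathrm{diam}}=\sum_{l\text{ a blue diameter}}e_l-\sum_{l\text{ a red diameter}}e_l$. *)

theory Defs
  imports
    "HOL-Analysis.Finite_Function_Topology"
    "HOL-Algebra.Ideal"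
    "HOL-Combinatorics.Transposition"
begin

section \<open>Polynomial rings and evaluation\<close>

text \<open>
  A monomial is an exponent vector of type \<open>'v \<Rightarrow>\<^sub>0 nat\<close>, a polynomial over \<open>'k\<close> a finitely supported
  map from monomials to coefficients. \<open>poly_ring X\<close> is the polynomial ring with one variable for
  each element of \<open>X\<close>; ideals are taken in this ring.
\<close>

definition poly_ring :: "'v set \<Rightarrow> (('v \<Rightarrow>\<^sub>0 nat) \<Rightarrow>\<^sub>0 'k::comm_ring_1) ring" where
  "poly_ring X =
    \<lparr>carrier = {p. \<forall>m\<in>Poly_Mapping.keys p. Poly_Mapping.keys m \<subseteq> X},
     mult = (*), one = 1, zero = 0, add = (+)\<rparr>"

abbreviation var_monomial :: "'v \<Rightarrow> 'v \<Rightarrow>\<^sub>0 nat" where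
  "var_monomial v \<equiv> Poly_Mapping.single v 1"

abbreviation var_poly :: "'v \<Rightarrow> ('v \<Rightarrow>\<^sub>0 nat) \<Rightarrow>\<^sub>0 'k::comm_ring_1" where
  "var_poly v \<equiv> Poly_Mapping.single (var_monomial v) 1"

definition field_embedding :: "('k::field \<Rightarrow> 'f::field) \<Rightarrow> bool" where
  "field_embedding \<iota> \<longleftrightarrow>
    \<iota> 1 = 1 \<and> (\<forall>a b. \<iota> (a + b) = \<iota> a + \<iota> b) \<and> (\<forall>a b. \<iota> (a * b) = \<iota> a * \<iota> b)"

text \<open>
  The variables are elements of the ambient field \<open>'f\<close>, and evaluation sends the
  variable \<open>z\<^sub>v\<close> to \<open>v\<close> itself; scalars enter through the embedding \<open>\<iota>\<close>.
\<close>

definition monomial_value :: "('f::field \<Rightarrow>\<^sub>0 nat) \<Rightarrow> 'f" where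
  "monomial_value m = (\<Prod>v\<in>Poly_Mapping.keys m. v ^ Poly_Mapping.lookup m v)"

definition poly_value :: "('k::field \<Rightarrow> 'f::field) \<Rightarrow> (('f \<Rightarrow>\<^sub>0 nat) \<Rightarrow>\<^sub>0 'k) \<Rightarrow> 'f" where
  "poly_value \<iota> p = (\<Sum>m\<in>Poly_Mapping.keys p. \<iota> (Poly_Mapping.lookup p m) * monomial_value m)"

text \<open>\<open>X\<close> is algebraically independent over the base field and generates \<open>'f\<close> as a field.\<close>

definition free_generating_set :: "('k::field \<Rightarrow> 'f::field) \<Rightarrow> 'f set \<Rightarrow> bool" where
  "free_generating_set \<iota> X \<longleftrightarrow>
    (\<forall>p\<in>carrier (poly_ring X). poly_value \<iota> p = 0 \<longrightarrow> p = 0) \<and>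
    (\<forall>f. \<exists>p\<in>carrier (poly_ring X). \<exists>q\<in>carrier (poly_ring X).
       poly_value \<iota> q \<noteq> 0 \<and> f = poly_value \<iota> p / poly_value \<iota> q)"


section \<open>Cluster algebras of geometric type\<close>

text \<open>
  Rows of the extended exchange matrix are indexed by the cluster and frozen variables, columns
  by the cluster variables; all other entries are required to be 0.
\<close>

record 'f seed =
  cluster :: "'f set"
  frozen :: "'f set"
  exmat :: "'f \<Rightarrow> 'f \<Rightarrow> int"

definition skew_symmetrizable_on :: "'a set \<Rightarrow> ('a \<Rightarrow> 'a \<Rightarrow> int) \<Rightarrow> bool" where
  "skew_symmetrizable_on X B \<longleftrightarrow>
    (\<exists>d :: 'a \<Rightarrow> int. (\<forall>y\<in>X. d y > 0) \<and> (\<forall>y\<in>X. \<forall>z\<in>X. d y * B y z = - (d z * B z y)))"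

definition geometric_seed :: "('k::field \<Rightarrow> 'f::field) \<Rightarrow> 'f seed \<Rightarrow> bool" where
  "geometric_seed \<iota> s \<longleftrightarrow>
    field_embedding \<iota> \<and>
    finite (cluster s) \<and> finite (frozen s) \<and> cluster s \<inter> frozen s = {} \<and>
    free_generating_set \<iota> (cluster s \<union> frozen s) \<and>
    skew_symmetrizable_on (cluster s) (exmat s) \<and>
    (\<forall>y z. \<not> (y \<in> cluster s \<union> frozen s \<and> z \<in> cluster s) \<longrightarrow> exmat s y z = 0)"

definition pos_monomial :: "'f seed \<Rightarrow> 'f \<Rightarrow> 'f \<Rightarrow>\<^sub>0 nat" where
  "pos_monomial s k =
    (\<Sum>y\<in>cluster s \<union> frozen s. Poly_Mapping.single y (nat (exmat s y k)))"

definition neg_monomial :: "'f seed \<Rightarrow> 'f \<Rightarrow> 'f \<Rightarrow>\<^sub>0 nat" where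
  "neg_monomial s k =
    (\<Sum>y\<in>cluster s \<union> frozen s. Poly_Mapping.single y (nat (- exmat s y k)))"

definition exchange_partner :: "'f::field seed \<Rightarrow> 'f \<Rightarrow> 'f" where
  "exchange_partner s k =
    (monomial_value (pos_monomial s k) + monomial_value (neg_monomial s k)) / k"

definition matrix_mutation :: "('a \<Rightarrow> 'a \<Rightarrow> int) \<Rightarrow> 'a \<Rightarrow> 'a \<Rightarrow> 'a \<Rightarrow> int" where
  "matrix_mutation B k y z =
    (if y = k \<or> z = k then - B y z
     else B y z + max 0 (B y k) * max 0 (B k z) - max 0 (- B y k) * max 0 (- B k z))"

text \<open>The transposition renames the row and column of \<open>k\<close> to the new cluster variable.\<close>

definition mutate :: "'f \<Rightarrow> 'f::field seed \<Rightarrow> 'f seed" where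
  "mutate k s =
    (let k' = exchange_partner s k; \<sigma> = transpose k k' in
     \<lparr>cluster = insert k' (cluster s - {k}),
      frozen = frozen s,
      exmat = (\<lambda>y z. matrix_mutation (exmat s) k (\<sigma> y) (\<sigma> z))\<rparr>)"

inductive_set seeds :: "'f::field seed \<Rightarrow> 'f seed set" for s0 where
  initial: "s0 \<in> seeds s0"
| mutation: "s \<in> seeds s0 \<Longrightarrow> k \<in> cluster s \<Longrightarrow> mutate k s \<in> seeds s0"

definition clusters :: "'f::field seed \<Rightarrow> 'f set set" where
  "clusters s0 = cluster ` seeds s0"

definition cluster_variables :: "'f::field seed \<Rightarrow> 'f set" where
  "cluster_variables s0 = \<Union> (clusters s0)"

abbreviation all_variables :: "'f::field seed \<Rightarrow> 'f set" where
  "all_variables s0 \<equiv> cluster_variables s0 \<union> frozen s0"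

text \<open>
  An exchange relation \<open>k k' = M\<^sub>1 + M\<^sub>2\<close> is recorded formally as the unordered pair of exchanged
  variables together with the unordered pair of monomials.
\<close>

definition exchange_relations :: "'f::field seed \<Rightarrow> ('f set \<times> ('f \<Rightarrow>\<^sub>0 nat) set) set" where
  "exchange_relations s0 =
    {({k, exchange_partner s k}, {pos_monomial s k, neg_monomial s k}) | s k.
       s \<in> seeds s0 \<and> k \<in> cluster s}"

definition subalgebra :: "('k::field \<Rightarrow> 'f::field) \<Rightarrow> 'f set \<Rightarrow> bool" where
  "subalgebra \<iota> S \<longleftrightarrow>
    range \<iota> \<subseteq> S \<and> (\<forall>a\<in>S. \<forall>b\<in>S. a + b \<in> S) \<and> (\<forall>a\<in>S. \<forall>b\<in>S. a * b \<in> S)"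

text \<open>The frozen variables are not inverted.\<close>

definition cluster_algebra :: "('k::field \<Rightarrow> 'f::field) \<Rightarrow> 'f seed \<Rightarrow> 'f ring" where
  "cluster_algebra \<iota> s0 =
    \<lparr>carrier = subalgebra \<iota> hull all_variables s0,
     mult = (*), one = 1, zero = 0, add = (+)\<rparr>"

text \<open>
  The Dynkin diagram of type \<open>D\<^sub>n\<close> on \<open>{1..n}\<close>: the path \<open>1, \<dots>, n - 1\<close> with \<open>n\<close> attached to \<open>n - 2\<close>.
  A cluster algebra has type \<open>D\<^sub>n\<close> if the Cartan counterpart of some exchange matrix is the
  corresponding Cartan matrix.
\<close>

definition cartan_matrix_D :: "nat \<Rightarrow> nat \<Rightarrow> nat \<Rightarrow> int" where
  "cartan_matrix_D n i j =
    (if i = j then 2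
     else if {i, j} \<in> {{l, l + 1} | l. 1 \<le> l \<and> l \<le> n - 2} \<union> {{n - 2, n}} then - 1
     else 0)"

definition cartan_counterpart :: "('a \<Rightarrow> 'a \<Rightarrow> int) \<Rightarrow> 'a \<Rightarrow> 'a \<Rightarrow> int" where
  "cartan_counterpart B y z = (if y = z then 2 else - \<bar>B y z\<bar>)"

definition cluster_type_D :: "nat \<Rightarrow> 'f::field seed \<Rightarrow> bool" where
  "cluster_type_D n s0 \<longleftrightarrow>
    (\<exists>s\<in>seeds s0. \<exists>\<pi>. bij_betw \<pi> {1..n} (cluster s) \<and>
       (\<forall>i\<in>{1..n}. \<forall>j\<in>{1..n}.
          cartan_counterpart (exmat s) (\<pi> i) (\<pi> j) = cartan_matrix_D n i j))"


section \<open>Initial ideals and the Groebner cone\<close>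

definition monomial_weight :: "('v \<Rightarrow>\<^sub>0 real) \<Rightarrow> ('v \<Rightarrow>\<^sub>0 nat) \<Rightarrow> real" where
  "monomial_weight \<omega> m =
    (\<Sum>v\<in>Poly_Mapping.keys m. Poly_Mapping.lookup \<omega> v * real (Poly_Mapping.lookup m v))"

definition initial_form ::
    "('v \<Rightarrow>\<^sub>0 real) \<Rightarrow> (('v \<Rightarrow>\<^sub>0 nat) \<Rightarrow>\<^sub>0 'k::comm_ring_1) \<Rightarrow> (('v \<Rightarrow>\<^sub>0 nat) \<Rightarrow>\<^sub>0 'k)" where
  "initial_form \<omega> f =
    (\<Sum>m | m \<in> Poly_Mapping.keys f \<and>
           (\<forall>m'\<in>Poly_Mapping.keys f. monomial_weight \<omega> m' \<le> monomial_weight \<omega> m).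
       Poly_Mapping.single m (Poly_Mapping.lookup f m))"

definition initial_ideal ::
    "'v set \<Rightarrow> ('v \<Rightarrow>\<^sub>0 real) \<Rightarrow> (('v \<Rightarrow>\<^sub>0 nat) \<Rightarrow>\<^sub>0 'k::comm_ring_1) set
      \<Rightarrow> (('v \<Rightarrow>\<^sub>0 nat) \<Rightarrow>\<^sub>0 'k) set" where
  "initial_ideal X \<omega> I = genideal (poly_ring X) (initial_form \<omega> ` I)"

definition cluster_ideal ::
    "('k::field \<Rightarrow> 'f::field) \<Rightarrow> 'f seed \<Rightarrow> (('f \<Rightarrow>\<^sub>0 nat) \<Rightarrow>\<^sub>0 'k) set" where
  "cluster_ideal \<iota> s0 =
    a_kernel (poly_ring (all_variables s0)) (cluster_algebra \<iota> s0) (poly_value \<iota>)"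

text \<open>
  The ideal does not depend on \<open>\<iota>\<close>; the argument only fixes the coefficient type.
\<close>

definition incompatibility_ideal ::
    "('k::field \<Rightarrow> 'f::field) \<Rightarrow> 'f seed \<Rightarrow> (('f \<Rightarrow>\<^sub>0 nat) \<Rightarrow>\<^sub>0 'k) set" where
  "incompatibility_ideal \<iota> s0 =
    genideal (poly_ring (all_variables s0))
      {var_poly v * var_poly w | v w.
         v \<in> cluster_variables s0 \<and> w \<in> cluster_variables s0 \<and>
         \<not> (\<exists>C\<in>clusters s0. v \<in> C \<and> w \<in> C)}"

text \<open>
  Vectors indexed by the cluster and frozen variables are finitely supported functions vanishing
  outside this set. As there are finitely many such variables in finite type, these
  functions form a finite-dimensional, hence closed, subspace of the normed space \<open>'f \<Rightarrow>\<^sub>0 real\<close>,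
  and the closure below is the Euclidean one.
\<close>

definition groebner_cone :: "('k::field \<Rightarrow> 'f::field) \<Rightarrow> 'f seed \<Rightarrow> ('f \<Rightarrow>\<^sub>0 real) set" where
  "groebner_cone \<iota> s0 =
    closure {\<omega>. Poly_Mapping.keys \<omega> \<subseteq> all_variables s0 \<and>
       initial_ideal (all_variables s0) \<omega> (cluster_ideal \<iota> s0) = incompatibility_ideal \<iota> s0}"

text \<open>For a convex cone, this is its largest linear subspace.\<close>

definition lineality_space :: "'a::real_vector set \<Rightarrow> 'a set" where
  "lineality_space C = C \<inter> uminus ` C"


section \<open>The polygon model of type \<open>D\<^sub>n\<close>\<close>

text \<open>Vertices of the regular \<open>2n\<close>-gon are \<open>1, \<dots>, 2n\<close>, labeled counterclockwise.\<close>

definition vertices :: "nat \<Rightarrow> nat set" where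
  "vertices n = {1..2 * n}"

definition antipode :: "nat \<Rightarrow> nat \<Rightarrow> nat" where
  "antipode n i = (if i \<le> n then i + n else i - n)"

definition ccw :: "nat \<Rightarrow> nat list \<Rightarrow> bool" where
  "ccw n vs \<longleftrightarrow> set vs \<subseteq> vertices n \<and> (\<exists>r. sorted_wrt (<) (rotate r vs))"

definition edges :: "nat \<Rightarrow> nat set set" where
  "edges n = {{i, i + 1} | i. 1 \<le> i \<and> i < 2 * n} \<union> {{2 * n, 1}}"

definition diagonals :: "nat \<Rightarrow> nat set set" where
  "diagonals n = {{i, j} | i j. i \<in> vertices n \<and> j \<in> vertices n \<and> i \<noteq> j} - edges n"

definition diameters :: "nat \<Rightarrow> nat set set" where
  "diameters n = {{a, antipode n a} | a. a \<in> vertices n}"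

datatype label =
    Orbit "nat set set"
  | Blue "nat set"
  | Red "nat set"

definition orbit :: "nat \<Rightarrow> nat set \<Rightarrow> label" where
  "orbit n l = Orbit {l, antipode n ` l}"

definition edge_labels :: "nat \<Rightarrow> label set" where
  "edge_labels n = orbit n ` edges n"

definition diagonal_pair_labels :: "nat \<Rightarrow> label set" where
  "diagonal_pair_labels n = orbit n ` (diagonals n - diameters n)"

definition cluster_labels :: "nat \<Rightarrow> label set" where
  "cluster_labels n = diagonal_pair_labels n \<union> Blue ` diameters n \<union> Red ` diameters n"

text \<open>Two diagonals cross if they meet in the interior of the polygon.\<close>

definition diagonals_cross :: "nat \<Rightarrow> nat set \<Rightarrow> nat set \<Rightarrow> bool" where
  "diagonals_cross n l m \<longleftrightarrow> (\<exists>a b c d. l = {a, c} \<and> m = {b, d} \<and> ccw n [a, b, c, d])"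

fun labels_cross :: "nat \<Rightarrow> label \<Rightarrow> label \<Rightarrow> bool" where
  "labels_cross n (Orbit L) (Orbit M) \<longleftrightarrow> (\<exists>l\<in>L. \<exists>m\<in>M. diagonals_cross n l m)"
| "labels_cross n (Orbit L) (Blue d) \<longleftrightarrow> (\<exists>l\<in>L. diagonals_cross n l d)"
| "labels_cross n (Orbit L) (Red d) \<longleftrightarrow> (\<exists>l\<in>L. diagonals_cross n l d)"
| "labels_cross n (Blue d) (Orbit L) \<longleftrightarrow> (\<exists>l\<in>L. diagonals_cross n d l)"
| "labels_cross n (Red d) (Orbit L) \<longleftrightarrow> (\<exists>l\<in>L. diagonals_cross n d l)"
| "labels_cross n (Blue d) (Blue d') \<longleftrightarrow> False"
| "labels_cross n (Red d) (Red d') \<longleftrightarrow> False"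
| "labels_cross n (Blue d) (Red d') \<longleftrightarrow> d \<noteq> d'"
| "labels_cross n (Red d) (Blue d') \<longleftrightarrow> d \<noteq> d'"

definition noncrossing :: "nat \<Rightarrow> label set \<Rightarrow> bool" where
  "noncrossing n T \<longleftrightarrow>
    T \<subseteq> cluster_labels n \<and> (\<forall>L\<in>T. \<forall>M\<in>T. \<not> labels_cross n L M)"

definition triangulations :: "nat \<Rightarrow> label set set" where
  "triangulations n = {T. noncrossing n T \<and> (\<forall>T'. noncrossing n T' \<and> T \<subseteq> T' \<longrightarrow> T' = T)}"

text \<open>\<open>seg n a b\<close> labels \<open>[a,b]\<close>, which is a blue diameter if \<open>b\<close> is antipodal to \<open>a\<close>.\<close>

definition seg :: "nat \<Rightarrow> nat \<Rightarrow> nat \<Rightarrow> label" where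
  "seg n a b = (if b = antipode n a then Blue {a, b} else orbit n {a, b})"

definition red :: "nat \<Rightarrow> nat \<Rightarrow> label" where
  "red n a = Red {a, antipode n a}"

definition polygon_exchange_relations ::
    "nat \<Rightarrow> (label \<Rightarrow> 'f) \<Rightarrow> ('f set \<times> ('f \<Rightarrow>\<^sub>0 nat) set) set" where
  "polygon_exchange_relations n x =
    (let z = (\<lambda>a b. var_monomial (x (seg n a b)));
         zr = (\<lambda>a. var_monomial (x (red n a)));
         ap = antipode n in
     {({x (seg n a c), x (seg n b d)}, {z a b + z c d, z a d + z b c}) | a b c d.
        ccw n [a, b, c, d, ap a]} \<union>
     {({x (seg n a c), x (seg n a (ap b))}, {z a b + z a (ap c), z a (ap a) + zr a + z b c}) | a b c.
        ccw n [a, b, c, ap a]} \<union>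
     {({x (seg n a (ap a)), x (red n b)}, {z a b, z a (ap b)}) | a b.
        ccw n [a, b, ap a]} \<union>
     {({x (seg n a (ap a)), x (seg n b (ap c))},
       {z a b + z c (ap c), z a (ap c) + z b (ap b)}) | a b c.
        ccw n [a, b, c, ap a]} \<union>
     {({x (red n a), x (seg n b (ap c))}, {z a b + zr c, z a (ap c) + zr b}) | a b c.
        ccw n [a, b, c, ap a]})"

text \<open>
  \<open>x\<close> identifies the cluster algebra of the seed \<open>s0\<close> with the polygon model: it labels the cluster
  and frozen variables so that clusters and exchange relations are those of the model.
\<close>

definition polygon_model :: "nat \<Rightarrow> 'f::field seed \<Rightarrow> (label \<Rightarrow> 'f) \<Rightarrow> bool" where
  "polygon_model n s0 x \<longleftrightarrow>
    cluster_type_D n s0 \<and>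
    bij_betw x (cluster_labels n) (cluster_variables s0) \<and>
    bij_betw x (edge_labels n) (frozen s0) \<and>
    clusters s0 = (`) x ` triangulations n \<and>
    exchange_relations s0 = polygon_exchange_relations n x"


section \<open>The vectors\<close>

definition basis_vec :: "(label \<Rightarrow> 'f) \<Rightarrow> label \<Rightarrow> 'f \<Rightarrow>\<^sub>0 real" where
  "basis_vec x L = Poly_Mapping.single (x L) 1"

text \<open>For \<open>L = {l, antipode n ` l}\<close>, the union of \<open>L\<close> is the set of endpoints of its two segments.\<close>

definition vertex_vec :: "nat \<Rightarrow> (label \<Rightarrow> 'f) \<Rightarrow> nat \<Rightarrow> 'f \<Rightarrow>\<^sub>0 real" where
  "vertex_vec n x i =
    basis_vec x (seg n i (antipode n i)) + basis_vec x (red n i) +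
    (\<Sum>L | Orbit L \<in> diagonal_pair_labels n \<union> edge_labels n \<and> i \<in> \<Union> L. basis_vec x (Orbit L))"

definition diam_vec :: "nat \<Rightarrow> (label \<Rightarrow> 'f) \<Rightarrow> 'f \<Rightarrow>\<^sub>0 real" where
  "diam_vec n x =
    (\<Sum>l\<in>diameters n. basis_vec x (Blue l)) - (\<Sum>l\<in>diameters n. basis_vec x (Red l))"

definition K_D :: "nat \<Rightarrow> (label \<Rightarrow> 'f) \<Rightarrow> ('f \<Rightarrow>\<^sub>0 real) set" where
  "K_D n x = vertex_vec n x ` {1..n} \<union> {diam_vec n x}"

definition integer_vectors :: "'v set \<Rightarrow> ('v \<Rightarrow>\<^sub>0 real) set" where
  "integer_vectors X =
    {w. Poly_Mapping.keys w \<subseteq> X \<and> (\<forall>v. Poly_Mapping.lookup w v \<in> \<int>)}"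

end

(*  The universal cover of the polygon gives coordinates in which everything is explicit.  Write B_a for the
    blue diameter at a and y_i = x_[i,i+1] / (B_i B_(i+1)).  The exchange relations with a blue diameter give
    x_[a,b] = B_a B_b (y_a + ... + y_(b-1)) for a < b < a + n, and the red diameter at a is B_a (y_1 + ... + y_n).
    As the blue diameters form a cluster, the B_a and y_i are algebraically independent.

    Products of crossing variables are rewritten by these formulas (Pluecker-type relations); every step lowers
    the weight 2 k (2n - k) on [a,a+k], n^2 on diameters, and is homogeneous for K(D_n).  Crossing-free monomials
    are linearly independent, because for y_1 < ... < y_n their leading exponents determine them.  So
    In_theta(I) is the incompatibility ideal for theta = t w + v with t > 0 and v in the span of K(D_n), which
    puts this span into the cone.  Conversely, on the cone the relation
    blue_a red_b = [a,b] + [a,b'] (b' antipodal to b) imposes inequalities; on the lineality space they are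
    equations, and their solutions are the span of K(D_n).  *)

theory Submission
  imports Defs "HOL-Computational_Algebra.Polynomial" "HOL-Analysis.Elementary_Metric_Spaces"
begin

text \<open>Leading exponents lose information: red_a blue_b, red_b blue_a and the arc between a and
  b that passes the vertex n all lead with B_a B_b y_n. Uniqueness can therefore hold only for
  crossing-free monomials. After common factors are cancelled, the labels are removed in the order
  in which their y-exponents isolate them: arcs inside 1..n by right endpoint, then arcs passing n,
  then red and finally blue diameters.

  Two weights have separate tasks. The integer weight \<open>wt\<close> makes the rewriting
  terminate, while the real weight \<theta> of the initial ideal only has to drop strictly along the
  same steps. One straightening thus serves every \<theta> = t w + v, and letting t tend to 0 puts v
  into the closure.

  For the converse, a single variable has degree one and is never in the incompatibility ideal, so
  in blue_a red_b = [a,b] + [a,b'] no term on the right can outweigh the left side. Equality, which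
  holds on the lineality space, makes blue_i - red_i independent of i; half of this constant is the
  coefficient of u^diam.\<close>

abbreviation "keys \<equiv> Poly_Mapping.keys"
abbreviation "lookup \<equiv> Poly_Mapping.lookup"
abbreviation "single \<equiv> Poly_Mapping.single"

section \<open>Evaluation of polynomials\<close>

text \<open>Variables and values are kept apart: besides field elements evaluated at themselves, the
  families indexed by blue diameters and edges need the same calculus.\<close>

definition mono_eval :: "('i \<Rightarrow> 'f::field) \<Rightarrow> ('i \<Rightarrow>\<^sub>0 nat) \<Rightarrow> 'f" where
  "mono_eval g m = (\<Prod>v\<in>keys m. g v ^ lookup m v)"

definition poly_eval ::
    "('k::field \<Rightarrow> 'f::field) \<Rightarrow> ('i \<Rightarrow> 'f) \<Rightarrow> (('i \<Rightarrow>\<^sub>0 nat) \<Rightarrow>\<^sub>0 'k) \<Rightarrow> 'f" where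
  "poly_eval \<iota> g p = (\<Sum>m\<in>keys p. \<iota> (lookup p m) * mono_eval g m)"

lemma monomial_value_eq_mono_eval: "monomial_value = mono_eval (\<lambda>v. v)"
  by (simp add: fun_eq_iff monomial_value_def mono_eval_def)

lemma poly_value_eq_poly_eval: "poly_value \<iota> = poly_eval \<iota> (\<lambda>v. v)"
  by (simp add: fun_eq_iff poly_value_def poly_eval_def monomial_value_eq_mono_eval)

lemma mono_eval_superset:
  assumes "finite A" "keys m \<subseteq> A"
  shows "mono_eval g m = (\<Prod>v\<in>A. g v ^ lookup m v)"
  unfolding mono_eval_def using assms
  by (intro prod.mono_neutral_left) (auto simp: in_keys_iff)

lemma mono_eval_zero [simp]: "mono_eval g 0 = 1"
  by (simp add: mono_eval_def)

lemma mono_eval_add: "mono_eval g (m + m') = mono_eval g m * mono_eval g m'"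
proof -
  let ?A = "keys m \<union> keys m'"
  have "mono_eval g (m + m') = (\<Prod>v\<in>?A. g v ^ lookup (m + m') v)"
    by (rule mono_eval_superset) (auto simp: keys_add)
  also have "\<dots> = (\<Prod>v\<in>?A. g v ^ lookup m v) * (\<Prod>v\<in>?A. g v ^ lookup m' v)"
    by (simp add: lookup_add power_add prod.distrib)
  also have "\<dots> = mono_eval g m * mono_eval g m'"
    by (simp add: mono_eval_superset[of ?A m] mono_eval_superset[of ?A m'])
  finally show ?thesis .
qed

lemma mono_eval_single: "mono_eval g (single v k) = g v ^ k"
  by (cases "k = 0") (simp_all add: mono_eval_def)

lemma field_embedding_0:
  assumes "field_embedding \<iota>"
  shows "\<iota> 0 = 0"
proof -
  have "\<iota> (0 + 0) = \<iota> 0 + \<iota> 0"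
    using assms unfolding field_embedding_def by blast
  then have "\<iota> 0 = \<iota> 0 + \<iota> 0" by (simp only: add_0)
  then show ?thesis by (simp only: add_cancel_right_right)
qed

lemma field_embedding_minus:
  assumes "field_embedding \<iota>"
  shows "\<iota> (- a) = - \<iota> a"
proof -
  have "\<iota> (- a + a) = \<iota> (- a) + \<iota> a"
    using assms unfolding field_embedding_def by blast
  then have "\<iota> (- a) + \<iota> a = 0"
    by (simp add: field_embedding_0[OF assms])
  then show ?thesis by (simp add: eq_neg_iff_add_eq_0)
qed

lemma field_embedding_eq_0_iff:
  assumes "field_embedding \<iota>"
  shows "\<iota> a = 0 \<longleftrightarrow> a = 0"
proof
  assume *: "\<iota> a = 0"
  have "\<iota> (a * inverse a) = \<iota> a * \<iota> (inverse a)" "\<iota> 1 = 1"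
    using assms unfolding field_embedding_def by blast+
  with * show "a = 0"
    by (cases "a = 0") simp_all
qed (simp add: field_embedding_0[OF assms])

lemma poly_eval_superset:
  assumes "field_embedding \<iota>" "finite A" "keys p \<subseteq> A"
  shows "poly_eval \<iota> g p = (\<Sum>m\<in>A. \<iota> (lookup p m) * mono_eval g m)"
  unfolding poly_eval_def using assms
  by (intro sum.mono_neutral_left) (auto simp: in_keys_iff field_embedding_0)

lemma poly_eval_zero [simp]: "poly_eval \<iota> g 0 = 0"
  by (simp add: poly_eval_def)

lemma poly_eval_add:
  assumes "field_embedding \<iota>"
  shows "poly_eval \<iota> g (p + q) = poly_eval \<iota> g p + poly_eval \<iota> g q"
proof -
  let ?A = "keys p \<union> keys q"
  have "poly_eval \<iota> g (p + q) = (\<Sum>m\<in>?A. \<iota> (lookup (p + q) m) * mono_eval g m)"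
    by (rule poly_eval_superset) (use assms in \<open>auto simp: keys_add\<close>)
  also have "\<dots> = (\<Sum>m\<in>?A. \<iota> (lookup p m) * mono_eval g m)
      + (\<Sum>m\<in>?A. \<iota> (lookup q m) * mono_eval g m)"
    using assms unfolding field_embedding_def
    by (simp add: lookup_add distrib_right sum.distrib)
  also have "\<dots> = poly_eval \<iota> g p + poly_eval \<iota> g q"
    by (simp add: poly_eval_superset[OF assms, of ?A p] poly_eval_superset[OF assms, of ?A q])
  finally show ?thesis .
qed

lemma poly_eval_uminus:
  assumes "field_embedding \<iota>"
  shows "poly_eval \<iota> g (- p) = - poly_eval \<iota> g p"
  using poly_eval_add[OF assms, of g "- p" p] by (simp add: eq_neg_iff_add_eq_0)

lemma poly_eval_diff:
  assumes "field_embedding \<iota>"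
  shows "poly_eval \<iota> g (p - q) = poly_eval \<iota> g p - poly_eval \<iota> g q"
  using poly_eval_add[OF assms, of g p "- q"] by (simp add: poly_eval_uminus[OF assms])

lemma poly_eval_sum:
  assumes "field_embedding \<iota>"
  shows "poly_eval \<iota> g (sum h A) = (\<Sum>a\<in>A. poly_eval \<iota> g (h a))"
  by (induction A rule: infinite_finite_induct) (simp_all add: poly_eval_add[OF assms])

lemma poly_eval_single:
  assumes "field_embedding \<iota>"
  shows "poly_eval \<iota> g (single m c) = \<iota> c * mono_eval g m"
  by (cases "c = 0") (simp_all add: poly_eval_def field_embedding_0[OF assms])

lemma poly_mapping_sum_single:
  fixes p :: "'a \<Rightarrow>\<^sub>0 'b::comm_monoid_add"
  shows "p = (\<Sum>m\<in>keys p. single m (lookup p m))"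
  by (rule poly_mapping_eqI)
    (auto simp: lookup_sum lookup_single when_def in_keys_iff)

lemma poly_mapping_induct_single [case_names zero single]:
  fixes p :: "'a \<Rightarrow>\<^sub>0 'b::comm_monoid_add"
  assumes "P 0" "\<And>p m c. P p \<Longrightarrow> P (p + single m c)"
  shows "P p"
proof -
  have "P (\<Sum>m\<in>A. single m (lookup p m))" if "finite A" for A
    using that
    by (induction A rule: finite_induct) (simp_all add: assms add.commute[of "single _ _"])
  from this[of "keys p"] show ?thesis
    using poly_mapping_sum_single[of p] by simp
qed

lemma poly_eval_mult:
  assumes "field_embedding \<iota>"
  shows "poly_eval \<iota> g (p * q) = poly_eval \<iota> g p * poly_eval \<iota> g q"
proof (induction p rule: poly_mapping_induct_single)
  case (single p m c)
  have "poly_eval \<iota> g (single m c * q) = \<iota> c * mono_eval g m * poly_eval \<iota> g q" for m c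
  proof (induction q rule: poly_mapping_induct_single)
    case (single q m' c')
    then show ?case
      using assms unfolding field_embedding_def
      by (simp add: distrib_left poly_eval_add[OF assms] poly_eval_single[OF assms] mult_single
          mono_eval_add mult_ac)
  qed simp
  with single show ?case
    by (simp add: distrib_right poly_eval_add[OF assms] poly_eval_single[OF assms])
qed simp

lemma poly_eval_prod:
  assumes "field_embedding \<iota>"
  shows "poly_eval \<iota> g (\<Prod>a\<in>A. h a) = (\<Prod>a\<in>A. poly_eval \<iota> g (h a))"
proof -
  have one: "poly_eval \<iota> g 1 = 1"
    using assms poly_eval_single[OF assms, of g 0 1] unfolding field_embedding_def by simp
  show ?thesis
    by (induction A rule: infinite_finite_induct) (simp_all add: one poly_eval_mult[OF assms])
qed

lemma poly_eval_power:
  assumes "field_embedding \<iota>"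
  shows "poly_eval \<iota> g (p ^ k) = poly_eval \<iota> g p ^ k"
  using poly_eval_prod[OF assms, of g "\<lambda>_. p" "{..<k}"] by simp


section \<open>Algebraic independence\<close>

text \<open>A relation is given by a finite set of exponents and a coefficient function, so that a
  sum can be tested without first being packed into a polynomial.\<close>

definition alg_indep :: "('k::field \<Rightarrow> 'f::field) \<Rightarrow> ('i \<Rightarrow> 'f) \<Rightarrow> 'i set \<Rightarrow> bool" where
  "alg_indep \<iota> g I \<longleftrightarrow>
    (\<forall>S c. finite S \<and> (\<forall>m\<in>S. keys m \<subseteq> I) \<and> (\<Sum>m\<in>S. \<iota> (c m) * mono_eval g m) = 0
      \<longrightarrow> (\<forall>m\<in>S. c m = 0))"

lemma alg_indepD:
  assumes "alg_indep \<iota> g I" "finite S" "\<forall>m\<in>S. keys m \<subseteq> I"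
    "(\<Sum>m\<in>S. \<iota> (c m) * mono_eval g m) = 0" "m \<in> S"
  shows "c m = 0"
  using assms unfolding alg_indep_def by blast

lemma alg_indep_poly_eval:
  assumes "alg_indep \<iota> g I" "\<forall>m\<in>keys p. keys m \<subseteq> I"
    "poly_eval \<iota> g p = 0"
  shows "p = 0"
proof -
  have "\<forall>m\<in>keys p. lookup p m = 0"
    using assms finite_keys[of p] unfolding alg_indep_def poly_eval_def by blast
  then show ?thesis
    by (auto intro!: poly_mapping_eqI simp: in_keys_iff)
qed

lemma alg_indep_mono: "alg_indep \<iota> g I \<Longrightarrow> J \<subseteq> I \<Longrightarrow> alg_indep \<iota> g J"
  unfolding alg_indep_def by (meson subset_trans)

lemma alg_indep_if_free:
  assumes \<iota>: "field_embedding \<iota>" and "free_generating_set \<iota> X"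
  shows "alg_indep \<iota> (\<lambda>v. v) X"
  unfolding alg_indep_def
proof (intro allI impI, elim conjE)
  fix S :: "('b \<Rightarrow>\<^sub>0 nat) set" and c
  assume S: "finite S" "\<forall>m\<in>S. keys m \<subseteq> X"
    and eq: "(\<Sum>m\<in>S. \<iota> (c m) * mono_eval (\<lambda>v. v) m) = 0"
  define p where "p = (\<Sum>m\<in>S. single m (c m))"
  have lookup: "lookup p m = c m" if "m \<in> S" for m
    using that S(1) by (simp add: p_def lookup_sum lookup_single when_def)
  have "keys p \<subseteq> S"
    unfolding p_def using keys_sum[of "\<lambda>m. single m (c m)" S] by (auto split: if_splits)
  then have "p \<in> carrier (poly_ring X)"
    using S(2) by (auto simp: poly_ring_def)
  moreover have "poly_value \<iota> p = 0"
    using eq by (simp add: p_def poly_value_eq_poly_eval poly_eval_sum[OF \<iota>] poly_eval_single[OF \<iota>])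
  ultimately have "p = 0"
    using assms(2) unfolding free_generating_set_def by blast
  then show "\<forall>m\<in>S. c m = 0"
    using lookup by auto
qed

section \<open>Generated subalgebras and transcendence over them\<close>

inductive_set generated :: "('k::field \<Rightarrow> 'f::field) \<Rightarrow> 'f set \<Rightarrow> 'f set" for \<iota> X where
  scalar: "\<iota> c \<in> generated \<iota> X"
| generator: "v \<in> X \<Longrightarrow> v \<in> generated \<iota> X"
| add: "a \<in> generated \<iota> X \<Longrightarrow> b \<in> generated \<iota> X \<Longrightarrow> a + b \<in> generated \<iota> X"
| mult: "a \<in> generated \<iota> X \<Longrightarrow> b \<in> generated \<iota> X \<Longrightarrow> a * b \<in> generated \<iota> X"

lemma generated_0: "field_embedding \<iota> \<Longrightarrow> 0 \<in> generated \<iota> X"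
  using generated.scalar[of \<iota> 0 X] by (simp add: field_embedding_0)

lemma generated_1: "field_embedding \<iota> \<Longrightarrow> 1 \<in> generated \<iota> X"
  using generated.scalar[of \<iota> 1 X] by (simp add: field_embedding_def)

lemma generated_power: "field_embedding \<iota> \<Longrightarrow> a \<in> generated \<iota> X \<Longrightarrow> a ^ k \<in> generated \<iota> X"
  by (induction k) (simp_all add: generated_1 generated.mult)

lemma generated_prod:
  "field_embedding \<iota> \<Longrightarrow> (\<And>a. a \<in> A \<Longrightarrow> h a \<in> generated \<iota> X) \<Longrightarrow> prod h A \<in> generated \<iota> X"
  by (induction A rule: infinite_finite_induct) (simp_all add: generated_1 generated.mult)

lemma mono_eval_in_generated:
  assumes "field_embedding \<iota>" "keys m \<subseteq> J"
  shows "mono_eval g m \<in> generated \<iota> (g ` J)"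
  unfolding mono_eval_def using assms
  by (intro generated_prod generated_power generated.generator) auto

lemma generated_sum:
  "field_embedding \<iota> \<Longrightarrow> (\<And>a. a \<in> A \<Longrightarrow> h a \<in> generated \<iota> X) \<Longrightarrow> sum h A \<in> generated \<iota> X"
  by (induction A rule: infinite_finite_induct) (simp_all add: generated_0 generated.add)

lemma generated_imp_poly_eval:
  assumes \<iota>: "field_embedding \<iota>" and "a \<in> generated \<iota> (g ` J)"
  shows "\<exists>p. (\<forall>m\<in>keys p. keys m \<subseteq> J) \<and> poly_eval \<iota> g p = a"
  using assms(2)
proof induction
  case (scalar c)
  show ?case
    by (rule exI[of _ "single 0 c"]) (simp add: poly_eval_single[OF \<iota>])
next
  case (generator v)
  then obtain i where "i \<in> J" "v = g i" by blast
  then show ?case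
    using \<iota> unfolding field_embedding_def
    by (intro exI[of _ "single (single i 1) 1"])
      (simp add: poly_eval_single[OF \<iota>] mono_eval_single)
next
  case (add a b)
  then obtain p q where pq: "\<forall>m\<in>keys p. keys m \<subseteq> J" "poly_eval \<iota> g p = a"
    "\<forall>m\<in>keys q. keys m \<subseteq> J" "poly_eval \<iota> g q = b" by blast
  have "\<forall>m\<in>keys (p + q). keys m \<subseteq> J"
    using keys_add[of p q] pq by blast
  then show ?case
    using pq by (intro exI[of _ "p + q"]) (simp add: poly_eval_add[OF \<iota>])
next
  case (mult a b)
  then obtain p q where pq: "\<forall>m\<in>keys p. keys m \<subseteq> J" "poly_eval \<iota> g p = a"
    "\<forall>m\<in>keys q. keys m \<subseteq> J" "poly_eval \<iota> g q = b" by blast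
  have "\<forall>m\<in>keys (p * q). keys m \<subseteq> J"
  proof
    fix m assume "m \<in> keys (p * q)"
    then obtain a b where ab: "a \<in> keys p" "b \<in> keys q" "m = a + b"
      using keys_mult[of p q] by blast
    then show "keys m \<subseteq> J"
      using keys_add[of a b] pq by blast
  qed
  then show ?case
    using pq by (intro exI[of _ "p * q"]) (simp add: poly_eval_mult[OF \<iota>])
qed

text \<open>The subalgebra R is a subset of the field and not a type, so polynomials over R are
  polynomials over the whole field with coefficients in R.\<close>

definition transcendental_over :: "'f::field set \<Rightarrow> 'f \<Rightarrow> bool" where
  "transcendental_over R k \<longleftrightarrow> (\<forall>q. (\<forall>j. coeff q j \<in> R) \<and> poly q k = 0 \<longrightarrow> q = 0)"

text \<open>Reversing the coefficients of a relation for 1/k gives a relation for k.\<close>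

lemma transcendental_over_inverse:
  assumes "field_embedding \<iota>" "transcendental_over (generated \<iota> X) k"
  shows "transcendental_over (generated \<iota> X) (inverse k)"
  unfolding transcendental_over_def
proof (intro allI impI, elim conjE)
  fix q assume q: "\<forall>j. coeff q j \<in> generated \<iota> X" "poly q (inverse k) = 0"
  \<comment> \<open>k is nonzero, since otherwise the polynomial X would be a relation.\<close>
  have "\<not> poly [:0, 1:] k = 0"
  proof
    have "\<forall>j. coeff [:0, 1:] j \<in> generated \<iota> X"
      using assms(1) by (simp add: coeff_pCons generated_0 generated_1 split: nat.split)
    moreover assume "poly [:0, 1:] k = 0"
    ultimately have "[:0, 1:] = (0 :: 'b poly)"
      using assms(2) unfolding transcendental_over_def by blast
    then show False by simp
  qed
  then have "poly (reflect_poly q) k = 0"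
    using q(2) by (simp add: poly_reflect_poly_nz)
  moreover have "\<forall>j. coeff (reflect_poly q) j \<in> generated \<iota> X"
    using q(1) assms(1) by (simp add: coeff_reflect_poly generated_0)
  ultimately show "q = 0"
    using assms(2) unfolding transcendental_over_def by (metis reflect_poly_eq_0_iff)
qed

text \<open>Substituting aX for X turns a relation q for ak into one for k. Its coefficients a^j q_j
  vanish only if those of q do, because a is nonzero.\<close>

lemma transcendental_over_mult:
  assumes "field_embedding \<iota>" "transcendental_over (generated \<iota> X) k" "a \<in> generated \<iota> X" "a \<noteq> 0"
  shows "transcendental_over (generated \<iota> X) (a * k)"
  unfolding transcendental_over_def
proof (intro allI impI, elim conjE)
  fix q assume q: "\<forall>j. coeff q j \<in> generated \<iota> X" "poly q (a * k) = 0"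
  have "\<forall>j. coeff (pcompose q [:0, a:]) j \<in> generated \<iota> X"
    using q(1) assms by (simp add: coeff_pcompose_linear generated.mult generated_power)
  moreover have "poly (pcompose q [:0, a:]) k = 0"
    using q(2) by (simp add: poly_pcompose mult.commute)
  ultimately have "pcompose q [:0, a:] = 0"
    using assms(2) unfolding transcendental_over_def by blast
  then have "a ^ j * coeff q j = 0" for j
    by (metis coeff_0 coeff_pcompose_linear)
  then show "q = 0"
    using assms(4) by (simp add: poly_eq_iff)
qed

text \<open>Serves exchange partners P/k and the passage from an edge to y_i. The quotient k/a is
  treated as the inverse of a/k, because 1/a need not lie in the subalgebra.\<close>

lemma transcendental_over_divide:
  assumes "field_embedding \<iota>" "transcendental_over (generated \<iota> X) k" "a \<in> generated \<iota> X" "a \<noteq> 0"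
  shows "transcendental_over (generated \<iota> X) (a / k)"
    and "transcendental_over (generated \<iota> X) (k / a)"
proof -
  show *: "transcendental_over (generated \<iota> X) (a / k)"
    using transcendental_over_mult[OF assms(1) transcendental_over_inverse[OF assms(1,2)] assms(3,4)]
    by (simp add: divide_inverse)
  show "transcendental_over (generated \<iota> X) (k / a)"
    using transcendental_over_inverse[OF assms(1) *] by (simp add: divide_inverse mult.commute)
qed

text \<open>The polynomial X - k would be a relation. This separates a new cluster variable from the
  ones that remain.\<close>

lemma not_transcendental_over_generated:
  assumes "field_embedding \<iota>" "k \<in> generated \<iota> X"
  shows "\<not> transcendental_over (generated \<iota> X) k"
proof
  assume t: "transcendental_over (generated \<iota> X) k"
  have "\<iota> (- 1) * k \<in> generated \<iota> X"
    using assms(2) by (intro generated.mult generated.scalar)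
  then have "- k \<in> generated \<iota> X"
    using assms(1) field_embedding_minus[OF assms(1), of 1] by (simp add: field_embedding_def)
  then have "\<forall>j. coeff [:- k, 1:] j \<in> generated \<iota> X"
    using assms(1) by (simp add: coeff_pCons generated_0 generated_1 split: nat.split)
  moreover have "poly [:- k, 1:] k = 0" by simp
  ultimately have "[:- k, 1:] = 0"
    using t unfolding transcendental_over_def by blast
  then show False by simp
qed

section \<open>Adjoining one element to an independent family\<close>

definition strip :: "'i \<Rightarrow> ('i \<Rightarrow>\<^sub>0 nat) \<Rightarrow> ('i \<Rightarrow>\<^sub>0 nat)" where
  "strip i m = m - single i (lookup m i)"

lemma strip_plus: "strip i m + single i (lookup m i) = m"
  by (rule poly_mapping_eqI) (simp add: strip_def lookup_add lookup_minus lookup_single when_def)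

lemma keys_strip: "keys (strip i m) = keys m - {i}"
  by (auto simp: strip_def in_keys_iff lookup_minus lookup_single when_def split: if_splits)

lemma strip_add_single:
  assumes "i \<notin> keys m"
  shows "strip i (m + single i j) = m"
    and "lookup (m + single i j) i = j"
proof -
  have "lookup m i = 0" using assms by (simp add: in_keys_iff)
  then show "strip i (m + single i j) = m"
    and "lookup (m + single i j) i = j"
    by (auto intro!: poly_mapping_eqI simp: strip_def lookup_add lookup_minus lookup_single when_def)
qed

text \<open>Sorting monomials by their power of the variable i turns a relation into a one-variable
  polynomial over the subalgebra of the others, and conversely. In both directions \<open>h\<close>
  sends (m, j), with m free of i, to m times the j-th power of i; \<open>strip\<close> and
  \<open>lookup\<close> give the inverse.\<close>

lemma alg_indep_insert:
  fixes \<iota> :: "'k::field \<Rightarrow> 'f::field" and g :: "'i \<Rightarrow> 'f"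
  assumes \<iota>: "field_embedding \<iota>" and i: "i \<notin> J"
  shows "alg_indep \<iota> g (insert i J) \<longleftrightarrow>
    alg_indep \<iota> g J \<and> transcendental_over (generated \<iota> (g ` J)) (g i)"
proof (intro iffI conjI)
  assume ind: "alg_indep \<iota> g (insert i J)"
  then show "alg_indep \<iota> g J"
    by (rule alg_indep_mono) blast
  show "transcendental_over (generated \<iota> (g ` J)) (g i)"
    unfolding transcendental_over_def
  proof (intro allI impI, elim conjE)
    fix q assume q: "\<forall>j. coeff q j \<in> generated \<iota> (g ` J)" "poly q (g i) = 0"
    have "\<forall>j. \<exists>p. (\<forall>m\<in>keys p. keys m \<subseteq> J) \<and> poly_eval \<iota> g p = coeff q j"
      using generated_imp_poly_eval[OF \<iota>] q(1) by blast
    then obtain p where p: "\<And>j m. m \<in> keys (p j) \<Longrightarrow> keys m \<subseteq> J"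
      "\<And>j. poly_eval \<iota> g (p j) = coeff q j" by metis
    define T where "T = (\<Union>j\<le>degree q. keys (p j))"
    define h where "h = (\<lambda>(m, j). m + single i (j::nat))"
    \<comment> \<open>The power of i in \<mu> selects the polynomial \<open>p j\<close>, and the
      i-free part of \<mu> selects the monomial in it.\<close>
    define c where "c \<mu> = lookup (p (lookup \<mu> i)) (strip i \<mu>)" for \<mu>
    have T: "finite T" "\<And>m. m \<in> T \<Longrightarrow> keys m \<subseteq> J"
      using p(1) by (auto simp: T_def)
    have iT: "i \<notin> keys m" if "m \<in> T" for m
      using T(2)[OF that] i by blast
    have ch: "c (h (m, j)) = lookup (p j) m" if "m \<in> T" for m j
      using strip_add_single[OF iT[OF that], of j] by (simp add: c_def h_def)
    have ch': "c (m + single i j) = lookup (p j) m" if "m \<in> T" for m j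
      using ch[OF that] by (simp add: h_def)
    have inj: "inj_on h (T \<times> {..degree q})"
    proof (rule inj_on_inverseI[where g = "\<lambda>\<mu>. (strip i \<mu>, lookup \<mu> i)"])
      fix x assume "x \<in> T \<times> {..degree q}"
      then show "(strip i (h x), lookup (h x) i) = x"
        using strip_add_single[OF iT] by (auto simp: h_def)
    qed
    have "(\<Sum>\<mu>\<in>h ` (T \<times> {..degree q}). \<iota> (c \<mu>) * mono_eval g \<mu>)
        = (\<Sum>(m, j)\<in>T \<times> {..degree q}. \<iota> (lookup (p j) m) * (mono_eval g m * g i ^ j))"
      unfolding sum.reindex[OF inj]
      by (rule sum.cong) (auto simp: ch' h_def mono_eval_add mono_eval_single )
    also have "\<dots> = (\<Sum>j\<le>degree q. (\<Sum>m\<in>T. \<iota> (lookup (p j) m) * mono_eval g m) * g i ^ j)"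
      unfolding sum.cartesian_product[symmetric]
      by (subst sum.swap) (simp add: sum_distrib_right mult.assoc)
    also have "\<dots> = (\<Sum>j\<le>degree q. coeff q j * g i ^ j)"
    proof (rule sum.cong)
      fix j assume "j \<in> {..degree q}"
      then have "keys (p j) \<subseteq> T" by (auto simp: T_def)
      from poly_eval_superset[OF \<iota> T(1) this, of g] p(2)[of j]
      show "(\<Sum>m\<in>T. \<iota> (lookup (p j) m) * mono_eval g m) * g i ^ j = coeff q j * g i ^ j"
        by simp
    qed simp
    also have "\<dots> = 0"
      using q(2) by (simp add: poly_altdef)
    finally have *: "(\<Sum>\<mu>\<in>h ` (T \<times> {..degree q}). \<iota> (c \<mu>) * mono_eval g \<mu>) = 0" .
    have "\<forall>\<mu>\<in>h ` (T \<times> {..degree q}). keys \<mu> \<subseteq> insert i J"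
    proof
      fix \<mu> assume "\<mu> \<in> h ` (T \<times> {..degree q})"
      then obtain m j where "m \<in> T" "\<mu> = m + single i j" by (auto simp: h_def)
      then show "keys \<mu> \<subseteq> insert i J"
        using T(2)[of m] keys_add[of m "single i j"] by (auto split: if_splits)
    qed
    from alg_indepD[OF ind _ this *] T(1) have "\<forall>\<mu>\<in>h ` (T \<times> {..degree q}). c \<mu> = 0"
      by blast
    then have z: "lookup (p j) m = 0" if "m \<in> T" "j \<le> degree q" for m j
      using that ch by force
    have "coeff q j = 0" if "j \<le> degree q" for j
    proof -
      have "lookup (p j) m = 0" for m
        using z[OF _ that, of m] that by (auto simp: T_def in_keys_iff)
      then have "p j = 0" by (intro poly_mapping_eqI) simp
      then show ?thesis using p(2)[of j] by simp
    qed
    then show "q = 0"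
      by (metis leading_coeff_0_iff order_refl)
  qed
next
  assume *: "alg_indep \<iota> g J \<and> transcendental_over (generated \<iota> (g ` J)) (g i)"
  show "alg_indep \<iota> g (insert i J)"
    unfolding alg_indep_def
  proof (intro allI impI, elim conjE)
    fix S :: "('i \<Rightarrow>\<^sub>0 nat) set" and c
    assume S: "finite S" "\<forall>m\<in>S. keys m \<subseteq> insert i J"
      and eq: "(\<Sum>m\<in>S. \<iota> (c m) * mono_eval g m) = 0"
    define T where "T = strip i ` S"
    define N where "N = Max ((\<lambda>m. lookup m i) ` S)"
    define h where "h = (\<lambda>(m, j). m + single i (j::nat))"
    define c' where "c' m = (if m \<in> S then c m else 0)" for m
    have T: "finite T" "\<And>m. m \<in> T \<Longrightarrow> keys m \<subseteq> J"
    proof -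
      show "finite T" using S(1) by (simp add: T_def)
      fix m assume "m \<in> T"
      then obtain \<mu> where "\<mu> \<in> S" "m = strip i \<mu>" by (auto simp: T_def)
      moreover from this have "keys \<mu> \<subseteq> insert i J" using S(2) by blast
      ultimately show "keys m \<subseteq> J" using keys_strip[of i \<mu>] by blast
    qed
    have iT: "i \<notin> keys m" if "m \<in> T" for m
      using T(2)[OF that] i by blast
    have inj: "inj_on h (T \<times> {..N})"
    proof (rule inj_on_inverseI[where g = "\<lambda>\<mu>. (strip i \<mu>, lookup \<mu> i)"])
      fix x assume "x \<in> T \<times> {..N}"
      then show "(strip i (h x), lookup (h x) i) = x"
        using strip_add_single[OF iT] by (auto simp: h_def)
    qed
    have hS: "(strip i m, lookup m i) \<in> T \<times> {..N}" if "m \<in> S" for m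
      using that S(1) by (auto simp: T_def N_def)
    have SI: "S \<subseteq> h ` (T \<times> {..N})"
    proof
      fix m assume "m \<in> S"
      with hS show "m \<in> h ` (T \<times> {..N})"
        by (intro image_eqI[of _ _ "(strip i m, lookup m i)"])
          (simp_all add: h_def strip_plus)
    qed
    \<comment> \<open>The coefficient of the j-th power of \<open>g i\<close>. Pairs whose monomial
      lies outside S enter with \<open>c'\<close> equal to 0, which makes the index set a full
      product.\<close>
    define a where "a j = (\<Sum>m\<in>T. \<iota> (c' (h (m, j))) * mono_eval g m)" for j
    define q where "q = (\<Sum>j\<le>N. monom (a j) j)"
    have coeff_q: "coeff q j = (if j \<le> N then a j else 0)" for j
      by (simp add: q_def coeff_sum coeff_monom)
    have "0 = (\<Sum>m\<in>S. \<iota> (c' m) * mono_eval g m)"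
      using eq by (simp add: c'_def)
    also have "\<dots> = (\<Sum>m\<in>h ` (T \<times> {..N}). \<iota> (c' m) * mono_eval g m)"
      using SI T(1) by (intro sum.mono_neutral_left) (auto simp: c'_def field_embedding_0[OF \<iota>])
    also have "\<dots> = (\<Sum>(m, j)\<in>T \<times> {..N}. \<iota> (c' (h (m, j))) * (mono_eval g m * g i ^ j))"
      unfolding sum.reindex[OF inj]
      by (rule sum.cong) (auto simp: h_def mono_eval_add mono_eval_single)
    also have "\<dots> = (\<Sum>j\<le>N. a j * g i ^ j)"
      unfolding sum.cartesian_product[symmetric] a_def
      by (subst sum.swap) (simp add: sum_distrib_right mult.assoc)
    also have "\<dots> = poly q (g i)"
      by (simp add: q_def poly_sum poly_monom)
    finally have "poly q (g i) = 0" by simp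
    moreover have "\<forall>j. coeff q j \<in> generated \<iota> (g ` J)"
      unfolding coeff_q a_def using T(2) \<iota>
      by (auto intro!: generated_sum generated.mult generated.scalar mono_eval_in_generated simp: generated_0)
    ultimately have "q = 0"
      using * unfolding transcendental_over_def by blast
    then have aj: "a j = 0" if "j \<le> N" for j
      using coeff_q[of j] that by simp
    have z: "c' (h (m, j)) = 0" if "j \<le> N" "m \<in> T" for m j
      using alg_indepD[OF conjunct1[OF *] T(1), of "\<lambda>m. c' (h (m, j))" m] aj[OF that(1)] that(2) T(2)
      by (simp add: a_def)
    show "\<forall>m\<in>S. c m = 0"
    proof
      fix m assume "m \<in> S"
      moreover from this have "c' (h (strip i m, lookup m i)) = 0"
        using hS z by blast
      ultimately show "c m = 0"
        by (simp add: h_def strip_plus c'_def)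
    qed
  qed
qed

lemma alg_indep_cong:
  assumes "\<And>i. i \<in> I \<Longrightarrow> g i = h i"
  shows "alg_indep \<iota> g I \<longleftrightarrow> alg_indep \<iota> h I"
proof -
  have "mono_eval g m = mono_eval h m" if "keys m \<subseteq> I" for m
    using that assms by (auto simp: mono_eval_def intro!: prod.cong)
  then have "(\<Sum>m\<in>S. \<iota> (c m) * mono_eval g m) = 0 \<longleftrightarrow> (\<Sum>m\<in>S. \<iota> (c m) * mono_eval h m) = 0"
    if "\<forall>m\<in>S. keys m \<subseteq> I" for S c
    using that by (simp cong: sum.cong)
  then show ?thesis
    unfolding alg_indep_def by (intro iff_allI) blast
qed

text \<open>Members are adjoined one at a time, and the transcendence condition of
  \<open>alg_indep_insert\<close> depends only on the image of the earlier ones. Injectivity keeps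
  each new value out of that image.\<close>

lemma alg_indep_reindex:
  fixes \<iota> :: "'k::field \<Rightarrow> 'f::field" and g :: "'i \<Rightarrow> 'f"
  assumes \<iota>: "field_embedding \<iota>" and "finite I" "inj_on g I" "alg_indep \<iota> (\<lambda>v. v) (g ` I)"
  shows "alg_indep \<iota> g I"
  using assms(2-)
proof (induction I rule: finite_induct)
  case empty
  show ?case
    unfolding alg_indep_def
  proof (intro allI impI, elim conjE)
    fix S :: "('i \<Rightarrow>\<^sub>0 nat) set" and c
    assume S: "\<forall>m\<in>S. keys m \<subseteq> {}" "(\<Sum>m\<in>S. \<iota> (c m) * mono_eval g m) = 0"
    \<comment> \<open>Without variables the only monomial is 1, so a relation is a vanishing
      scalar.\<close>
    then have "S = {} \<or> S = {0}" by auto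
    with S(2) show "\<forall>m\<in>S. c m = 0"
      by (auto simp: field_embedding_eq_0_iff[OF \<iota>])
  qed
next
  case (insert i I)
  from insert.prems(1) insert.hyps(2) have gi: "g i \<notin> g ` I" by (auto simp: inj_on_def)
  have "alg_indep \<iota> (\<lambda>v. v) (insert (g i) (g ` I))"
    using insert.prems(2) by simp
  then have "alg_indep \<iota> (\<lambda>v. v) (g ` I)" "transcendental_over (generated \<iota> (g ` I)) (g i)"
    using alg_indep_insert[OF \<iota> gi, of "\<lambda>v. v"] by auto
  then show ?case
    using alg_indep_insert[OF \<iota> insert.hyps(2), of g] insert by auto
qed

lemma alg_indep_scale:
  assumes \<iota>: "field_embedding \<iota>" and "alg_indep \<iota> g I" "i \<in> I"
    and a: "a \<in> generated \<iota> (g ` (I - {i}))" "a \<noteq> 0"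
  shows "alg_indep \<iota> (g(i := g i / a)) I"
proof -
  have I: "I = insert i (I - {i})" using assms(3) by blast
  let ?h = "g(i := g i / a)"
  have "alg_indep \<iota> g (insert i (I - {i}))" using assms(2) I by simp
  then have *: "alg_indep \<iota> g (I - {i})" "transcendental_over (generated \<iota> (g ` (I - {i}))) (g i)"
    using alg_indep_insert[OF \<iota>, of i "I - {i}" g] by auto
  have im: "?h ` (I - {i}) = g ` (I - {i})" by auto
  have "alg_indep \<iota> ?h (I - {i})"
    using *(1) alg_indep_cong[of "I - {i}" ?h g \<iota>] by simp
  then have "alg_indep \<iota> ?h (insert i (I - {i}))"
    using alg_indep_insert[OF \<iota>, of i "I - {i}" ?h] transcendental_over_divide(2)[OF \<iota> *(2) a]
    unfolding im by simp
  then show ?thesis using I by simp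
qed

section \<open>Seeds\<close>

text \<open>The invariant for induction along mutations: algebraic independence of the extended
  cluster stands in for free generation of the ambient field.\<close>

definition independent_seed :: "('k::field \<Rightarrow> 'f::field) \<Rightarrow> 'f seed \<Rightarrow> bool" where
  "independent_seed \<iota> s \<longleftrightarrow>
    finite (cluster s) \<and> finite (frozen s) \<and> cluster s \<inter> frozen s = {} \<and>
    alg_indep \<iota> (\<lambda>v. v) (cluster s \<union> frozen s) \<and> skew_symmetrizable_on (cluster s) (exmat s)"

text \<open>The same symmetrizer d works: positive factors pass through the maximum with 0, and this
  interchanges the two product terms of the mutation rule between the entries (y, z) and (z,
  y).\<close>

lemma skew_symmetrizable_on_mutation:
  assumes B: "skew_symmetrizable_on X B" and k: "k \<in> X"
  shows "skew_symmetrizable_on X (matrix_mutation B k)"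
proof -
  obtain d :: "'a \<Rightarrow> int" where d: "\<And>y. y \<in> X \<Longrightarrow> d y > 0"
    and skew: "\<And>y z. y \<in> X \<Longrightarrow> z \<in> X \<Longrightarrow> d y * B y z = - (d z * B z y)"
    using B unfolding skew_symmetrizable_on_def by blast
  have pos: "d y * max 0 a = max 0 (d y * a)" if "y \<in> X" for y a
    using d[OF that] by (simp add: max_def zero_le_mult_iff mult_le_0_iff)
  have mm: "d y * (max 0 (B y k) * max 0 (B k z)) = d z * (max 0 (- B z k) * max 0 (- B k y))"
    if "y \<in> X" "z \<in> X" for y z
  proof -
    have "d y * max 0 (B y k) = d k * max 0 (- B k y)"
      using pos[OF that(1), of "B y k"] pos[OF k, of "- B k y"] skew[OF that(1) k] by simp
    moreover have "d k * max 0 (B k z) = d z * max 0 (- B z k)"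
      using pos[OF that(2), of "- B z k"] pos[OF k, of "B k z"] skew[OF k that(2)] by simp
    ultimately show ?thesis by (metis mult.assoc mult.commute)
  qed
  have "d y * matrix_mutation B k y z = - (d z * matrix_mutation B k z y)" if "y \<in> X" "z \<in> X" for y z
    using skew[OF that] mm[OF that] mm[OF that(2,1)]
    by (simp add: matrix_mutation_def algebra_simps)
  then show ?thesis
    using d unfolding skew_symmetrizable_on_def by blast
qed

lemma skew_symmetrizable_on_diagonal:
  assumes "skew_symmetrizable_on X B" "k \<in> X"
  shows "B k k = 0"
  using assms unfolding skew_symmetrizable_on_def
  by (metis (no_types, opaque_lifting) equal_neg_zero less_numeral_extra(3) mult_eq_0_iff)

lemma lookup_exchange_monomials:
  assumes "finite (cluster s)" "finite (frozen s)"
  shows "lookup (pos_monomial s k) y =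
      (if y \<in> cluster s \<union> frozen s then nat (exmat s y k) else 0)"
    and "lookup (neg_monomial s k) y =
      (if y \<in> cluster s \<union> frozen s then nat (- exmat s y k) else 0)"
  using assms by (simp_all add: pos_monomial_def neg_monomial_def lookup_sum lookup_single when_def)

text \<open>The new variable is P/k, where P is a nonzero element of the subalgebra generated by the
  remaining variables. The exchange monomials avoid k because the diagonal of the exchange matrix is
  0.\<close>

lemma independent_seed_mutate:
  fixes \<iota> :: "'k::field_char_0 \<Rightarrow> 'f::field"
  assumes \<iota>: "field_embedding \<iota>" and s: "independent_seed \<iota> s" and k: "k \<in> cluster s"
  shows "independent_seed \<iota> (mutate k s)"
proof -
  define Y where "Y = cluster s \<union> frozen s - {k}"
  define k' where "k' = exchange_partner s k"
  define M1 where "M1 = pos_monomial s k"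
  define M2 where "M2 = neg_monomial s k"
  define P where "P = monomial_value M1 + monomial_value M2"
  have fin: "finite (cluster s)" "finite (frozen s)" and disj: "cluster s \<inter> frozen s = {}"
    and ind: "alg_indep \<iota> (\<lambda>v. v) (cluster s \<union> frozen s)"
    and sk: "skew_symmetrizable_on (cluster s) (exmat s)"
    using s unfolding independent_seed_def by auto
  have X: "cluster s \<union> frozen s = insert k Y" and kY: "k \<notin> Y" using k by (auto simp: Y_def)
  have indY: "alg_indep \<iota> (\<lambda>v. v) Y" and tr: "transcendental_over (generated \<iota> Y) k"
    using ind alg_indep_insert[OF \<iota> kY, of "\<lambda>v. v"] unfolding X by auto
  have keys: "keys M1 \<subseteq> Y" "keys M2 \<subseteq> Y"
    using skew_symmetrizable_on_diagonal[OF sk k]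
    by (auto simp: M1_def M2_def Y_def in_keys_iff lookup_exchange_monomials[OF fin] split: if_splits)
  have "P \<in> generated \<iota> Y"
    using mono_eval_in_generated[OF \<iota> keys(1), of "\<lambda>v. v"] mono_eval_in_generated[OF \<iota> keys(2), of "\<lambda>v. v"]
    by (auto simp: P_def monomial_value_eq_mono_eval intro: generated.add)
  moreover have "P \<noteq> 0"
  proof
    assume "P = 0"
    let ?p = "single M1 1 + single M2 (1::'k)"
    have "poly_eval \<iota> (\<lambda>v. v) ?p = 0"
      using \<open>P = 0\<close> \<iota> by (simp add: poly_eval_add[OF \<iota>] poly_eval_single[OF \<iota>] P_def
          monomial_value_eq_mono_eval field_embedding_def)
    moreover have "\<forall>m\<in>keys ?p. keys m \<subseteq> Y"
      using keys keys_add[of "single M1 1" "single M2 (1::'k)"] by auto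
    ultimately have "?p = 0" using alg_indep_poly_eval[OF indY] by blast
    \<comment> \<open>The coefficient is 1, or 2 if the two monomials agree; characteristic zero
      excludes both from being 0.\<close>
    then have "lookup ?p M1 = 0" by simp
    then show False by (auto simp: lookup_add lookup_single when_def split: if_splits)
  qed
  ultimately have tr': "transcendental_over (generated \<iota> Y) k'"
    using transcendental_over_divide(1)[OF \<iota> tr]
    by (simp add: k'_def exchange_partner_def P_def M1_def M2_def)
  then have k'Y: "k' \<notin> Y"
    using not_transcendental_over_generated[OF \<iota>] generated.generator by blast
  have ind': "alg_indep \<iota> (\<lambda>v. v) (insert k' Y)"
    using alg_indep_insert[OF \<iota> k'Y, of "\<lambda>v. v"] indY tr' by simp
  have cl: "cluster (mutate k s) = insert k' (cluster s - {k})" "frozen (mutate k s) = frozen s"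
    by (simp_all add: mutate_def k'_def Let_def)
  have Y': "cluster (mutate k s) \<union> frozen (mutate k s) = insert k' Y"
    unfolding cl
    using disj k by (auto simp: Y_def)
  have disj': "cluster (mutate k s) \<inter> frozen (mutate k s) = {}"
    unfolding cl using k'Y disj k by (auto simp: Y_def)
  have sk': "skew_symmetrizable_on (cluster (mutate k s)) (exmat (mutate k s))"
  proof -
    \<comment> \<open>The renaming carries the new cluster back to the old one, and the symmetrizer
      is transported along it.\<close>
    let ?\<sigma> = "transpose k k'"
    have \<sigma>: "?\<sigma> y \<in> cluster s" if "y \<in> insert k' (cluster s - {k})" for y
      using that k k'Y by (auto simp: transpose_def Y_def)
    obtain d :: "'f \<Rightarrow> int" where d: "\<forall>y\<in>cluster s. d y > 0"
      "\<forall>y\<in>cluster s. \<forall>z\<in>cluster s. d y * matrix_mutation (exmat s) k y z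
        = - (d z * matrix_mutation (exmat s) k z y)"
      using skew_symmetrizable_on_mutation[OF sk k] unfolding skew_symmetrizable_on_def by blast
    have e: "exmat (mutate k s) y z = matrix_mutation (exmat s) k (?\<sigma> y) (?\<sigma> z)" for y z
      by (simp add: mutate_def k'_def Let_def)
    show ?thesis
      unfolding skew_symmetrizable_on_def e cl
    proof (rule exI[of _ "\<lambda>y. d (?\<sigma> y)"], rule conjI; intro ballI)
      fix y assume y: "y \<in> insert k' (cluster s - {k})"
      show "d (?\<sigma> y) > 0" using d(1) \<sigma>[OF y] by blast
    next
      fix y z assume yz: "y \<in> insert k' (cluster s - {k})" "z \<in> insert k' (cluster s - {k})"
      show "d (?\<sigma> y) * matrix_mutation (exmat s) k (?\<sigma> y) (?\<sigma> z)
          = - (d (?\<sigma> z) * matrix_mutation (exmat s) k (?\<sigma> z) (?\<sigma> y))"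
        using d(2) \<sigma>[OF yz(1)] \<sigma>[OF yz(2)] by blast
    qed
  qed
  have "finite (cluster (mutate k s))" "finite (frozen (mutate k s))"
    unfolding cl using fin by simp_all
  with ind' disj' sk' show ?thesis
    unfolding independent_seed_def Y' by blast
qed

lemma independent_seed_if_geometric:
  assumes "geometric_seed \<iota> s"
  shows "independent_seed \<iota> s"
  using assms alg_indep_if_free unfolding geometric_seed_def independent_seed_def by blast

lemma seeds_independent:
  fixes \<iota> :: "'k::field_char_0 \<Rightarrow> 'f::field"
  assumes s0: "geometric_seed \<iota> s0" and "s \<in> seeds s0"
  shows "independent_seed \<iota> s \<and> frozen s = frozen s0"
  using assms(2)
proof induction
  case initial
  show ?case using independent_seed_if_geometric[OF s0] by simp
next
  case (mutation s k)
  moreover have "field_embedding \<iota>" using s0 by (simp add: geometric_seed_def)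
  ultimately have "independent_seed \<iota> (mutate k s)"
    using independent_seed_mutate by blast
  with mutation show ?case by (simp add: mutate_def Let_def)
qed

lemma alg_indep_nonzero:
  assumes \<iota>: "field_embedding \<iota>" and "alg_indep \<iota> g I" "i \<in> I"
  shows "g i \<noteq> 0"
proof
  assume "g i = 0"
  then have "poly_eval \<iota> g (single (single i 1) 1) = 0"
    by (simp add: poly_eval_single[OF \<iota>] mono_eval_single)
  then have "single (single i (1::nat)) (1::'a) = 0"
    using assms(3) by (intro alg_indep_poly_eval[OF assms(2)]) auto
  then show False by (metis lookup_single_eq lookup_zero zero_neq_one)
qed

text \<open>As a member of an algebraically independent cluster, k is nonzero, so the quotient
  defining its partner can be cleared. The unordered pairs of the formal relation may match in
  either order.\<close>

lemma exchange_relationD: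
  fixes \<iota> :: "'k::field_char_0 \<Rightarrow> 'f::field"
  assumes s0: "geometric_seed \<iota> s0" and "({u, v}, {M, M'}) \<in> exchange_relations s0"
  shows "u * v = monomial_value M + monomial_value M'"
proof -
  obtain s k where s: "s \<in> seeds s0" "k \<in> cluster s" "{u, v} = {k, exchange_partner s k}"
    "{M, M'} = {pos_monomial s k, neg_monomial s k}"
    using assms(2) unfolding exchange_relations_def by blast
  have "k \<noteq> 0"
    using seeds_independent[OF s0 s(1)] alg_indep_nonzero[of \<iota> "\<lambda>v. v"] s(2) s0
    unfolding independent_seed_def geometric_seed_def by blast
  moreover have "u * v = k * exchange_partner s k"
    using s(3) by (auto simp: doubleton_eq_iff)
  moreover have "monomial_value M + monomial_value M'
      = monomial_value (pos_monomial s k) + monomial_value (neg_monomial s k)"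
    using s(4) by (auto simp: doubleton_eq_iff)
  ultimately show ?thesis by (simp add: exchange_partner_def)
qed

lemma cluster_variables_Int_frozen:
  fixes \<iota> :: "'k::field_char_0 \<Rightarrow> 'f::field"
  assumes s0: "geometric_seed \<iota> s0"
  shows "cluster_variables s0 \<inter> frozen s0 = {}"
  using seeds_independent[OF s0] unfolding cluster_variables_def clusters_def independent_seed_def
  by blast

section \<open>Arcs of the polygon\<close>

text \<open>Vertices are indexed by all positive numbers modulo \<open>2n\<close>. The pair of a non-diameter diagonal
  or edge is then \<open>arc n a b\<close> with \<open>a < b < a + n\<close>, uniquely up to shifting both indices by \<open>n\<close>.\<close>

definition pt :: "nat \<Rightarrow> nat \<Rightarrow> nat" where
  "pt n k = (k - 1) mod (2 * n) + 1"

definition arc :: "nat \<Rightarrow> nat \<Rightarrow> nat \<Rightarrow> label" where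
  "arc n a b = orbit n {pt n a, pt n b}"

definition bl :: "nat \<Rightarrow> nat \<Rightarrow> label" where
  "bl n a = Blue {pt n a, pt n (a + n)}"

definition rd :: "nat \<Rightarrow> nat \<Rightarrow> label" where
  "rd n a = Red {pt n a, pt n (a + n)}"

abbreviation labels :: "nat \<Rightarrow> label set" where
  "labels n \<equiv> cluster_labels n \<union> edge_labels n"

lemma pt_id: "1 \<le> k \<Longrightarrow> k \<le> 2 * n \<Longrightarrow> pt n k = k"
  by (simp add: pt_def)

text \<open>The hypothesis guards the truncated difference k - 1 in \<open>pt\<close>; it recurs in
  all shift lemmas.\<close>

lemma pt_shift:
  assumes "1 \<le> k"
  shows "pt n (k + 2 * n) = pt n k"
proof -
  have "k + 2 * n - 1 = (k - 1) + 2 * n" using assms by simp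
  then show ?thesis by (simp only: pt_def mod_add_self2)
qed

lemma pt_shift': "1 \<le> k \<Longrightarrow> pt n (k + n + n) = pt n k"
  using pt_shift[of k n] by (simp add: mult_2 add.assoc)

lemma pt_shift_mult: "1 \<le> k \<Longrightarrow> pt n (k + j * (2 * n)) = pt n k"
proof (induction j)
  case (Suc j)
  have "pt n (k + Suc j * (2 * n)) = pt n ((k + j * (2 * n)) + 2 * n)"
    by (simp add: algebra_simps)
  also have "\<dots> = pt n k"
    using Suc pt_shift[of "k + j * (2 * n)" n] by simp
  finally show ?case .
qed simp

lemma pt_in_vertices: "1 \<le> n \<Longrightarrow> pt n k \<in> vertices n"
  by (simp add: pt_def vertices_def Suc_leI)

lemma pt_reduce:
  assumes "1 \<le> n" "1 \<le> (k::nat)"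
  obtains k0 j where "1 \<le> k0" "k0 \<le> 2 * n" "k = k0 + j * (2 * n)"
proof (rule that)
  show "k = ((k - 1) mod (2 * n) + 1) + (k - 1) div (2 * n) * (2 * n)"
    using assms by (metis One_nat_def add.commute add.left_commute div_mult_mod_eq le_add_diff_inverse)
  show "(k - 1) mod (2 * n) + 1 \<le> 2 * n"
    using assms by (simp add: Suc_leI)
qed simp

lemma antipode_pt:
  assumes "1 \<le> n" "1 \<le> k"
  shows "antipode n (pt n k) = pt n (k + n)"
proof -
  obtain k0 j where k: "1 \<le> k0" "k0 \<le> 2 * n" "k = k0 + j * (2 * n)"
    using pt_reduce[OF assms] by blast
  have "pt n (k + n) = pt n ((k0 + n) + j * (2 * n))" by (simp add: k(3) algebra_simps)
  also have "\<dots> = pt n (k0 + n)" using k by (intro pt_shift_mult) simp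
  finally have *: "pt n (k + n) = pt n (k0 + n)" .
  show ?thesis
  proof (cases "k0 \<le> n")
    case True
    then show ?thesis using k * by (simp add: pt_shift_mult pt_id antipode_def)
  next
    case False
    then have "pt n (k0 + n) = pt n ((k0 - n) + 2 * n)" by (simp add: mult_2)
    also have "\<dots> = k0 - n" using False k by (subst pt_shift) (auto simp: pt_id)
    finally show ?thesis using False k * by (simp add: pt_shift_mult pt_id antipode_def)
  qed
qed

lemma arc_eq_Orbit:
  assumes "1 \<le> n" "1 \<le> a" "1 \<le> b"
  shows "arc n a b = Orbit {{pt n a, pt n b}, {pt n (a + n), pt n (b + n)}}"
  using assms by (simp add: arc_def orbit_def antipode_pt)

lemma arc_shift:
  assumes "1 \<le> n" "1 \<le> a" "1 \<le> b"
  shows "arc n (a + n) (b + n) = arc n a b"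
  using assms by (simp add: arc_eq_Orbit pt_shift' insert_commute)

lemma arc_shift_mult:
  assumes "1 \<le> n" "1 \<le> a" "1 \<le> b"
  shows "arc n (a + j * n) (b + j * n) = arc n a b"
proof (induction j)
  case (Suc j)
  have "arc n (a + Suc j * n) (b + Suc j * n) = arc n ((a + j * n) + n) ((b + j * n) + n)"
    by (simp add: algebra_simps)
  then show ?case
    using Suc assms arc_shift[of n "a + j * n" "b + j * n"] by simp
qed simp

text \<open>Reads an arc from its other end, which replaces a length k by 2n - k. Arcs longer than a
  half turn are brought into normal form this way.\<close>

lemma arc_flip: "1 \<le> a \<Longrightarrow> arc n b (a + 2 * n) = arc n a b"
  by (simp add: arc_def pt_shift insert_commute)

lemma bl_shift: "1 \<le> a \<Longrightarrow> bl n (a + n) = bl n a"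
  by (simp add: bl_def pt_shift' insert_commute)

lemma rd_shift: "1 \<le> a \<Longrightarrow> rd n (a + n) = rd n a"
  by (simp add: rd_def pt_shift' insert_commute)

lemma shift_reduce:
  assumes "1 \<le> n" "1 \<le> (k::nat)"
  obtains k0 j where "1 \<le> k0" "k0 \<le> n" "k = k0 + j * n"
proof (rule that)
  show "k = ((k - 1) mod n + 1) + (k - 1) div n * n"
    using assms by (metis One_nat_def add.commute add.left_commute div_mult_mod_eq le_add_diff_inverse)
  show "(k - 1) mod n + 1 \<le> n"
    using assms by (simp add: Suc_leI)
qed simp

lemma arc_normal_form:
  assumes "1 \<le> n" "1 \<le> a" "a < b" "b < a + n"
  obtains a0 b0 j where "1 \<le> a0" "a0 \<le> n" "a0 < b0" "b0 < a0 + n"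
    "a = a0 + j * n" "b = b0 + j * n" "arc n a b = arc n a0 b0"
proof -
  obtain a0 j where a0: "1 \<le> a0" "a0 \<le> n" "a = a0 + j * n"
    using shift_reduce[OF assms(1,2)] by blast
  show thesis
    by (rule that[of a0 "b - j * n" j]) (use assms a0 arc_shift_mult[of n a0 "b - j * n" j] in auto)
qed

text \<open>Explicit vertex numbers in 1..2n for both members, on which equality of orbits can be
  decided.\<close>

lemma arc_coordinates:
  assumes "1 \<le> n" "1 \<le> a" "a \<le> n" "a < b" "b < a + n"
  shows "arc n a b = Orbit {{a, b}, {a + n, if b \<le> n then b + n else b - n}}"
proof -
  have "pt n (b + n) = (if b \<le> n then b + n else b - n)"
  proof (cases "b \<le> n")
    case False
    then have "pt n (b + n) = pt n ((b - n) + 2 * n)" by (simp add: mult_2)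
    also have "\<dots> = b - n" using False assms by (subst pt_shift) (auto simp: pt_id)
    finally show ?thesis using False by simp
  next
    case True
    then have "pt n (b + n) = b + n" using assms by (intro pt_id) auto
    with True show ?thesis by simp
  qed
  then show ?thesis using assms by (simp add: arc_eq_Orbit pt_id)
qed

lemma arc_inject:
  assumes "1 \<le> n" "1 \<le> a" "a \<le> n" "a < b" "b < a + n" "1 \<le> a'" "a' \<le> n" "a' < b'" "b' < a' + n"
    and "arc n a b = arc n a' b'"
  shows "a = a'" "b = b'"
proof -
  have "{{a, b}, {a + n, if b \<le> n then b + n else b - n}}
      = {{a', b'}, {a' + n, if b' \<le> n then b' + n else b' - n}}"
    using assms(10) unfolding arc_coordinates[OF assms(1-5)] arc_coordinates[OF assms(1,6-9)] label.inject .
  then have "{a, b} \<in> {{a', b'}, {a' + n, if b' \<le> n then b' + n else b' - n}}"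
    by (metis insertI1)
  then have "{a, b} = {a', b'} \<or> {a, b} = {a' + n, if b' \<le> n then b' + n else b' - n}"
    by blast
  then have "a = a' \<and> b = b'"
    using assms(1-9) by (auto simp: doubleton_eq_iff split: if_splits)
  then show "a = a'" "b = b'" by auto
qed

lemma arc_eq_imp_cong:
  assumes "1 \<le> n" "1 \<le> a" "a < b" "b < a + n" "1 \<le> a'" "a' < b'" "b' < a' + n"
    and "arc n a b = arc n a' b'"
  shows "a mod n = a' mod n" "b - a = b' - a'"
proof -
  obtain a0 b0 j where 1: "1 \<le> a0" "a0 \<le> n" "a0 < b0" "b0 < a0 + n"
    "a = a0 + j * n" "b = b0 + j * n" "arc n a b = arc n a0 b0"
    using arc_normal_form[OF assms(1-4)] by blast
  obtain a1 b1 j' where 2: "1 \<le> a1" "a1 \<le> n" "a1 < b1" "b1 < a1 + n"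
    "a' = a1 + j' * n" "b' = b1 + j' * n" "arc n a' b' = arc n a1 b1"
    using arc_normal_form[OF assms(1,5-7)] by blast
  have "a0 = a1" "b0 = b1"
    using arc_inject[OF assms(1) 1(1-4) 2(1-4)] assms(8) 1(7) 2(7) by simp_all
  then show "a mod n = a' mod n" "b - a = b' - a'" using 1 2 by auto
qed

lemma bl_inject:
  assumes "1 \<le> a" "a \<le> n" "1 \<le> a'" "a' \<le> n" "bl n a = bl n a' \<or> rd n a = rd n a'"
  shows "a = a'"
  using assms by (auto simp: bl_def rd_def pt_id doubleton_eq_iff)

lemma diameters_eq:
  assumes "1 \<le> n"
  shows "diameters n = (\<lambda>a. {pt n a, pt n (a + n)}) ` {1..n}"
proof (intro equalityI subsetI)
  fix d assume "d \<in> diameters n"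
  then obtain a where a: "1 \<le> a" "a \<le> 2 * n" "d = {a, antipode n a}"
    by (auto simp: diameters_def vertices_def)
  show "d \<in> (\<lambda>a. {pt n a, pt n (a + n)}) ` {1..n}"
  proof (cases "a \<le> n")
    case True
    then show ?thesis using a by (intro image_eqI[of _ _ a]) (auto simp: pt_id antipode_def)
  next
    case False
    then show ?thesis using a by (intro image_eqI[of _ _ "a - n"]) (auto simp: pt_id antipode_def)
  qed
next
  fix d assume "d \<in> (\<lambda>a. {pt n a, pt n (a + n)}) ` {1..n}"
  then show "d \<in> diameters n"
    by (auto simp: diameters_def vertices_def pt_id antipode_def)
qed

lemma Blue_diameters: "1 \<le> n \<Longrightarrow> Blue ` diameters n = bl n ` {1..n}"
  by (auto simp: diameters_eq bl_def)

lemma Red_diameters: "1 \<le> n \<Longrightarrow> Red ` diameters n = rd n ` {1..n}"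
  by (auto simp: diameters_eq rd_def)

lemma bl_rd_in_cluster_labels:
  assumes "1 \<le> n" "1 \<le> a"
  shows "bl n a \<in> cluster_labels n" "rd n a \<in> cluster_labels n"
proof -
  have "{pt n a, pt n (a + n)} = {pt n a, antipode n (pt n a)}"
    using assms by (simp add: antipode_pt)
  then have "{pt n a, pt n (a + n)} \<in> diameters n"
    unfolding diameters_def using pt_in_vertices[OF assms(1)] by blast
  then show "bl n a \<in> cluster_labels n" "rd n a \<in> cluster_labels n"
    by (auto simp: cluster_labels_def bl_def rd_def)
qed

lemma edge_labels_eq:
  assumes "1 \<le> n"
  shows "edge_labels n = (\<lambda>a. arc n a (a + 1)) ` {1..n}"
proof (intro equalityI subsetI)
  fix L assume "L \<in> edge_labels n"
  then consider i where "1 \<le> i" "i < 2 * n" "L = orbit n {i, i + 1}" | "L = orbit n {2 * n, 1}"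
    by (auto simp: edge_labels_def edges_def)
  then show "L \<in> (\<lambda>a. arc n a (a + 1)) ` {1..n}"
  proof cases
    case (1 i)
    then have L: "L = arc n i (i + 1)" by (simp add: arc_def pt_id)
    show ?thesis
    proof (cases "i \<le> n")
      case False
      then have "arc n i (i + 1) = arc n (i - n) (i - n + 1)"
        using arc_shift[of n "i - n" "i - n + 1"] assms by simp
      then show ?thesis using L False 1 by (intro image_eqI[of _ _ "i - n"]) auto
    qed (use L 1 in auto)
  next
    case 2
    then have "L = arc n (n + n) (n + 1 + n)"
      using assms pt_shift[of 1 n] by (simp add: arc_def pt_id mult_2[symmetric] insert_commute)
    then show ?thesis
      using arc_shift[of n n "n + 1"] assms by auto
  qed
next
  fix L assume "L \<in> (\<lambda>a. arc n a (a + 1)) ` {1..n}"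
  then obtain a where a: "1 \<le> a" "a \<le> n" "L = arc n a (a + 1)" by auto
  then have "L = orbit n {a, a + 1}" using assms by (simp add: arc_def pt_id)
  moreover have "{a, a + 1} \<in> edges n" using a assms by (auto simp: edges_def)
  ultimately show "L \<in> edge_labels n" by (auto simp: edge_labels_def)
qed

lemma diagonal_pair_labels_eq:
  assumes "2 \<le> n"
  shows "diagonal_pair_labels n = {arc n a b | a b. 1 \<le> a \<and> a \<le> n \<and> a + 1 < b \<and> b < a + n}"
proof (intro equalityI subsetI)
  fix L assume "L \<in> diagonal_pair_labels n"
  then obtain l where l: "l \<in> diagonals n - diameters n" "L = orbit n l"
    by (auto simp: diagonal_pair_labels_def)
  then obtain i j where ij: "1 \<le> i" "i < j" "j \<le> 2 * n" "l = {i, j}"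
  proof -
    obtain i j where ij: "i \<in> {1..2 * n}" "j \<in> {1..2 * n}" "i \<noteq> j" "l = {i, j}"
      using l by (auto simp: diagonals_def vertices_def)
    show thesis
      using that[of i j] that[of j i] ij by (cases "i < j") (auto simp: insert_commute)
  qed
  have nd: "j \<noteq> i + n"
  proof
    assume "j = i + n"
    then have "l = {i, antipode n i}" using ij by (simp add: antipode_def)
    then show False using l ij by (auto simp: diameters_def vertices_def)
  qed
  have ne: "j \<noteq> i + 1" "\<not> (i = 1 \<and> j = 2 * n)"
    using l ij by (auto simp: diagonals_def edges_def doubleton_eq_iff)
  have L: "L = arc n i j" using l ij by (simp add: arc_def pt_id)
  \<comment> \<open>The chord is already in normal form, needs a shift by n, or is longer than a
    half turn.\<close>
  consider "i \<le> n" "j < i + n" | "i > n" "j < i + n" | "j > i + n" using nd by linarith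
  then show "L \<in> {arc n a b | a b. 1 \<le> a \<and> a \<le> n \<and> a + 1 < b \<and> b < a + n}"
  proof cases
    case 1
    then have "1 \<le> i \<and> i \<le> n \<and> i + 1 < j \<and> j < i + n" using ij ne by linarith
    then show ?thesis using L by blast
  next
    case 2
    then have "L = arc n (i - n) (j - n)"
      using L ij arc_shift[of n "i - n" "j - n"] by simp
    moreover have "1 \<le> i - n \<and> i - n \<le> n \<and> i - n + 1 < j - n \<and> j - n < i - n + n"
      using 2 ij ne by linarith
    ultimately show ?thesis by blast
  next
    case 3
    \<comment> \<open>The long chord runs from j to i + 2n; shifting by -n gives the short arc from
      j - n to i + n.\<close>
    have "L = arc n ((j - n) + n) ((i + n) + n)"
      using L ij 3 arc_flip[of i n j] by (simp add: mult_2 add.assoc)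
    also have "\<dots> = arc n (j - n) (i + n)"
      using assms ij 3 by (intro arc_shift) auto
    finally have "L = arc n (j - n) (i + n)" .
    moreover have "1 \<le> j - n" "j - n \<le> n" "i + n < j - n + n" "j - n + 1 < i + n"
      using 3 ij ne assms by auto
    ultimately show ?thesis by blast
  qed
next
  fix L assume "L \<in> {arc n a b | a b. 1 \<le> a \<and> a \<le> n \<and> a + 1 < b \<and> b < a + n}"
  then obtain a b where ab: "1 \<le> a" "a \<le> n" "a + 1 < b" "b < a + n" "L = arc n a b" by blast
  then have "L = orbit n {a, b}" by (simp add: arc_def pt_id)
  moreover have "{a, b} \<in> diagonals n"
  proof -
    have "a \<in> vertices n" "b \<in> vertices n" "a \<noteq> b" using ab by (auto simp: vertices_def)
    then have "{a, b} \<in> {{i, j} | i j. i \<in> vertices n \<and> j \<in> vertices n \<and> i \<noteq> j}" by blast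
    moreover have "{a, b} \<notin> edges n"
      using ab by (auto simp: edges_def doubleton_eq_iff)
    ultimately show ?thesis by (simp add: diagonals_def)
  qed
  moreover have "{a, b} \<notin> diameters n"
    using ab by (auto simp: diameters_def vertices_def antipode_def doubleton_eq_iff split: if_splits)
  ultimately show "L \<in> diagonal_pair_labels n" by (auto simp: diagonal_pair_labels_def)
qed

lemma arc_in_diagonal_pair_labels:
  assumes "2 \<le> n" "1 \<le> a" "a + 1 < b" "b < a + n"
  shows "arc n a b \<in> diagonal_pair_labels n"
proof -
  have "1 \<le> n" "a < b" using assms by auto
  then obtain a0 b0 j where "1 \<le> a0" "a0 \<le> n" "a0 < b0" "b0 < a0 + n"
    "a = a0 + j * n" "b = b0 + j * n" "arc n a b = arc n a0 b0"
    using arc_normal_form[of n a b] assms by blast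
  then show ?thesis using assms by (auto simp: diagonal_pair_labels_eq[OF assms(1)])
qed

lemma arc_in_labels:
  assumes "2 \<le> n" "1 \<le> a" "a < b" "b < a + n"
  shows "arc n a b \<in> diagonal_pair_labels n \<union> edge_labels n"
proof (cases "b = a + 1")
  case True
  have "1 \<le> n" using assms by simp
  then obtain a0 b0 j where "1 \<le> a0" "a0 \<le> n" "a0 < b0" "b0 < a0 + n"
    "a = a0 + j * n" "b = b0 + j * n" "arc n a b = arc n a0 b0"
    using arc_normal_form[of n a b] assms by blast
  then show ?thesis using True assms by (auto simp: edge_labels_eq)
next
  case False
  then show ?thesis using arc_in_diagonal_pair_labels[OF assms(1,2)] assms by auto
qed

lemma arc_labels_cases:
  assumes "2 \<le> n" "L \<in> diagonal_pair_labels n \<union> edge_labels n"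
  obtains a b where "1 \<le> a" "a \<le> n" "a < b" "b < a + n" "L = arc n a b"
proof -
  have n: "1 \<le> n" using assms(1) by simp
  have "\<exists>a b. 1 \<le> a \<and> a \<le> n \<and> a < b \<and> b < a + n \<and> L = arc n a b"
    using assms(2)
  proof
    assume "L \<in> diagonal_pair_labels n"
    then obtain a b where "1 \<le> a" "a \<le> n" "a + 1 < b" "b < a + n" "L = arc n a b"
      unfolding diagonal_pair_labels_eq[OF assms(1)] by blast
    then show ?thesis by (intro exI[of _ a] exI[of _ b]) auto
  next
    assume "L \<in> edge_labels n"
    then obtain a where "1 \<le> a" "a \<le> n" "L = arc n a (a + 1)"
      unfolding edge_labels_eq[OF n] by auto
    then show ?thesis using assms(1) by (intro exI[of _ a] exI[of _ "a + 1"]) auto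
  qed
  then show thesis using that by blast
qed

lemma labels_cases:
  assumes "2 \<le> n" "L \<in> labels n"
  obtains (blue) a where "1 \<le> a" "a \<le> n" "L = bl n a"
    | (red) a where "1 \<le> a" "a \<le> n" "L = rd n a"
    | (arc) a b where "1 \<le> a" "a \<le> n" "a < b" "b < a + n" "L = arc n a b"
proof -
  consider "L \<in> diagonal_pair_labels n \<union> edge_labels n" | "L \<in> bl n ` {1..n}" | "L \<in> rd n ` {1..n}"
    using assms Blue_diameters[of n] Red_diameters[of n] by (auto simp: cluster_labels_def)
  then show thesis
  proof cases
    case 1
    then show thesis using arc_labels_cases[OF assms(1)] arc by blast
  qed (use blue red in auto)
qed

lemma finite_labels: "2 \<le> n \<Longrightarrow> finite (labels n)"
proof -
  assume n: "2 \<le> n"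
  have "diagonal_pair_labels n \<subseteq> (\<lambda>(a, b). arc n a b) ` ({1..n} \<times> {1..2 * n})"
    using n by (force simp: diagonal_pair_labels_eq)
  then have "finite (diagonal_pair_labels n)" by (rule finite_subset) simp
  then show ?thesis
    using n Blue_diameters[of n] Red_diameters[of n] by (simp add: cluster_labels_def edge_labels_eq)
qed

lemma cluster_labels_Int_edge_labels:
  assumes "2 \<le> n"
  shows "cluster_labels n \<inter> edge_labels n = {}"
proof -
  have False if L: "L \<in> diagonal_pair_labels n" "L \<in> edge_labels n" for L
  proof -
    obtain a b where ab: "1 \<le> a" "a \<le> n" "a + 1 < b" "b < a + n" "L = arc n a b"
      using L(1) unfolding diagonal_pair_labels_eq[OF assms] by blast
    obtain c where c: "1 \<le> c" "c \<le> n" "L = arc n c (c + 1)"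
      using L(2) assms by (auto simp: edge_labels_eq)
    show False
      using arc_inject[of n a b c "c + 1"] ab c assms by auto
  qed
  moreover have "L \<notin> Blue ` diameters n \<union> Red ` diameters n" if "L \<in> edge_labels n" for L
    using that by (auto simp: edge_labels_def orbit_def)
  ultimately show ?thesis by (auto simp: cluster_labels_def)
qed


section \<open>Crossings\<close>

text \<open>Once p is moved into 1..2n, the points beyond 2n form a final segment of the list.
  Rotating this segment to the front sorts the vertex numbers; \<open>ccw_pt4\<close> works in the
  same way.\<close>

lemma ccw_pt3:
  assumes "1 \<le> n" "1 \<le> p" "p < q" "q < r" "r < p + 2 * n"
  shows "ccw n [pt n p, pt n q, pt n r]"
proof -
  obtain p0 j where p0: "1 \<le> p0" "p0 \<le> 2 * n" "p = p0 + j * (2 * n)"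
    using pt_reduce[OF assms(1,2)] by blast
  define q0 where "q0 = q - j * (2 * n)"
  define r0 where "r0 = r - j * (2 * n)"
  have o: "p0 < q0" "q0 < r0" "r0 < p0 + 2 * n" using assms p0 by (auto simp: q0_def r0_def)
  have e: "q = q0 + j * (2 * n)" "r = r0 + j * (2 * n)"
    using assms p0 by (auto simp: q0_def r0_def)
  have pp: "pt n p = p0" "pt n q = pt n q0" "pt n r = pt n r0"
    using p0 o by (simp_all add: p0(3) e pt_shift_mult pt_id del: mult_2)
  have big: "pt n z = (if z \<le> 2 * n then z else z - 2 * n)" if "1 \<le> z" "z \<le> 4 * n" for z
    using that pt_shift[of "z - 2 * n" n] by (auto simp: pt_id)
  have "set [pt n p, pt n q, pt n r] \<subseteq> vertices n"
    using pt_in_vertices[OF assms(1)] by simp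
  moreover have "\<exists>i. sorted_wrt (<) (rotate i [p0, pt n q0, pt n r0])"
  proof -
    consider "r0 \<le> 2 * n" | "q0 \<le> 2 * n" "r0 > 2 * n" | "q0 > 2 * n" by linarith
    then show ?thesis
    proof cases
      case 1
      then show ?thesis using o p0 big by (intro exI[of _ 0]) simp
    next
      case 2
      then show ?thesis using o p0 big by (intro exI[of _ 2]) (simp add: numeral_2_eq_2; arith)
    next
      case 3
      then show ?thesis using o p0 big by (intro exI[of _ 1]) (simp; arith)
    qed
  qed
  ultimately show ?thesis unfolding ccw_def pp by simp
qed

lemma ccw_pt4:
  assumes "1 \<le> n" "1 \<le> p" "p < q" "q < r" "r < s" "s < p + 2 * n"
  shows "ccw n [pt n p, pt n q, pt n r, pt n s]"
proof -
  obtain p0 j where p0: "1 \<le> p0" "p0 \<le> 2 * n" "p = p0 + j * (2 * n)"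
    using pt_reduce[OF assms(1,2)] by blast
  define q0 where "q0 = q - j * (2 * n)"
  define r0 where "r0 = r - j * (2 * n)"
  define s0 where "s0 = s - j * (2 * n)"
  have o: "p0 < q0" "q0 < r0" "r0 < s0" "s0 < p0 + 2 * n"
    using assms p0 by (auto simp: q0_def r0_def s0_def)
  have e: "q = q0 + j * (2 * n)" "r = r0 + j * (2 * n)" "s = s0 + j * (2 * n)"
    using assms p0 by (auto simp: q0_def r0_def s0_def)
  have pp: "pt n p = p0" "pt n q = pt n q0" "pt n r = pt n r0" "pt n s = pt n s0"
    using p0 o by (simp_all add: p0(3) e pt_shift_mult pt_id del: mult_2)
  have big: "pt n z = (if z \<le> 2 * n then z else z - 2 * n)" if "1 \<le> z" "z \<le> 4 * n" for z
    using that pt_shift[of "z - 2 * n" n] by (auto simp: pt_id)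
  have "set [pt n p, pt n q, pt n r, pt n s] \<subseteq> vertices n"
    using pt_in_vertices[OF assms(1)] by simp
  moreover have "\<exists>i. sorted_wrt (<) (rotate i [p0, pt n q0, pt n r0, pt n s0])"
  proof -
    consider "s0 \<le> 2 * n" | "r0 \<le> 2 * n" "s0 > 2 * n" | "q0 \<le> 2 * n" "r0 > 2 * n" | "q0 > 2 * n"
      by linarith
    then show ?thesis
    proof cases
      case 1
      then show ?thesis using o p0 big by (intro exI[of _ 0]) simp
    next
      case 2
      then show ?thesis using o p0 big by (intro exI[of _ 3]) (simp add: numeral_3_eq_3; arith)
    next
      case 3
      then show ?thesis using o p0 big by (intro exI[of _ 2]) (simp add: numeral_2_eq_2; arith)
    next
      case 4
      then show ?thesis using o p0 big by (intro exI[of _ 1]) (simp; arith)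
    qed
  qed
  ultimately show ?thesis unfolding ccw_def pp by simp
qed

lemma diagonals_cross_pt:
  assumes "1 \<le> n" "1 \<le> p" "p < q" "q < r" "r < s" "s < p + 2 * n"
  shows "diagonals_cross n {pt n p, pt n r} {pt n q, pt n s}"
  using ccw_pt4[OF assms] unfolding diagonals_cross_def by blast

text \<open>A rotation matters only modulo 4. Each of the four cases puts the endpoints in
  increasing order, and either diagonal may own the smallest one.\<close>

lemma diagonals_cross_imp:
  assumes "diagonals_cross n l m"
  obtains i j k h where "1 \<le> i" "i < k" "k < j" "j < h" "h \<le> 2 * n"
    "l = {i, j} \<and> m = {k, h} \<or> l = {k, h} \<and> m = {i, j}"
proof -
  obtain a b c d r where *: "l = {a, c}" "m = {b, d}" "{a, b, c, d} \<subseteq> vertices n"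
    "sorted_wrt (<) (rotate r [a, b, c, d])"
    using assms unfolding diagonals_cross_def ccw_def by auto
  have "sorted_wrt (<) (rotate (r mod length [a, b, c, d]) [a, b, c, d])"
    using *(4) rotate_conv_mod[of r "[a, b, c, d]"] by metis
  then have "sorted_wrt (<) (rotate (r mod 4) [a, b, c, d])"
    by simp
  moreover have "r mod 4 = 0 \<or> r mod 4 = 1 \<or> r mod 4 = 2 \<or> r mod 4 = 3" by linarith
  ultimately have "a < b \<and> b < c \<and> c < d \<or> b < c \<and> c < d \<and> d < a \<or> c < d \<and> d < a \<and> a < b
      \<or> d < a \<and> a < b \<and> b < c"
    by (elim disjE) (simp_all add: numeral_2_eq_2 numeral_3_eq_3)
  moreover have v: "1 \<le> a" "1 \<le> b" "1 \<le> c" "1 \<le> d" "a \<le> 2 * n" "b \<le> 2 * n" "c \<le> 2 * n" "d \<le> 2 * n"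
    using *(3) by (auto simp: vertices_def)
  ultimately show thesis
  proof (elim disjE conjE)
    assume "a < b" "b < c" "c < d"
    then show thesis using v *(1,2) by (intro that[of a b c d]) auto
  next
    assume "b < c" "c < d" "d < a"
    then show thesis using v *(1,2) by (intro that[of b c d a]) auto
  next
    assume "c < d" "d < a" "a < b"
    then show thesis using v *(1,2) by (intro that[of c d a b]) auto
  next
    assume "d < a" "a < b" "b < c"
    then show thesis using v *(1,2) by (intro that[of d a b c]) auto
  qed
qed

text \<open>Crossing in the coordinates of the universal cover, with representatives chosen to
  interlace. The relation is oriented to save cases (arc before diameter, blue before red), so it
  has to be used in both orders. Among arcs, s may reach or exceed p + n.\<close>

inductive crossing :: "nat \<Rightarrow> label \<Rightarrow> label \<Rightarrow> bool" for n where
  arcs: "1 \<le> p \<Longrightarrow> p < q \<Longrightarrow> q < r \<Longrightarrow> r < s \<Longrightarrow> r < p + n \<Longrightarrow> s < q + n \<Longrightarrow>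
    crossing n (arc n p r) (arc n q s)"
| arc_blue: "1 \<le> p \<Longrightarrow> p < q \<Longrightarrow> q < r \<Longrightarrow> r < p + n \<Longrightarrow> crossing n (arc n p r) (bl n q)"
| arc_red: "1 \<le> p \<Longrightarrow> p < q \<Longrightarrow> q < r \<Longrightarrow> r < p + n \<Longrightarrow> crossing n (arc n p r) (rd n q)"
| blue_red: "1 \<le> p \<Longrightarrow> p < q \<Longrightarrow> q < p + n \<Longrightarrow> crossing n (bl n p) (rd n q)"

text \<open>A member with sorted endpoints i < j is the short way round from i to j, unless i + n <
  j; then the short way leads from j across the vertex 2n to i + 2n.\<close>

lemma arc_member:
  assumes "1 \<le> n" "1 \<le> a" "a \<le> n" "a < b" "b < a + n" "arc n a b = Orbit X" "{i, j} \<in> X" "i < j"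
  shows "1 \<le> i" "j \<le> 2 * n"
    "j < i + n \<and> Orbit X = arc n i j \<or> i + n < j \<and> Orbit X = arc n j (i + 2 * n)"
proof -
  have X: "X = {{a, b}, {a + n, if b \<le> n then b + n else b - n}}"
    using assms(6) arc_coordinates[OF assms(1-5)] by simp
  have b: "1 \<le> b" using assms by simp
  consider "{i, j} = {a, b}" | "b \<le> n" "{i, j} = {a + n, b + n}" | "b > n" "{i, j} = {b - n, a + n}"
    using assms(7) unfolding X by (auto simp: insert_commute split: if_splits)
  then have "1 \<le> i \<and> j \<le> 2 * n \<and>
    (j < i + n \<and> Orbit X = arc n i j \<or> i + n < j \<and> Orbit X = arc n j (i + 2 * n))"
  proof cases
    case 1
    then have "i = a" "j = b" using assms(4,8) by (auto simp: doubleton_eq_iff)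
    then show ?thesis using assms by simp
  next
    case 2
    then have "i = a + n" "j = b + n" using assms(4,8) by (auto simp: doubleton_eq_iff)
    then show ?thesis using assms(1-6) 2(1) arc_shift[OF assms(1,2) b] by simp
  next
    case 3
    then have ij: "i = b - n" "j = a + n" using assms(5,8) by (auto simp: doubleton_eq_iff)
    then have i2: "i + 2 * n = b + n" "1 \<le> i" "j \<le> 2 * n" "i + n < j" using 3(1) assms(1-5) by auto
    have "arc n b (a + 2 * n) = Orbit X" using arc_flip[OF assms(2)] assms(6) by simp
    moreover have "arc n j (i + 2 * n) = arc n a b"
      unfolding i2 ij(2) using arc_shift[OF assms(1,2) b] .
    ultimately have "Orbit X = arc n j (i + 2 * n)" using assms(6) by simp
    then show ?thesis using i2 by blast
  qed
  then show "1 \<le> i" "j \<le> 2 * n"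
    "j < i + n \<and> Orbit X = arc n i j \<or> i + n < j \<and> Orbit X = arc n j (i + 2 * n)"
    by blast+
qed

lemma bl_shift_mult: "1 \<le> a \<Longrightarrow> bl n (a + j * n) = bl n a"
proof (induction j)
  case (Suc j)
  have "a + Suc j * n = (a + j * n) + n" by simp
  then show ?case using Suc bl_shift[of "a + j * n" n] by (simp add: add_ac)
qed simp

lemma rd_shift_mult: "1 \<le> a \<Longrightarrow> rd n (a + j * n) = rd n a"
proof (induction j)
  case (Suc j)
  have "a + Suc j * n = (a + j * n) + n" by simp
  then show ?case using Suc rd_shift[of "a + j * n" n] by (simp add: add_ac)
qed simp

lemma Orbit_cluster_label_cases:
  assumes "2 \<le> n" "Orbit X \<in> cluster_labels n"
  obtains a b where "1 \<le> a" "a \<le> n" "a < b" "b < a + n" "arc n a b = Orbit X"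
proof -
  have "Orbit X \<in> diagonal_pair_labels n \<union> edge_labels n"
    using assms(2) by (auto simp: cluster_labels_def)
  then show thesis using arc_labels_cases[OF assms(1)] that by metis
qed

lemma orbit_member:
  assumes "2 \<le> n" "Orbit X \<in> cluster_labels n" "{i, j} \<in> X" "i < j"
  shows "1 \<le> i" "j \<le> 2 * n"
    "j < i + n \<and> Orbit X = arc n i j \<or> i + n < j \<and> Orbit X = arc n j (i + 2 * n)"
proof -
  have n: "1 \<le> n" using assms(1) by simp
  obtain a b where "1 \<le> a" "a \<le> n" "a < b" "b < a + n" "arc n a b = Orbit X"
    using Orbit_cluster_label_cases[OF assms(1,2)] by blast
  note * = arc_member[OF n this assms(3,4)]
  show "1 \<le> i" "j \<le> 2 * n"
    "j < i + n \<and> Orbit X = arc n i j \<or> i + n < j \<and> Orbit X = arc n j (i + 2 * n)"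
    by (fact *)+
qed

lemma arc_shift2:
  assumes "1 \<le> n" "1 \<le> a" "1 \<le> b"
  shows "arc n (a + 2 * n) (b + 2 * n) = arc n a b"
  using arc_shift_mult[OF assms, of 2] by simp

text \<open>Each chord may be short or have to be flipped. In all four cases suitable lifts by 2n
  interlace again; flipping one chord of the pair can interchange the order.\<close>

lemma orbits_cross_imp:
  assumes n: "2 \<le> n" and X: "Orbit X \<in> cluster_labels n" and Y: "Orbit Y \<in> cluster_labels n"
    and "{i, j} \<in> X" "{k, h} \<in> Y" "i < k" "k < j" "j < h"
  shows "crossing n (Orbit X) (Orbit Y) \<or> crossing n (Orbit Y) (Orbit X)"
proof -
  have n1: "1 \<le> n" using n by simp
  have ij: "i < j" and kh: "k < h" using assms by auto
  note mX = orbit_member[OF n X assms(4) ij] and mY = orbit_member[OF n Y assms(5) kh]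
  consider (A) "j < i + n" "Orbit X = arc n i j" "h < k + n" "Orbit Y = arc n k h"
    | (B) "i + n < j" "Orbit X = arc n j (i + 2 * n)" "h < k + n" "Orbit Y = arc n k h"
    | (C) "j < i + n" "Orbit X = arc n i j" "k + n < h" "Orbit Y = arc n h (k + 2 * n)"
    | (D) "i + n < j" "Orbit X = arc n j (i + 2 * n)" "k + n < h" "Orbit Y = arc n h (k + 2 * n)"
    using mX(3) mY(3) by blast
  then show ?thesis
  proof cases
    case A
    then have "crossing n (arc n i j) (arc n k h)"
      using assms(6-8) mX(1) by (intro crossing.arcs) auto
    then show ?thesis using A by simp
  next
    case B
    then have "crossing n (arc n k h) (arc n j (i + 2 * n))"
      using assms(6-8) mX(1) mY(1,2) by (intro crossing.arcs) auto
    then show ?thesis using B by simp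
  next
    case C
    then have "crossing n (arc n h (k + 2 * n)) (arc n (i + 2 * n) (j + 2 * n))"
      using assms(6-8) mX(1) mY(1,2) by (intro crossing.arcs) auto
    then show ?thesis using C arc_shift2[OF n1 mX(1), of j] ij by simp
  next
    case D
    then have "crossing n (arc n j (i + 2 * n)) (arc n h (k + 2 * n))"
      using assms(6-8) mX(1) mY(1,2) by (intro crossing.arcs) auto
    then show ?thesis using D by simp
  qed
qed

text \<open>The diameter at k has the lifts k, k + n and k + 2n in the cover; q is the one that
  falls strictly inside the short arc.\<close>

lemma orbit_diameter_cross_imp:
  assumes n: "2 \<le> n" and X: "Orbit X \<in> cluster_labels n" and "{i, j} \<in> X" "1 \<le> k" "k \<le> n"
    and "i < k \<and> k < j \<and> j < k + n \<or> k < i \<and> i < k + n \<and> k + n < j"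
  obtains p q r where "1 \<le> p" "p < q" "q < r" "r < p + n" "Orbit X = arc n p r"
    "bl n q = bl n k" "rd n q = rd n k"
proof -
  have ij: "i < j" using assms(6) by auto
  note mX = orbit_member[OF n X assms(3) ij]
  have s: "bl n (k + n) = bl n k" "rd n (k + n) = rd n k"
    "bl n (k + n + n) = bl n k" "rd n (k + n + n) = rd n k"
    using assms(4) by (simp_all add: bl_shift rd_shift)
  show thesis
    using mX(3)
  proof
    assume X': "j < i + n \<and> Orbit X = arc n i j"
    from assms(6) show thesis
    proof
      assume "i < k \<and> k < j \<and> j < k + n"
      then show thesis using X' mX(1) by (intro that[of i k j]) auto
    next
      assume "k < i \<and> i < k + n \<and> k + n < j"
      then show thesis using X' mX(1) s by (intro that[of i "k + n" j]) auto
    qed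
  next
    assume X': "i + n < j \<and> Orbit X = arc n j (i + 2 * n)"
    from assms(6) show thesis
    proof
      assume "i < k \<and> k < j \<and> j < k + n"
      then show thesis using X' mX(1,2) s assms(4,5) by (intro that[of j "k + n" "i + 2 * n"]) auto
    next
      assume "k < i \<and> i < k + n \<and> k + n < j"
      then show thesis using X' mX(1,2) s assms(4,5) by (intro that[of j "k + n + n" "i + 2 * n"]) auto
    qed
  qed
qed

lemma orbit_diameter_cross_imp':
  assumes n: "2 \<le> n" and X: "Orbit X \<in> cluster_labels n" "l \<in> X"
    and k: "1 \<le> k" "k \<le> n" and "diagonals_cross n l {k, k + n} \<or> diagonals_cross n {k, k + n} l"
  shows "crossing n (Orbit X) (bl n k)" "crossing n (Orbit X) (rd n k)"
proof -
  have dk: "u = k \<and> v = k + n" if "{k, k + n} = {u, v}" "u < v" for u v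
    using that n by (auto simp: doubleton_eq_iff)
  have "\<exists>i j k' h. i < k' \<and> k' < j \<and> j < h \<and>
      (l = {i, j} \<and> {k, k + n} = {k', h} \<or> l = {k', h} \<and> {k, k + n} = {i, j})"
    using assms(6)
  proof
    assume "diagonals_cross n l {k, k + n}"
    then show ?thesis by (rule diagonals_cross_imp) blast
  next
    assume "diagonals_cross n {k, k + n} l"
    then show ?thesis by (rule diagonals_cross_imp) blast
  qed
  then obtain i j k' h where o: "i < k'" "k' < j" "j < h"
    and "l = {i, j} \<and> {k, k + n} = {k', h} \<or> l = {k', h} \<and> {k, k + n} = {i, j}" by blast
  from this(4) have "\<exists>i j. l = {i, j} \<and> (i < k \<and> k < j \<and> j < k + n \<or> k < i \<and> i < k + n \<and> k + n < j)"
  proof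
    assume "l = {i, j} \<and> {k, k + n} = {k', h}"
    then show ?thesis using dk[of k' h] o by (intro exI[of _ i] exI[of _ j]) auto
  next
    assume "l = {k', h} \<and> {k, k + n} = {i, j}"
    then show ?thesis using dk[of i j] o by (intro exI[of _ k'] exI[of _ h]) auto
  qed
  then obtain i j where ij: "{i, j} \<in> X"
    "i < k \<and> k < j \<and> j < k + n \<or> k < i \<and> i < k + n \<and> k + n < j" using X(2) by blast
  obtain p q r where pqr: "1 \<le> p" "p < q" "q < r" "r < p + n" "Orbit X = arc n p r"
    "bl n q = bl n k" "rd n q = rd n k"
    using orbit_diameter_cross_imp[OF n X(1) ij(1) k ij(2)] by blast
  show "crossing n (Orbit X) (bl n k)" "crossing n (Orbit X) (rd n k)"
    using crossing.arc_blue[OF pqr(1-4)] crossing.arc_red[OF pqr(1-4)] pqr(5-7) by simp_all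
qed

lemma labels_cross_imp_crossing:
  assumes n: "2 \<le> n" and L: "L \<in> cluster_labels n" and M: "M \<in> cluster_labels n"
    and "labels_cross n L M"
  shows "crossing n L M \<or> crossing n M L"
proof -
  have n1: "1 \<le> n" using n by simp
  have BL: "\<exists>k. 1 \<le> k \<and> k \<le> n \<and> d = {k, k + n} \<and> Blue d = bl n k" if "Blue d \<in> cluster_labels n" for d
    using that by (auto simp: cluster_labels_def diagonal_pair_labels_def orbit_def diameters_eq[OF n1] bl_def pt_id)
  have RD: "\<exists>k. 1 \<le> k \<and> k \<le> n \<and> d = {k, k + n} \<and> Red d = rd n k" if "Red d \<in> cluster_labels n" for d
    using that by (auto simp: cluster_labels_def diagonal_pair_labels_def orbit_def diameters_eq[OF n1] rd_def pt_id)
  have BR: "crossing n (Blue d) (Red d')"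
    if d: "Blue d \<in> cluster_labels n" "Red d' \<in> cluster_labels n" "d \<noteq> d'" for d d'
  proof -
    obtain a where a: "1 \<le> a" "a \<le> n" "d = {a, a + n}" "Blue d = bl n a" using BL[OF d(1)] by blast
    obtain b where b: "1 \<le> b" "b \<le> n" "d' = {b, b + n}" "Red d' = rd n b" using RD[OF d(2)] by blast
    \<comment> \<open>For b < a the red diameter is lifted to b + n, which lies between a and a +
      n.\<close>
    have "a < b \<or> b < a" using a b d(3) by auto
    then show ?thesis
    proof
      assume "a < b"
      then show ?thesis using a b crossing.blue_red[of a b n] by simp
    next
      assume "b < a"
      then show ?thesis using a b crossing.blue_red[of a "b + n" n] rd_shift[of b n] by simp
    qed
  qed
  show ?thesis
  proof (cases L)
    case LX: (Orbit X)
    show ?thesis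
    proof (cases M)
      case MY: (Orbit Y)
      obtain l m where lm: "l \<in> X" "m \<in> Y" "diagonals_cross n l m" using assms(4) LX MY by auto
      obtain i j k h where "i < k" "k < j" "j < h" "l = {i, j} \<and> m = {k, h} \<or> l = {k, h} \<and> m = {i, j}"
        using lm(3) by (rule diagonals_cross_imp)
      then show ?thesis
        using orbits_cross_imp[OF n, of X Y i j k h] orbits_cross_imp[OF n, of Y X i j k h] L M lm LX MY
        by blast
    next
      case MB: (Blue d)
      obtain k where k: "1 \<le> k" "k \<le> n" "d = {k, k + n}" "Blue d = bl n k"
        using BL[of d] M MB by auto
      obtain l where "l \<in> X" "diagonals_cross n l d" using assms(4) LX MB by auto
      then have "crossing n (Orbit X) (bl n k)"
        using orbit_diameter_cross_imp'(1)[OF n, of X l k] L LX k by simp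
      then show ?thesis using LX MB k by simp
    next
      case MR: (Red d)
      obtain k where k: "1 \<le> k" "k \<le> n" "d = {k, k + n}" "Red d = rd n k"
        using RD[of d] M MR by auto
      obtain l where "l \<in> X" "diagonals_cross n l d" using assms(4) LX MR by auto
      then have "crossing n (Orbit X) (rd n k)"
        using orbit_diameter_cross_imp'(2)[OF n, of X l k] L LX k by simp
      then show ?thesis using LX MR k by simp
    qed
  next
    case LB: (Blue d)
    show ?thesis
    proof (cases M)
      case MY: (Orbit Y)
      obtain k where k: "1 \<le> k" "k \<le> n" "d = {k, k + n}" "Blue d = bl n k"
        using BL[of d] L LB by auto
      obtain l where "l \<in> Y" "diagonals_cross n d l" using assms(4) LB MY by auto
      then have "crossing n (Orbit Y) (bl n k)"
        using orbit_diameter_cross_imp'(1)[OF n, of Y l k] M MY k by simp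
      then show ?thesis using LB MY k by simp
    next
      case (Red d')
      then show ?thesis using assms(4) LB BR[of d d'] L M by simp
    qed (use assms(4) LB in simp)
  next
    case LR: (Red d)
    show ?thesis
    proof (cases M)
      case MY: (Orbit Y)
      obtain k where k: "1 \<le> k" "k \<le> n" "d = {k, k + n}" "Red d = rd n k"
        using RD[of d] L LR by auto
      obtain l where "l \<in> Y" "diagonals_cross n d l" using assms(4) LR MY by auto
      then have "crossing n (Orbit Y) (rd n k)"
        using orbit_diameter_cross_imp'(2)[OF n, of Y l k] M MY k by simp
      then show ?thesis using LR MY k by simp
    next
      case (Blue d')
      then show ?thesis using assms(4) LR BR[of d' d] L M by auto
    qed (use assms(4) LR in simp)
  qed
qed

lemma crossing_imp:
  assumes n: "2 \<le> n" and "crossing n L M"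
  shows "L \<in> cluster_labels n" "M \<in> cluster_labels n" "labels_cross n L M"
proof -
  have n1: "1 \<le> n" using n by simp
  have arc: "arc n a b \<in> cluster_labels n" if "1 \<le> a" "a + 1 < b" "b < a + n" for a b
    using arc_in_diagonal_pair_labels[OF n that] by (simp add: cluster_labels_def)
  have "L \<in> cluster_labels n \<and> M \<in> cluster_labels n \<and> labels_cross n L M"
    using assms(2)
  proof cases
    case (arcs p q r s)
    have "diagonals_cross n {pt n p, pt n r} {pt n q, pt n s}"
      using arcs by (intro diagonals_cross_pt n1) auto
    then show ?thesis
      using arcs arc[of p r] arc[of q s] by (simp add: arc_eq_Orbit n1)
  next
    case (arc_blue p q r)
    have "diagonals_cross n {pt n p, pt n r} {pt n q, pt n (q + n)}"
      using arc_blue by (intro diagonals_cross_pt n1) auto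
    then show ?thesis
      using arc_blue arc[of p r] bl_rd_in_cluster_labels[OF n1, of q] by (simp add: arc_eq_Orbit n1 bl_def)
  next
    case (arc_red p q r)
    have "diagonals_cross n {pt n p, pt n r} {pt n q, pt n (q + n)}"
      using arc_red by (intro diagonals_cross_pt n1) auto
    then show ?thesis
      using arc_red arc[of p r] bl_rd_in_cluster_labels[OF n1, of q] by (simp add: arc_eq_Orbit n1 rd_def)
  next
    case (blue_red p q)
    obtain p0 j where p0: "1 \<le> p0" "p0 \<le> n" "p = p0 + j * n" using shift_reduce[OF n1 blue_red(3)] by blast
    have shift: "rd n (a + j * n) = rd n a" "bl n (a + j * n) = bl n a" if "1 \<le> a" for a
      using that by (simp_all add: bl_shift_mult rd_shift_mult)
    define q0 where "q0 = q - j * n"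
    have q0: "p0 < q0" "q0 < p0 + n" "q = q0 + j * n" using blue_red p0 by (auto simp: q0_def)
    have L: "L = Blue {p0, p0 + n}" using blue_red shift[of p0] p0 by (simp add: bl_def pt_id)
    have "rd n q = rd n q0" using shift(1)[of q0] q0 by simp
    moreover have "rd n q0 = (if q0 \<le> n then Red {q0, q0 + n} else Red {q0 - n, q0})"
    proof (cases "q0 \<le> n")
      case False
      then have "rd n q0 = rd n (q0 - n)" using rd_shift[of "q0 - n" n] by simp
      then show ?thesis using False q0 p0 by (simp add: rd_def pt_id)
    qed (use q0 p0 in \<open>simp add: rd_def pt_id\<close>)
    ultimately have "labels_cross n L M"
      using L blue_red q0 p0 by (auto simp: doubleton_eq_iff)
    then show ?thesis using blue_red bl_rd_in_cluster_labels[OF n1, of p] bl_rd_in_cluster_labels[OF n1, of q]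
      by simp
  qed
  then show "L \<in> cluster_labels n" "M \<in> cluster_labels n" "labels_cross n L M" by blast+
qed

text \<open>Only two arcs could coincide. Equal orbits force q to be congruent to p modulo n,
  whereas 0 < q - p < n.\<close>

lemma not_crossing_self:
  assumes n: "2 \<le> n"
  shows "\<not> crossing n L L"
proof
  have n1: "1 \<le> n" using n by simp
  assume "crossing n L L"
  then show False
  proof cases
    case (arcs p q r s)
    have "q mod n = p mod n"
      using arc_eq_imp_cong(1)[OF n1, of q s p r] arcs by simp
    then have "n dvd q - p" using arcs mod_eq_dvd_iff_nat[of p q n] by simp
    then have "n \<le> q - p" using arcs by (intro dvd_imp_le) auto
    then show False using arcs by simp
  qed (auto simp: arc_def orbit_def bl_def rd_def)
qed

lemma finite_cluster_labels: "2 \<le> n \<Longrightarrow> finite (cluster_labels n)"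
  using finite_labels by simp

section \<open>Compatibility and triangulations\<close>

lemma noncrossing_extends:
  assumes n: "2 \<le> n" and T: "noncrossing n T"
  obtains T' where "T' \<in> triangulations n" "T \<subseteq> T'"
proof -
  let ?A = "{T'. noncrossing n T' \<and> T \<subseteq> T'}"
  have "finite ?A"
    by (rule finite_subset[of _ "Pow (cluster_labels n)"])
      (auto simp: noncrossing_def finite_cluster_labels[OF n])
  moreover have "T \<in> ?A" using T by simp
  ultimately obtain T' where "T' \<in> ?A" "\<forall>T''\<in>?A. T' \<subseteq> T'' \<longrightarrow> T' = T''"
    using finite_has_maximal2[of ?A T] by blast
  then have "T' \<in> triangulations n" "T \<subseteq> T'" unfolding triangulations_def by auto
  then show thesis by (rule that)
qed

text \<open>Non-crossing is a pairwise condition, so two labels that do not cross already form a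
  non-crossing set, and this extends to a maximal one.\<close>

lemma incompatible_iff_crossing:
  assumes n: "2 \<le> n" and L: "L \<in> cluster_labels n" and M: "M \<in> cluster_labels n"
  shows "(\<exists>T\<in>triangulations n. L \<in> T \<and> M \<in> T) \<longleftrightarrow> \<not> crossing n L M \<and> \<not> crossing n M L"
proof
  assume "\<exists>T\<in>triangulations n. L \<in> T \<and> M \<in> T"
  then show "\<not> crossing n L M \<and> \<not> crossing n M L"
    using crossing_imp(3)[OF n] unfolding triangulations_def noncrossing_def by blast
next
  assume "\<not> crossing n L M \<and> \<not> crossing n M L"
  then have "noncrossing n {L, M}"
    using labels_cross_imp_crossing[OF n] not_crossing_self[OF n] L M
    unfolding noncrossing_def by blast
  then obtain T' where "T' \<in> triangulations n" "{L, M} \<subseteq> T'"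
    using noncrossing_extends[OF n] by blast
  then show "\<exists>T\<in>triangulations n. L \<in> T \<and> M \<in> T" by blast
qed

text \<open>Maximality: a red diameter crosses the blue one at any other vertex, and a proper arc
  from a crosses the blue diameter at a + 1.\<close>

lemma all_blue_triangulation:
  assumes n: "2 \<le> n"
  shows "bl n ` {1..n} \<in> triangulations n"
proof -
  have n1: "1 \<le> n" using n by simp
  have "noncrossing n (bl n ` {1..n})"
    using bl_rd_in_cluster_labels[OF n1] by (auto simp: noncrossing_def bl_def)
  moreover have "L \<in> bl n ` {1..n}" if T: "noncrossing n T" "bl n ` {1..n} \<subseteq> T" "L \<in> T" for T L
  proof -
    have nc: "\<not> crossing n L (bl n a)" "\<not> crossing n (bl n a) L" if a: "1 \<le> a" for a
    proof -
      obtain a0 j where "1 \<le> a0" "a0 \<le> n" "a = a0 + j * n" using shift_reduce[OF n1 a] by blast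
      then have "bl n a \<in> T" using T(2) by (auto simp: bl_shift_mult)
      then show "\<not> crossing n L (bl n a)" "\<not> crossing n (bl n a) L"
        using crossing_imp(3)[OF n] T(1,3) unfolding noncrossing_def by blast+
    qed
    have Lc: "L \<in> cluster_labels n" using T by (auto simp: noncrossing_def)
    then have "L \<in> labels n" by simp
    from n this show ?thesis
    proof (cases rule: labels_cases)
      case (red a)
      show ?thesis
      proof (cases "a = 1")
        case True
        \<comment> \<open>The red diameter at 1 is read at 1 + n, so that it follows the blue one at
          n.\<close>
        then show ?thesis
          using nc(2)[of n] crossing.blue_red[of n "a + n" n] rd_shift[of a n] red n by simp
      next
        case False
        then show ?thesis using nc(2)[of 1] crossing.blue_red[of 1 a n] red n by simp
      qed
    next
      case (arc a b)
      have "b \<noteq> a + 1"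
      proof
        assume "b = a + 1"
        then have "L \<in> edge_labels n" using arc edge_labels_eq[OF n1] by auto
        then show False using Lc cluster_labels_Int_edge_labels[OF n] by blast
      qed
      then show ?thesis using nc(1)[of "a + 1"] crossing.arc_blue[of a "a + 1" b n] arc by simp
    qed auto
  qed
  ultimately show ?thesis
    unfolding triangulations_def by blast
qed

section \<open>Values of the variables\<close>

lemma pt_neq:
  assumes "1 \<le> k" "k < l" "l < k + 2 * n"
  shows "pt n k \<noteq> pt n l"
proof
  assume "pt n k = pt n l"
  then have "(l - 1) mod (2 * n) = (k - 1) mod (2 * n)" by (simp add: pt_def)
  then have "2 * n dvd (l - 1) - (k - 1)" using assms mod_eq_dvd_iff_nat[of "k - 1" "l - 1" "2 * n"] by simp
  then have "2 * n \<le> (l - 1) - (k - 1)" using assms by (intro dvd_imp_le) auto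
  then show False using assms by simp
qed

text \<open>The chords {a, b + n} and {b, a + n} are antipodal to each other and hence form one
  orbit.\<close>

lemma arc_antipode:
  assumes "1 \<le> n" "1 \<le> a" "1 \<le> b"
  shows "arc n a (b + n) = arc n b (a + n)"
proof -
  have "arc n a (b + n) = arc n (b + n) (a + n + n)"
    using arc_flip[of a n "b + n"] assms by (simp add: mult_2 add.assoc)
  also have "\<dots> = arc n b (a + n)" using assms by (intro arc_shift) auto
  finally show ?thesis .
qed

lemma seg_pt_arc:
  assumes "1 \<le> n" "1 \<le> a" "a < b" "b < a + 2 * n" "b \<noteq> a + n"
  shows "seg n (pt n a) (pt n b) = arc n a b"
proof -
  have "pt n b \<noteq> pt n (a + n)"
    using pt_neq[of b "a + n" n] pt_neq[of "a + n" b n] assms by (cases "b < a + n") auto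
  then show ?thesis using assms by (simp add: seg_def antipode_pt arc_def)
qed

lemma seg_pt_bl:
  assumes "1 \<le> n" "1 \<le> a"
  shows "seg n (pt n a) (pt n (a + n)) = bl n a"
  using assms by (simp add: seg_def antipode_pt bl_def)

lemma red_pt:
  assumes "1 \<le> n" "1 \<le> a"
  shows "red n (pt n a) = rd n a"
  using assms by (simp add: red_def antipode_pt rd_def)

locale D_model =
  fixes \<iota> :: "'k::field_char_0 \<Rightarrow> 'f::field"
    and s0 :: "'f seed"
    and n :: nat
    and x :: "label \<Rightarrow> 'f"
  assumes n2: "2 \<le> n"
    and s0: "geometric_seed \<iota> s0"
    and model: "polygon_model n s0 x"
begin

lemma n1: "1 \<le> n"
  using n2 by simp

lemma \<iota>: "field_embedding \<iota>"
  using s0 by (simp add: geometric_seed_def)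

lemma cluster_variables_eq: "cluster_variables s0 = x ` cluster_labels n"
  and frozen_eq: "frozen s0 = x ` edge_labels n"
  using model by (auto simp: polygon_model_def bij_betw_def)

lemma all_variables_eq: "all_variables s0 = x ` labels n"
  by (simp add: cluster_variables_eq frozen_eq image_Un)

lemma inj_x: "inj_on x (labels n)"
proof -
  have "inj_on x (cluster_labels n)" "inj_on x (edge_labels n)"
    using model by (auto simp: polygon_model_def bij_betw_def)
  moreover have "x ` cluster_labels n \<inter> x ` edge_labels n = {}"
    using cluster_variables_Int_frozen[OF s0] by (simp add: cluster_variables_eq frozen_eq)
  ultimately show ?thesis
    by (auto simp: inj_on_Un)
qed

abbreviation "B a \<equiv> x (bl n a)"
abbreviation "R a \<equiv> x (rd n a)"
abbreviation "A a b \<equiv> x (arc n a b)"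

text \<open>\<open>Inl\<close> indexes the blue diameters and \<open>Inr\<close> the edges.\<close>

abbreviation "Idx \<equiv> Inl ` {1..n} \<union> Inr ` {1..n} :: (nat + nat) set"

definition initial_family :: "nat + nat \<Rightarrow> 'f" where
  "initial_family i = (case i of Inl a \<Rightarrow> B a | Inr a \<Rightarrow> A a (a + 1))"

lemma edge_arc_in_edge_labels: "a \<in> {1..n} \<Longrightarrow> arc n a (a + 1) \<in> edge_labels n"
  using edge_labels_eq[OF n1] by auto

lemma bl_in_labels: "1 \<le> a \<Longrightarrow> bl n a \<in> labels n"
  and rd_in_labels: "1 \<le> a \<Longrightarrow> rd n a \<in> labels n"
  using bl_rd_in_cluster_labels[OF n1] by auto

lemma arc_in_labels': "1 \<le> a \<Longrightarrow> a < b \<Longrightarrow> b < a + n \<Longrightarrow> arc n a b \<in> labels n"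
  using arc_in_labels[OF n2] by (auto simp: cluster_labels_def)

lemma alg_indep_initial: "alg_indep \<iota> initial_family Idx"
proof (rule alg_indep_reindex[OF \<iota>])
  show "inj_on initial_family Idx"
  proof (rule inj_onI)
    fix i j assume ij: "i \<in> Idx" "j \<in> Idx" "initial_family i = initial_family j"
    have BB: "a = b" if ab: "a \<in> {1..n}" "b \<in> {1..n}" "B a = B b" for a b
    proof -
      have "bl n a = bl n b" using ab(1,2) by (intro inj_onD[OF inj_x ab(3)] bl_in_labels) auto
      then show ?thesis using ab(1,2) by (intro bl_inject[of a n b]) auto
    qed
    have AA: "a = b" if ab: "a \<in> {1..n}" "b \<in> {1..n}" "A a (a + 1) = A b (b + 1)" for a b
    proof -
      have "arc n a (a + 1) = arc n b (b + 1)"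
        using inj_onD[OF inj_x ab(3)] ab(1,2) edge_arc_in_edge_labels by blast
      then show ?thesis using arc_inject(1)[OF n1, of a "a + 1" b "b + 1"] ab n2 by auto
    qed
    have BA: "B a \<noteq> A b (b + 1)" if ab: "a \<in> {1..n}" "b \<in> {1..n}" for a b
    proof
      assume "B a = A b (b + 1)"
      then have "bl n a = arc n b (b + 1)"
        using inj_onD[OF inj_x] ab bl_in_labels[of a] edge_arc_in_edge_labels[of b] by auto
      then show False by (simp add: bl_def arc_def orbit_def)
    qed
    have AB: "A a (a + 1) \<noteq> B b" if "a \<in> {1..n}" "b \<in> {1..n}" for a b
      using BA[OF that(2,1)] by (rule not_sym)
    show "i = j"
    proof (cases i)
      case (Inl a)
      then have a: "a \<in> {1..n}" using ij(1) by auto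
      show ?thesis
      proof (cases j)
        case (Inl b)
        then show ?thesis using \<open>i = Inl a\<close> ij a BB[of a b] by (auto simp: initial_family_def)
      next
        case (Inr b)
        then show ?thesis using \<open>i = Inl a\<close> ij a BA[of a b] by (auto simp: initial_family_def)
      qed
    next
      case (Inr a)
      then have a: "a \<in> {1..n}" using ij(1) by auto
      show ?thesis
      proof (cases j)
        case (Inl b)
        then show ?thesis using \<open>i = Inr a\<close> ij a AB[of a b] by (auto simp: initial_family_def)
      next
        case (Inr b)
        then show ?thesis using \<open>i = Inr a\<close> ij a AA[of a b] by (auto simp: initial_family_def)
      qed
    qed
  qed
  \<comment> \<open>The blue diameters are the cluster of some seed; its extended cluster is this
    family, and independence is inherited along mutations.\<close>
  have "bl n ` {1..n} \<in> triangulations n" by (rule all_blue_triangulation[OF n2])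
  then have "x ` bl n ` {1..n} \<in> clusters s0"
    using model unfolding polygon_model_def by blast
  then obtain s where s: "s \<in> seeds s0" "cluster s = x ` bl n ` {1..n}"
    unfolding clusters_def by auto
  have "initial_family ` Idx = cluster s \<union> frozen s0"
    unfolding s(2) frozen_eq edge_labels_eq[OF n1]
    by (auto simp: initial_family_def image_Un image_image)
  then show "alg_indep \<iota> (\<lambda>v. v) (initial_family ` Idx)"
    using seeds_independent[OF s0 s(1)] unfolding independent_seed_def by argo
qed simp

lemma B_nonzero:
  assumes "1 \<le> a"
  shows "B a \<noteq> 0"
proof -
  obtain a0 j where a0: "1 \<le> a0" "a0 \<le> n" "a = a0 + j * n" using shift_reduce[OF n1 assms] by blast
  have "initial_family (Inl a0) \<noteq> 0"
    using a0 by (intro alg_indep_nonzero[OF \<iota> alg_indep_initial]) auto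
  then show ?thesis using a0 by (simp add: initial_family_def bl_shift_mult)
qed

lemma exchange:
  assumes "({x L, x M}, {m, m'}) \<in> polygon_exchange_relations n x"
  shows "x L * x M = monomial_value m + monomial_value m'"
  using exchange_relationD[OF s0] assms model by (simp add: polygon_model_def)

lemma monomial_value_var: "monomial_value (var_monomial v) = v"
  by (simp add: monomial_value_eq_mono_eval mono_eval_single)

lemma monomial_value_var2: "monomial_value (var_monomial v + var_monomial w) = v * w"
  by (simp add: monomial_value_eq_mono_eval mono_eval_single mono_eval_add)

text \<open>Both [q, r'] and [p, r'], with r' antipodal to r, are rewritten by
  \<open>arc_antipode\<close> as arcs starting at r. In this form the relation prolongs an arc by
  one edge.\<close>

lemma blue_arc_exchange:
  assumes "1 \<le> p" "p < q" "q < r" "r < p + n"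
  shows "B p * A r (q + n) = A p q * B r + A r (p + n) * B q"
proof -
  let ?a = "pt n p" and ?b = "pt n q" and ?c = "pt n r"
  have q: "1 \<le> q" "1 \<le> r" using assms by auto
  have ap: "antipode n ?a = pt n (p + n)" "antipode n ?b = pt n (q + n)" "antipode n ?c = pt n (r + n)"
    using antipode_pt[OF n1] assms by auto
  have ccw: "ccw n [?a, ?b, ?c, antipode n ?a]"
    unfolding ap using assms n1 by (intro ccw_pt4) auto
  let ?z = "\<lambda>a b. var_monomial (x (seg n a b))"
  have "({x (seg n ?a (antipode n ?a)), x (seg n ?b (antipode n ?c))},
      {?z ?a ?b + ?z ?c (antipode n ?c), ?z ?a (antipode n ?c) + ?z ?b (antipode n ?b)})
    \<in> polygon_exchange_relations n x"
    unfolding polygon_exchange_relations_def Let_def using ccw by blast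
  from exchange[OF this]
  have "x (seg n ?a (antipode n ?a)) * x (seg n ?b (antipode n ?c))
      = x (seg n ?a ?b) * x (seg n ?c (antipode n ?c)) + x (seg n ?a (antipode n ?c)) * x (seg n ?b (antipode n ?b))"
    by (simp only: monomial_value_var2)
  moreover have "seg n ?b (pt n (r + n)) = arc n q (r + n)" "seg n ?a (pt n (r + n)) = arc n p (r + n)"
    "seg n ?a ?b = arc n p q"
    using assms by (auto intro!: seg_pt_arc n1)
  ultimately have "B p * A q (r + n) = A p q * B r + A p (r + n) * B q"
    unfolding ap using seg_pt_bl[OF n1] assms q by simp
  then show ?thesis
    using arc_antipode[OF n1, of q r] arc_antipode[OF n1, of p r] assms q by simp
qed

lemma blue_red_exchange:
  assumes "1 \<le> p" "p < q" "q < p + n"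
  shows "B p * R q = A p q + A q (p + n)"
proof -
  let ?a = "pt n p" and ?b = "pt n q"
  have q: "1 \<le> q" using assms by auto
  have ap: "antipode n ?a = pt n (p + n)" "antipode n ?b = pt n (q + n)"
    using antipode_pt[OF n1] assms by auto
  have ccw: "ccw n [?a, ?b, antipode n ?a]"
    unfolding ap using assms n1 by (intro ccw_pt3) auto
  let ?z = "\<lambda>a b. var_monomial (x (seg n a b))"
  have "({x (seg n ?a (antipode n ?a)), x (red n ?b)}, {?z ?a ?b, ?z ?a (antipode n ?b)})
    \<in> polygon_exchange_relations n x"
    unfolding polygon_exchange_relations_def Let_def using ccw by blast
  from exchange[OF this]
  have "x (seg n ?a (antipode n ?a)) * x (red n ?b) = x (seg n ?a ?b) + x (seg n ?a (antipode n ?b))"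
    by (simp only: monomial_value_var)
  moreover have "seg n ?a (pt n (q + n)) = arc n p (q + n)" "seg n ?a ?b = arc n p q"
    using assms by (auto intro!: seg_pt_arc n1)
  ultimately have "B p * R q = A p q + A p (q + n)"
    unfolding ap using seg_pt_bl[OF n1] red_pt[OF n1] assms q by simp
  then show ?thesis
    using arc_antipode[OF n1, of p q] assms q by simp
qed

definition y :: "nat \<Rightarrow> 'f" where
  "y i = A i (i + 1) / (B i * B (i + 1))"

lemma y_shift: "1 \<le> i \<Longrightarrow> y (i + n) = y i"
  using arc_shift[OF n1, of i "i + 1"] bl_shift[of i n] bl_shift[of "i + 1" n] by (simp add: y_def)

text \<open>Divided by B_a B_b B_(b+1), the exchange relation says that A a b / (B_a B_b) grows by
  y_b when b grows by 1. The relation is taken at r = a + n, the lift of a that follows b +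
  1.\<close>

lemma A_eq:
  assumes "1 \<le> a" "a < b" "b < a + n"
  shows "A a b = B a * B b * (\<Sum>i\<in>{a..<b}. y i)"
proof -
  have "a + 1 \<le> b" using assms by simp
  then show ?thesis using assms(3)
  proof (induction b rule: dec_induct)
    case base
    show ?case using B_nonzero[of a] B_nonzero[of "a + 1"] assms(1) by (simp add: y_def)
  next
    case (step b)
    have s: "A (a + n) (b + n) = A a b" "A (a + n) (b + 1 + n) = A a (b + 1)" "B (a + n) = B a"
      using arc_shift[OF n1, of a b] arc_shift[OF n1, of a "b + 1"] bl_shift[of a n] assms(1) step.hyps
      by simp_all
    have "B b * A a (b + 1) = A b (b + 1) * B a + A a b * B (b + 1)"
      using blue_arc_exchange[of b "b + 1" "a + n"] step assms(1) unfolding s by simp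
    also have "A b (b + 1) = B b * B (b + 1) * y b"
      using B_nonzero[of b] B_nonzero[of "b + 1"] assms(1) step.hyps by (simp add: y_def)
    also have "A a b = B a * B b * (\<Sum>i\<in>{a..<b}. y i)" using step by simp
    finally have "B b * A a (b + 1) = B b * (B a * B (b + 1) * (\<Sum>i\<in>{a..<b + 1}. y i))"
      using step.hyps by (simp add: algebra_simps)
    then show ?case using B_nonzero[of b] assms(1) step.hyps by simp
  qed
qed

definition \<tau> :: 'f where
  "\<tau> = (\<Sum>i\<in>{1..n}. y i)"

lemma sum_y_shift: "1 \<le> a \<Longrightarrow> (\<Sum>i\<in>{a + n..<b + n}. y i) = (\<Sum>i\<in>{a..<b}. y i)"
  unfolding sum.shift_bounds_nat_ivl by (rule sum.cong) (auto simp: y_shift)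

lemma sum_y_period: "1 \<le> a \<Longrightarrow> (\<Sum>i\<in>{a..<a + n}. y i) = \<tau>"
proof (induction a rule: dec_induct)
  case base
  have "{1..<1 + n} = {1..n}" by auto
  then show ?case by (simp add: \<tau>_def)
next
  case (step a)
  have "(\<Sum>i\<in>{a..<a + n}. y i) = y a + (\<Sum>i\<in>{Suc a..<a + n}. y i)"
    using n1 by (intro sum.atLeast_Suc_lessThan) simp
  moreover have "(\<Sum>i\<in>{Suc a..<Suc a + n}. y i) = (\<Sum>i\<in>{Suc a..<a + n}. y i) + y (a + n)"
    using n1 by simp
  ultimately show ?case using step y_shift[of a] by simp
qed

text \<open>The blue diameter at a + 1 and the red one at a exchange to two arcs whose y-sums
  together cover one full period of n consecutive indices.\<close>

lemma R_eq:
  assumes "1 \<le> a"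
  shows "R a = B a * \<tau>"
proof -
  have "B (a + 1) * R (a + n) = A (a + 1) (a + n) + A (a + n) (a + 1 + n)"
    using assms n2 by (intro blue_red_exchange) auto
  also have "A (a + 1) (a + n) = B (a + 1) * B (a + n) * (\<Sum>i\<in>{a + 1..<a + n}. y i)"
    using assms n2 by (intro A_eq) auto
  also have "A (a + n) (a + 1 + n) = B (a + n) * B (a + 1 + n) * (\<Sum>i\<in>{a + n..<a + 1 + n}. y i)"
    using assms n2 by (intro A_eq) auto
  also have "(\<Sum>i\<in>{a + n..<a + 1 + n}. y i) = y a" using y_shift[OF assms] by simp
  finally have "B (a + 1) * R a = B (a + 1) * (B a * (y a + (\<Sum>i\<in>{a + 1..<a + n}. y i)))"
    using rd_shift[OF assms, of n] bl_shift[OF assms, of n] bl_shift[of "a + 1" n]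
    by (simp add: algebra_simps)
  then have "R a = B a * (y a + (\<Sum>i\<in>{a + 1..<a + n}. y i))"
    using B_nonzero[of "a + 1"] by simp
  also have "y a + (\<Sum>i\<in>{a + 1..<a + n}. y i) = (\<Sum>i\<in>{a..<a + n}. y i)"
    using sum.atLeast_Suc_lessThan[of a "a + n" y] n1 by simp
  finally show ?thesis using sum_y_period[OF assms] by simp
qed

end

section \<open>Rewriting crossing pairs\<close>

text \<open>An orbit has two members, so the weight of \<open>arc n a (a + k)\<close> is \<open>2 k (2n - k)\<close>. This is strictly concave in \<open>k\<close>,
  like the square of a chord length.\<close>

fun wt :: "nat \<Rightarrow> label \<Rightarrow> nat" where
  "wt n (Orbit X) = (\<Sum>l\<in>X. (Max l - Min l) * (2 * n - (Max l - Min l)))"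
| "wt n (Blue d) = n * n"
| "wt n (Red d) = n * n"

text \<open>\<open>cnt i\<close> and \<open>sgn_label\<close> anticipate the coordinates of E_i and
  u^diam. Rewriting steps are required to preserve both, which expresses homogeneity for
  K(D_n).\<close>

fun cnt :: "nat \<Rightarrow> label \<Rightarrow> real" where
  "cnt i (Orbit X) = (if i \<in> \<Union> X then 1 else 0)"
| "cnt i (Blue d) = (if i \<in> d then 1 else 0)"
| "cnt i (Red d) = (if i \<in> d then 1 else 0)"

fun sgn_label :: "label \<Rightarrow> real" where
  "sgn_label (Orbit X) = 0"
| "sgn_label (Blue d) = 1"
| "sgn_label (Red d) = - 1"

text \<open>Both members contribute k (2n - k), since this product is unchanged under k to 2n - k
  and so does not depend on the side from which a chord is measured. Integers avoid truncated
  differences in the later identities.\<close>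

lemma wt_arc:
  assumes "1 \<le> n" "1 \<le> a" "a < b" "b < a + n"
  shows "int (wt n (arc n a b)) = 2 * (int b - int a) * (2 * int n - (int b - int a))"
proof -
  obtain a0 b0 j where ab: "1 \<le> a0" "a0 \<le> n" "a0 < b0" "b0 < a0 + n"
    "a = a0 + j * n" "b = b0 + j * n" "arc n a b = arc n a0 b0"
    using arc_normal_form[OF assms] by blast
  define k where "k = b0 - a0"
  define l where "l = {a0 + n, if b0 \<le> n then b0 + n else b0 - n}"
  have k: "k < n" "b0 = a0 + k" using ab by (auto simp: k_def)
  have ne: "{a0, b0} \<noteq> l" using ab by (auto simp: l_def doubleton_eq_iff split: if_splits)
  have "Max {a0, b0} - Min {a0, b0} = k" using k by simp
  moreover have "Max l - Min l = (if b0 \<le> n then k else 2 * n - k)"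
    using k ab by (auto simp: l_def max_def min_def)
  moreover have "arc n a b = Orbit {{a0, b0}, l}"
    using arc_coordinates[OF assms(1) ab(1-4)] ab(7) by (simp only: l_def)
  moreover have "(if b0 \<le> n then k else 2 * n - k) * (2 * n - (if b0 \<le> n then k else 2 * n - k)) = k * (2 * n - k)"
    using k by (simp add: mult.commute)
  ultimately have "wt n (arc n a b) = k * (2 * n - k) + k * (2 * n - k)"
    using ne by simp
  moreover have "int (k * (2 * n - k)) = int k * (2 * int n - int k)"
    using k by (simp add: of_nat_diff)
  ultimately have "int (wt n (arc n a b)) = 2 * int k * (2 * int n - int k)"
    by (simp only: of_nat_add)
  moreover have "int k = int b - int a" using ab k by simp
  ultimately show ?thesis by (simp only:)
qed

lemma wt_bl_rd: "int (wt n (bl n a)) = int n * int n" "int (wt n (rd n a)) = int n * int n"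
  by (simp_all add: bl_def rd_def)

text \<open>The endpoint indicator of a modulo n, so that lifts of the same diameter or arc endpoint
  give equal values.\<close>

definition ind :: "nat \<Rightarrow> nat \<Rightarrow> nat \<Rightarrow> real" where
  "ind n i a = (if i = pt n a \<or> i = pt n (a + n) then 1 else 0)"

lemma ind_shift: "1 \<le> a \<Longrightarrow> ind n i (a + n) = ind n i a"
  by (auto simp: ind_def pt_shift')

lemma cnt_arc:
  assumes "1 \<le> n" "1 \<le> a" "a < b" "b < a + n"
  shows "cnt i (arc n a b) = ind n i a + ind n i b"
proof -
  have "pt n a \<noteq> pt n b" "pt n a \<noteq> pt n (b + n)" "pt n b \<noteq> pt n (a + n)" "pt n (a + n) \<noteq> pt n (b + n)"
    using assms pt_neq[of a b n] pt_neq[of a "b + n" n] pt_neq[of b "a + n" n] pt_neq[of "a + n" "b + n" n]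
    by simp_all
  moreover have "1 \<le> b" using assms by simp
  ultimately show ?thesis using assms by (auto simp: arc_eq_Orbit ind_def)
qed

lemma cnt_bl_rd: "cnt i (bl n a) = ind n i a" "cnt i (rd n a) = ind n i a"
  by (auto simp: bl_def rd_def ind_def)

lemma sgn_label_simps: "sgn_label (arc n a b) = 0" "sgn_label (bl n a) = 1" "sgn_label (rd n a) = - 1"
  by (auto simp: arc_def orbit_def bl_def rd_def)

section \<open>Straightening relations for crossing pairs\<close>

context D_model
begin

text \<open>\<open>Ks\<close> is a sum of monomials with all coefficients 1, each monomial a list of
  labels. The decrease of \<open>wt\<close> gives termination; the conditions on \<open>cnt\<close>
  and \<open>sgn_label\<close> give homogeneity for K(D_n).\<close>

definition rewrites_to :: "label \<Rightarrow> label \<Rightarrow> label list list \<Rightarrow> bool" where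
  "rewrites_to L M Ks \<longleftrightarrow>
    x L * x M = (\<Sum>K\<leftarrow>Ks. prod_list (map x K)) \<and>
    (\<forall>K\<in>set Ks. set K \<subseteq> labels n \<and> sum_list (map (wt n) K) < wt n L + wt n M \<and>
      (\<forall>i. sum_list (map (cnt i) K) = cnt i L + cnt i M) \<and>
      sum_list (map sgn_label K) = sgn_label L + sgn_label M)"

lemma sum_y_split: "a \<le> b \<Longrightarrow> b \<le> c \<Longrightarrow> (\<Sum>i\<in>{a..<c}. y i) = (\<Sum>i\<in>{a..<b}. y i) + (\<Sum>i\<in>{b..<c}. y i)"
  using sum.atLeastLessThan_concat[of a b c y] by simp

text \<open>With \<alpha>, \<beta>, \<gamma> the y-sums of the three pieces between p, q, r, s, the
  identity is (\<alpha> + \<beta>)(\<beta> + \<gamma>) = \<alpha>\<gamma> + \<beta>(\<alpha> +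
  \<beta> + \<gamma>). The last factor is that of the arc [p,s] if s < p + n, and equals \<tau> if s
  = p + n, where B_p R_p appears. If s > p + n it is \<tau> + \<delta>, with \<delta> the y-sum of
  the overlap from p to s - n, and splits into two terms.\<close>

lemma rewrite_arcs:
  assumes p: "1 \<le> p" "p < q" "q < r" "r < s" "r < p + n" "s < q + n"
  shows "\<exists>Ks. rewrites_to (arc n p r) (arc n q s) Ks"
proof -
  define u v w where "u = int q - int p" and "v = int r - int q" and "w = int s - int r"
  define N where "N = int n"
  have uvw: "u \<ge> 1" "v \<ge> 1" "w \<ge> 1" "u + v < N" "v + w < N" "N \<ge> 1"
    using p n1 by (auto simp: u_def v_def w_def N_def)
  have d: "int r - int p = u + v" "int s - int q = v + w" "int q - int p = u" "int r - int q = v"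
    "int s - int r = w" "int s - int p = u + v + w" by (auto simp: u_def v_def w_def)
  have W: "int (wt n (arc n p r)) = 2 * (u + v) * (2 * N - (u + v))"
    "int (wt n (arc n q s)) = 2 * (v + w) * (2 * N - (v + w))"
    "int (wt n (arc n p q)) = 2 * u * (2 * N - u)"
    "int (wt n (arc n q r)) = 2 * v * (2 * N - v)"
    "int (wt n (arc n r s)) = 2 * w * (2 * N - w)"
    using p wt_arc[OF n1, of p r] wt_arc[OF n1, of q s] wt_arc[OF n1, of p q] wt_arc[OF n1, of q r]
      wt_arc[OF n1, of r s] unfolding d N_def by auto
  have prods: "v * (2 * N - (u + v + w)) > 0" "u * w > 0" using uvw by simp_all
  have W1: "wt n (arc n p q) + wt n (arc n r s) < wt n (arc n p r) + wt n (arc n q s)"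
  proof -
    \<comment> \<open>The difference of the two sides' weights, halved: 2v(2N - u - v - w), positive
      because u + v and w are both below N.\<close>
    have "(u + v) * (2 * N - (u + v)) + (v + w) * (2 * N - (v + w))
        = u * (2 * N - u) + w * (2 * N - w) + 2 * (v * (2 * N - (u + v + w)))"
      by (simp add: algebra_simps)
    then have "int (wt n (arc n p q) + wt n (arc n r s)) < int (wt n (arc n p r) + wt n (arc n q s))"
      unfolding of_nat_add W using prods by linarith
    then show ?thesis by linarith
  qed
  have lab: "arc n p q \<in> labels n" "arc n q r \<in> labels n" "arc n r s \<in> labels n"
    by (intro arc_in_labels'; use p in linarith)+
  define \<alpha> \<beta> \<gamma> where "\<alpha> = (\<Sum>i\<in>{p..<q}. y i)" and "\<beta> = (\<Sum>i\<in>{q..<r}. y i)" and "\<gamma> = (\<Sum>i\<in>{r..<s}. y i)"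
  have S: "(\<Sum>i\<in>{p..<r}. y i) = \<alpha> + \<beta>" "(\<Sum>i\<in>{q..<s}. y i) = \<beta> + \<gamma>" "(\<Sum>i\<in>{p..<s}. y i) = \<alpha> + \<beta> + \<gamma>"
    using p sum_y_split[of p q r] sum_y_split[of q r s] sum_y_split[of p r s]
    by (auto simp: \<alpha>_def \<beta>_def \<gamma>_def)
  have V: "A p r = B p * B r * (\<alpha> + \<beta>)" "A q s = B q * B s * (\<beta> + \<gamma>)" "A p q = B p * B q * \<alpha>"
    "A q r = B q * B r * \<beta>" "A r s = B r * B s * \<gamma>"
    using p A_eq[of p r] A_eq[of q s] A_eq[of p q] A_eq[of q r] A_eq[of r s]
    by (auto simp: S \<alpha>_def \<beta>_def \<gamma>_def)
  have C: "cnt i (arc n p r) = ind n i p + ind n i r" "cnt i (arc n q s) = ind n i q + ind n i s"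
    "cnt i (arc n p q) = ind n i p + ind n i q" "cnt i (arc n q r) = ind n i q + ind n i r"
    "cnt i (arc n r s) = ind n i r + ind n i s" for i
    using p by (auto intro!: cnt_arc n1)
  consider "s < p + n" | "s = p + n" | "s > p + n" by linarith
  then show ?thesis
  proof cases
    case 1
    have V': "A p s = B p * B s * (\<alpha> + \<beta> + \<gamma>)"
      using p 1 A_eq[of p s] by (simp add: S)
    have C': "cnt i (arc n p s) = ind n i p + ind n i s" for i
      using p 1 by (intro cnt_arc n1) auto
    have lab': "arc n p s \<in> labels n" using p 1 by (intro arc_in_labels') auto
    have "int (wt n (arc n p s)) = 2 * (u + v + w) * (2 * N - (u + v + w))"
      using p 1 wt_arc[OF n1, of p s] unfolding d N_def by auto
    \<comment> \<open>Here the slack is 2uw.\<close>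
    moreover have "(u + v) * (2 * N - (u + v)) + (v + w) * (2 * N - (v + w))
        = (u + v + w) * (2 * N - (u + v + w)) + v * (2 * N - v) + 2 * (u * w)"
      by (simp add: algebra_simps)
    ultimately have "int (wt n (arc n p s) + wt n (arc n q r)) < int (wt n (arc n p r) + wt n (arc n q s))"
      unfolding of_nat_add W using prods by linarith
    then have W2: "wt n (arc n p s) + wt n (arc n q r) < wt n (arc n p r) + wt n (arc n q s)" by linarith
    have "rewrites_to (arc n p r) (arc n q s) [[arc n p q, arc n r s], [arc n p s, arc n q r]]"
      unfolding rewrites_to_def using W1 W2 lab lab'
      by (simp add: C C' sgn_label_simps del: Un_iff) (simp add: V V' algebra_simps)
    then show ?thesis by blast
  next
    case 2
    have s: "B s = B p" using 2 bl_shift[of p n] p by simp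
    have \<tau>: "\<tau> = \<alpha> + \<beta> + \<gamma>" using S(3) 2 sum_y_period[of p] p by simp
    have "u + v + w = N" using 2 by (simp add: u_def w_def v_def N_def)
    then have w: "w = N - u - v" by simp
    \<comment> \<open>The preceding identity with u + v + w = N: half the joint weight of the two
      diameters is N N, the value of k (2N - k) at k = N.\<close>
    have "(u + v) * (2 * N - (u + v)) + (v + w) * (2 * N - (v + w)) = N * N + v * (2 * N - v) + 2 * (u * w)"
      unfolding w by (simp add: algebra_simps)
    then have "int (wt n (bl n p) + wt n (rd n p) + wt n (arc n q r)) < int (wt n (arc n p r) + wt n (arc n q s))"
      unfolding of_nat_add W wt_bl_rd N_def[symmetric] using prods by linarith
    then have W2: "wt n (bl n p) + wt n (rd n p) + wt n (arc n q r) < wt n (arc n p r) + wt n (arc n q s)" by linarith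
    have i: "ind n i s = ind n i p" for i using 2 p ind_shift by simp
    have "rewrites_to (arc n p r) (arc n q s) [[arc n p q, arc n r s], [bl n p, rd n p, arc n q r]]"
      unfolding rewrites_to_def using W1 W2 lab bl_in_labels[of p] rd_in_labels[of p] p
      by (simp add: C cnt_bl_rd i sgn_label_simps del: Un_iff) (simp add: V R_eq s \<tau> algebra_simps)
    then show ?thesis by blast
  next
    case 3
    define e where "e = s - n"
    have e: "s = e + n" "p < e" "e < q" "1 \<le> e" using 3 p by (auto simp: e_def)
    define \<delta> where "\<delta> = (\<Sum>i\<in>{p..<e}. y i)"
    have s: "B s = B e" using e bl_shift[of e n] by simp
    have i: "ind n i s = ind n i e" for i using e ind_shift by simp
    have "\<alpha> + \<beta> + \<gamma> = \<tau> + \<delta>"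
      using S(3) sum_y_split[of p "p + n" s] sum_y_period[of p] sum_y_shift[of p e] p e by (simp add: \<delta>_def)
    then have \<tau>: "\<tau> = \<alpha> + \<beta> + \<gamma> - \<delta>" by simp
    have V': "A p e = B p * B e * \<delta>" using p e A_eq[of p e] by (simp add: \<delta>_def)
    have C': "cnt i (arc n p e) = ind n i p + ind n i e" for i
      using p e by (intro cnt_arc n1) auto
    have lab': "arc n p e \<in> labels n" using p e by (intro arc_in_labels') auto
    define j where "j = int e - int p"
    have j: "0 < j" "j < u" "j < w" using e p by (auto simp: j_def u_def w_def)
    have "int s = int e + int n" using e by simp
    then have jN: "u + v + w = N + j" by (simp add: j_def u_def v_def w_def N_def)
    then have v: "v = N + j - u - w" by simp
    have Wj: "int (wt n (arc n p e)) = 2 * j * (2 * N - j)"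
      using p e wt_arc[OF n1, of p e] by (simp add: j_def N_def)
    \<comment> \<open>Now u + v + w = N + j, so (N + j)(N - j) = N N - j j replaces the square of N.
      The loss j j is covered by the slack 2uw, since the overlap j is shorter than both u and
      w.\<close>
    have jj: "j * j < u * w" using j by (intro mult_strict_mono) auto
    have "(u + v) * (2 * N - (u + v)) + (v + w) * (2 * N - (v + w))
        = N * N - j * j + v * (2 * N - v) + 2 * (u * w)"
      unfolding v by (simp add: algebra_simps)
    then have "int (wt n (bl n p) + wt n (rd n e) + wt n (arc n q r)) < int (wt n (arc n p r) + wt n (arc n q s))"
      unfolding of_nat_add W wt_bl_rd N_def[symmetric] using prods jj by linarith
    then have W2: "wt n (bl n p) + wt n (rd n e) + wt n (arc n q r) < wt n (arc n p r) + wt n (arc n q s)" by linarith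
    \<comment> \<open>The term with the overlap arc instead of two diameters is lighter still,
      because N N - j (2N - j) is the square of N - j.\<close>
    have "j * (2 * N - j) \<le> N * N"
      using zero_le_square[of "N - j"] by (simp add: algebra_simps)
    moreover have "(u + v) * (2 * N - (u + v)) + (v + w) * (2 * N - (v + w))
        = N * N - j * j + v * (2 * N - v) + 2 * (u * w)"
      unfolding v by (simp add: algebra_simps)
    ultimately have "int (wt n (arc n p e) + wt n (arc n q r)) < int (wt n (arc n p r) + wt n (arc n q s))"
      unfolding of_nat_add W Wj using prods jj by linarith
    then have W3: "wt n (arc n p e) + wt n (arc n q r) < wt n (arc n p r) + wt n (arc n q s)" by linarith
    have "rewrites_to (arc n p r) (arc n q s)
        [[arc n p q, arc n r s], [bl n p, rd n e, arc n q r], [arc n p e, arc n q r]]"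
      unfolding rewrites_to_def using W1 W2 W3 lab lab' bl_in_labels[of p] rd_in_labels[of e] p(1) e(4)
      by (simp add: C C' cnt_bl_rd i sgn_label_simps del: Un_iff) (simp add: V V' R_eq s \<tau> algebra_simps)
    then show ?thesis by blast
  qed
qed

text \<open>The diameter at q splits the y-sum of the arc at q; for red every term carries an extra
  factor \<tau>. All diameters weigh the same, and both new arcs are shorter than the old one, hence
  lighter.\<close>

lemma rewrite_arc_diameter:
  assumes p: "1 \<le> p" "p < q" "q < r" "r < p + n"
  shows "\<exists>Ks. rewrites_to (arc n p r) (bl n q) Ks" "\<exists>Ks. rewrites_to (arc n p r) (rd n q) Ks"
proof -
  define u v where "u = int q - int p" and "v = int r - int q"
  define N where "N = int n"
  have uv: "u \<ge> 1" "v \<ge> 1" "u + v < N" using p by (auto simp: u_def v_def N_def)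
  have d: "int r - int p = u + v" "int q - int p = u" "int r - int q = v" by (auto simp: u_def v_def)
  have W: "int (wt n (arc n p r)) = 2 * (u + v) * (2 * N - (u + v))"
    "int (wt n (arc n p q)) = 2 * u * (2 * N - u)" "int (wt n (arc n q r)) = 2 * v * (2 * N - v)"
    using p wt_arc[OF n1, of p r] wt_arc[OF n1, of p q] wt_arc[OF n1, of q r] unfolding d N_def by auto
  have "v * (2 * N - 2 * u - v) > 0" "u * (2 * N - 2 * v - u) > 0" using uv by simp_all
  moreover have "(u + v) * (2 * N - (u + v)) = u * (2 * N - u) + v * (2 * N - 2 * u - v)"
    "(u + v) * (2 * N - (u + v)) = v * (2 * N - v) + u * (2 * N - 2 * v - u)"
    by (simp_all add: algebra_simps)
  ultimately have "int (wt n (arc n p q)) < int (wt n (arc n p r))" "int (wt n (arc n q r)) < int (wt n (arc n p r))"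
    unfolding W by linarith+
  then have W': "wt n (arc n p q) < wt n (arc n p r)" "wt n (arc n q r) < wt n (arc n p r)" by linarith+
  have Wd: "wt n (bl n a) = n * n" "wt n (rd n a) = n * n" for a by (simp_all add: bl_def rd_def)
  have S: "(\<Sum>i\<in>{p..<r}. y i) = (\<Sum>i\<in>{p..<q}. y i) + (\<Sum>i\<in>{q..<r}. y i)"
    using p by (intro sum_y_split) auto
  have V: "A p r = B p * B r * ((\<Sum>i\<in>{p..<q}. y i) + (\<Sum>i\<in>{q..<r}. y i))"
    "A p q = B p * B q * (\<Sum>i\<in>{p..<q}. y i)" "A q r = B q * B r * (\<Sum>i\<in>{q..<r}. y i)"
    using p A_eq[of p r] A_eq[of p q] A_eq[of q r] by (auto simp: S)
  have C: "cnt i (arc n p r) = ind n i p + ind n i r" "cnt i (arc n p q) = ind n i p + ind n i q"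
    "cnt i (arc n q r) = ind n i q + ind n i r" for i
    using p by (auto intro!: cnt_arc n1)
  have lab: "arc n p q \<in> labels n" "arc n q r \<in> labels n"
    by (intro arc_in_labels'; use p in linarith)+
  have "rewrites_to (arc n p r) (bl n q) [[bl n p, arc n q r], [bl n r, arc n p q]]"
    unfolding rewrites_to_def using W' lab bl_in_labels[of p] bl_in_labels[of r] p
    by (simp add: C cnt_bl_rd sgn_label_simps Wd del: Un_iff) (simp add: V algebra_simps)
  then show "\<exists>Ks. rewrites_to (arc n p r) (bl n q) Ks" by blast
  have "rewrites_to (arc n p r) (rd n q) [[rd n p, arc n q r], [rd n r, arc n p q]]"
    unfolding rewrites_to_def using W' lab rd_in_labels[of p] rd_in_labels[of r] p
    by (simp add: C cnt_bl_rd sgn_label_simps Wd del: Un_iff) (simp add: V R_eq algebra_simps)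
  then show "\<exists>Ks. rewrites_to (arc n p r) (rd n q) Ks" by blast
qed

text \<open>The two arcs have lengths u and w with u + w = n, and 2u(2n - u) = 2nn - 2ww is below
  the weight 2nn of the two diameters.\<close>

lemma rewrite_blue_red:
  assumes p: "1 \<le> p" "p < q" "q < p + n"
  shows "rewrites_to (bl n p) (rd n q) [[arc n p q], [arc n q (p + n)]]"
proof -
  define u w where "u = int q - int p" and "w = int (p + n) - int q"
  have u: "u \<ge> 1" "w \<ge> 1" and N: "int n = u + w" using p by (auto simp: u_def w_def)
  have W: "int (wt n (arc n p q)) = 2 * u * (2 * (u + w) - u)"
    "int (wt n (arc n q (p + n))) = 2 * w * (2 * (u + w) - w)"
    using p wt_arc[OF n1, of p q] wt_arc[OF n1, of q "p + n"] unfolding N u_def[symmetric] w_def[symmetric]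
    by simp_all
  have "2 * u * (2 * (u + w) - u) = 2 * ((u + w) * (u + w)) - 2 * (w * w)"
    "2 * w * (2 * (u + w) - w) = 2 * ((u + w) * (u + w)) - 2 * (u * u)" by (simp_all add: algebra_simps)
  moreover have "u * u > 0" "w * w > 0" using u by simp_all
  ultimately have "int (wt n (arc n p q)) < int (wt n (bl n p) + wt n (rd n q))"
    "int (wt n (arc n q (p + n))) < int (wt n (bl n p) + wt n (rd n q))"
    unfolding of_nat_add wt_bl_rd N W by simp_all
  then have W: "wt n (arc n p q) < wt n (bl n p) + wt n (rd n q)"
    "wt n (arc n q (p + n)) < wt n (bl n p) + wt n (rd n q)" by linarith+
  have C: "cnt i (arc n p q) = ind n i p + ind n i q" "cnt i (arc n q (p + n)) = ind n i q + ind n i (p + n)" for i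
    using p by (auto intro!: cnt_arc n1)
  have lab: "arc n p q \<in> labels n" "arc n q (p + n) \<in> labels n"
    by (intro arc_in_labels'; use p in linarith)+
  show ?thesis
    unfolding rewrites_to_def using W lab blue_red_exchange[OF p] p
    by (simp add: C cnt_bl_rd sgn_label_simps ind_shift del: Un_iff)
qed

lemma crossing_rewrites:
  assumes "crossing n L M"
  shows "\<exists>Ks. rewrites_to L M Ks"
  using assms by cases (use rewrite_arcs rewrite_arc_diameter rewrite_blue_red in blast)+

end

section \<open>Leading exponents\<close>

text \<open>\<open>Inl i\<close> and \<open>Inr i\<close> index \<open>B\<^sub>i\<close> and \<open>y\<^sub>i\<close>; these are the exponents of the leading monomials for an order
  with \<open>y\<^sub>1 < \<dots> < y\<^sub>n\<close>.\<close>

inductive lead_rel :: "nat \<Rightarrow> label \<Rightarrow> (nat + nat \<Rightarrow>\<^sub>0 nat) \<Rightarrow> bool" for n where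
  "1 \<le> a \<Longrightarrow> a \<le> n \<Longrightarrow> lead_rel n (bl n a) (single (Inl a) 1)"
| "1 \<le> a \<Longrightarrow> a \<le> n \<Longrightarrow>
    lead_rel n (rd n a) (single (Inl a) 1 + single (Inr n) 1)"
| "1 \<le> a \<Longrightarrow> a < b \<Longrightarrow> b \<le> n \<Longrightarrow> lead_rel n (arc n a b)
    (single (Inl a) 1 + single (Inl b) 1 + single (Inr (b - 1)) 1)"
| "1 \<le> a \<Longrightarrow> a < b \<Longrightarrow> b \<le> n \<Longrightarrow> lead_rel n (arc n b (a + n))
    (single (Inl a) 1 + single (Inl b) 1 + single (Inr n) 1)"

text \<open>A label is an orbit without distinguished coordinates, so its exponent is described by a
  relation on normal forms; uniqueness of these makes it well defined.\<close>

definition lead :: "nat \<Rightarrow> label \<Rightarrow> nat + nat \<Rightarrow>\<^sub>0 nat" where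
  "lead n L = (THE \<mu>. lead_rel n L \<mu>)"

lemma label_neqs:
  "bl n a \<noteq> rd n b" "rd n b \<noteq> bl n a" "arc n c d \<noteq> bl n a" "bl n a \<noteq> arc n c d"
  "arc n c d \<noteq> rd n a" "rd n a \<noteq> arc n c d"
  by (simp_all add: bl_def rd_def arc_def orbit_def)

lemma lead_rel_unique:
  assumes "1 \<le> n" "lead_rel n L \<mu>" "lead_rel n L \<nu>"
  shows "\<mu> = \<nu>"
  using assms(2)
proof cases
  case (1 a)
  show ?thesis using assms(3)
    by cases (use 1 bl_inject[of a n] label_neqs in auto)
next
  case (2 a)
  show ?thesis using assms(3)
    by cases (use 2 bl_inject[of a n] label_neqs in auto)
next
  case (3 a b)
  show ?thesis using assms(3)
  proof cases
    case (3 a' b')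
    then show ?thesis
      using \<open>L = arc n a b\<close> \<open>\<mu> = _\<close> \<open>1 \<le> a\<close> \<open>a < b\<close> \<open>b \<le> n\<close> arc_inject[OF assms(1), of a b a' b'] by auto
  next
    case (4 a' b')
    then show ?thesis
      using \<open>L = arc n a b\<close> \<open>\<mu> = _\<close> \<open>1 \<le> a\<close> \<open>a < b\<close> \<open>b \<le> n\<close> arc_inject[OF assms(1), of a b b' "a' + n"] by auto
  qed (use 3 label_neqs in auto)
next
  case (4 a b)
  show ?thesis using assms(3)
  proof cases
    case (3 a' b')
    then show ?thesis
      using \<open>L = arc n b (a + n)\<close> \<open>\<mu> = _\<close> \<open>1 \<le> a\<close> \<open>a < b\<close> \<open>b \<le> n\<close> arc_inject[OF assms(1), of b "a + n" a' b'] by auto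
  next
    case (4 a' b')
    then show ?thesis
      using \<open>L = arc n b (a + n)\<close> \<open>\<mu> = _\<close> \<open>1 \<le> a\<close> \<open>a < b\<close> \<open>b \<le> n\<close> arc_inject[OF assms(1), of b "a + n" b' "a' + n"] by auto
  qed (use 4 label_neqs in auto)
qed

lemma lead_eq: "1 \<le> n \<Longrightarrow> lead_rel n L \<mu> \<Longrightarrow> lead n L = \<mu>"
  unfolding lead_def by (rule the_equality) (auto intro: lead_rel_unique)

text \<open>An arc within 1..n has y_(b-1) as its last summand, whereas an arc passing the vertex n
  (\<open>wrap\<close>) has y_n among its summands and shares this leading y with the red
  diameters.\<close>

lemma labels_lead_cases:
  assumes n: "2 \<le> n" and "L \<in> labels n"
  obtains (blue) a where "1 \<le> a" "a \<le> n" "L = bl n a" "lead n L = single (Inl a) 1"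
    | (red) a where "1 \<le> a" "a \<le> n" "L = rd n a"
      "lead n L = single (Inl a) 1 + single (Inr n) 1"
    | (inner) a b where "1 \<le> a" "a < b" "b \<le> n" "L = arc n a b"
      "lead n L = single (Inl a) 1 + single (Inl b) 1 + single (Inr (b - 1)) 1"
    | (wrap) a b where "1 \<le> a" "a < b" "b \<le> n" "L = arc n b (a + n)"
      "lead n L = single (Inl a) 1 + single (Inl b) 1 + single (Inr n) 1"
proof -
  have n1: "1 \<le> n" using n by simp
  from assms show thesis
  proof (cases rule: labels_cases)
    case (blue a)
    then show thesis using that(1) lead_eq[OF n1 lead_rel.intros(1)] by blast
  next
    case (red a)
    then show thesis using that(2) lead_eq[OF n1 lead_rel.intros(2)] by blast
  next
    case (arc a b)
    show thesis
    proof (cases "b \<le> n")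
      case True
      then show thesis using that(3)[of a b] lead_eq[OF n1 lead_rel.intros(3)] arc by blast
    next
      case False
      have "b = b - n + n" "1 \<le> b - n" "b - n < a" using False arc by auto
      then show thesis using that(4)[of "b - n" a] lead_eq[OF n1 lead_rel.intros(4)[of "b - n" a n]] arc by simp
    qed
  qed
qed

section \<open>Crossing-free monomials are determined by their leading exponents\<close>

definition lead_sum :: "nat \<Rightarrow> (label \<Rightarrow> nat) \<Rightarrow> nat + nat \<Rightarrow> nat" where
  "lead_sum n f i = (\<Sum>L\<in>labels n. f L * lookup (lead n L) i)"

definition crossing_free :: "nat \<Rightarrow> (label \<Rightarrow> nat) \<Rightarrow> bool" where
  "crossing_free n f \<longleftrightarrow> (\<forall>L\<in>labels n. \<forall>M\<in>labels n. f L > 0 \<longrightarrow> f M > 0 \<longrightarrow> \<not> crossing n L M)"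

lemma lead_sum_pos_iff:
  assumes "2 \<le> n"
  shows "lead_sum n f i > 0 \<longleftrightarrow> (\<exists>L\<in>labels n. f L > 0 \<and> lookup (lead n L) i > 0)"
  using finite_labels[OF assms] by (auto simp: lead_sum_def sum_eq_0_iff simp flip: neq0_conv)

text \<open>Red diameters and wrapping arcs lead with y_n, so for j < n the exponent of y_j detects
  exactly the inner arcs with right endpoint j + 1.\<close>

lemma lookup_lead_inner:
  assumes "2 \<le> n" "L \<in> labels n" "j < n" "lookup (lead n L) (Inr j) > 0"
  obtains a where "1 \<le> a" "a \<le> j" "L = arc n a (j + 1)"
  using assms(1,2)
proof (cases rule: labels_lead_cases)
  case (inner a b)
  then have "j = b - 1" using assms(4) by (auto simp: lookup_add lookup_single when_def split: if_splits)
  then show thesis using inner that[of a] by simp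
qed (use assms(3,4) in \<open>auto simp: lookup_add lookup_single when_def split: if_splits\<close>)

lemma lookup_lead_endpoint:
  assumes "2 \<le> n" "L \<in> labels n" "lookup (lead n L) (Inl j) > 0"
  obtains "L = bl n j" | "L = rd n j" | b where "1 \<le> j" "j < b" "b \<le> n" "L = arc n j b"
    | a where "1 \<le> a" "a < j" "j \<le> n" "L = arc n a j"
    | a where "1 \<le> a" "a < j" "j \<le> n" "L = arc n j (a + n)"
    | b where "1 \<le> j" "j < b" "b \<le> n" "L = arc n b (j + n)"
  using assms(1,2)
proof (cases rule: labels_lead_cases)
  case (inner a b)
  then have "j = a \<or> j = b" using assms(3) by (auto simp: lookup_add lookup_single when_def split: if_splits)
  then show thesis using inner that by blast
next
  case (wrap a b)
  then have "j = a \<or> j = b" using assms(3) by (auto simp: lookup_add lookup_single when_def split: if_splits)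
  then show thesis using wrap that by blast
qed (use assms(3) that in \<open>auto simp: lookup_add lookup_single when_def split: if_splits\<close>)

lemma lead_arc_inner:
  assumes "1 \<le> n" "1 \<le> a" "a < b" "b \<le> n"
  shows "lead n (arc n a b) =
    single (Inl a) 1 + single (Inl b) 1 + single (Inr (b - 1)) 1"
  using assms by (intro lead_eq lead_rel.intros)

lemma lead_arc_wrap:
  assumes "1 \<le> n" "1 \<le> a" "a < b" "b \<le> n"
  shows "lead n (arc n b (a + n)) =
    single (Inl a) 1 + single (Inl b) 1 + single (Inr n) 1"
  using assms by (intro lead_eq lead_rel.intros)

lemma lead_bl: "1 \<le> a \<Longrightarrow> a \<le> n \<Longrightarrow> lead n (bl n a) = single (Inl a) 1"
  by (intro lead_eq lead_rel.intros) auto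

lemma lead_rd:
  "1 \<le> a \<Longrightarrow> a \<le> n \<Longrightarrow> lead n (rd n a) = single (Inl a) 1 + single (Inr n) 1"
  by (intro lead_eq lead_rel.intros) auto

lemma arc_labels:
  assumes "2 \<le> n" "1 \<le> a" "a < b" "b < a + n"
  shows "arc n a b \<in> labels n"
  using arc_in_labels[OF assms] by (auto simp: cluster_labels_def)

lemma bl_labels: "1 \<le> n \<Longrightarrow> 1 \<le> a \<Longrightarrow> bl n a \<in> labels n"
  and rd_labels: "1 \<le> n \<Longrightarrow> 1 \<le> a \<Longrightarrow> rd n a \<in> labels n"
  using bl_rd_in_cluster_labels by auto

text \<open>By equality of the exponents of \<open>B\<close>, the vertex \<open>a'\<close> is also an endpoint in \<open>f\<close>; every label with this
  endpoint crosses \<open>arc n a b\<close> or contradicts the choice of \<open>a\<close> and \<open>b\<close>.\<close>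

lemma inner_arc_maximal:
  assumes n: "2 \<le> n" and f: "crossing_free n f" and eq: "\<And>i. lead_sum n f i = lead_sum n g i"
    and fa: "1 \<le> a" "a < b" "b \<le> n" "f (arc n a b) > 0"
    and ga: "a < a'" "a' < b" "g (arc n a' b) > 0"
    and minimal: "\<And>c d. 1 \<le> c \<Longrightarrow> c < d \<Longrightarrow> d < b \<Longrightarrow> f (arc n c d) = 0"
    and maximal: "\<And>c. a < c \<Longrightarrow> c < b \<Longrightarrow> f (arc n c b) = 0"
  shows False
proof -
  have n1: "1 \<le> n" using n by simp
  have "arc n a' b \<in> labels n" using fa ga n by (intro arc_labels) auto
  then have "lead_sum n g (Inl a') > 0"
    unfolding lead_sum_pos_iff[OF n] using ga fa n1
    by (intro bexI[of _ "arc n a' b"]) (auto simp: lead_arc_inner lookup_add)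
  then have "lead_sum n f (Inl a') > 0" using eq by simp
  then obtain L where L: "L \<in> labels n" "f L > 0" "lookup (lead n L) (Inl a') > 0"
    unfolding lead_sum_pos_iff[OF n] by blast
  have ab: "arc n a b \<in> labels n" using fa n by (intro arc_labels) auto
  then have nc: "\<not> crossing n (arc n a b) L" "\<not> crossing n L (arc n a b)"
    using f L fa unfolding crossing_free_def by blast+
  from n L(1,3) show False
  proof (cases rule: lookup_lead_endpoint)
    case 1
    then show False using nc(1) crossing.arc_blue[of a a' b n] fa ga by simp
  next
    case 2
    then show False using nc(1) crossing.arc_red[of a a' b n] fa ga by simp
  next
    case (3 d)
    consider "d < b" | "d = b" | "d > b" by linarith
    then show False
    proof cases
      case 1
      then show False using minimal[of a' d] 3 L fa ga by simp
    next
      case 2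
      then show False using maximal[of a'] 3 L fa ga by simp
    next
      assume "d > b"
      then show False using nc(1) crossing.arcs[of a a' b d n] 3 fa ga by simp
    qed
  next
    case (4 d)
    then show False using minimal[of d a'] L fa ga by simp
  next
    case (5 d)
    then show False using nc(1) crossing.arcs[of a a' b "d + n" n] fa ga by simp
  next
    case (6 d)
    show False
    proof (cases "d < b")
      case True
      then show False using nc(1) crossing.arcs[of a d b "a' + n" n] 6 fa ga by simp
    next
      case False
      \<comment> \<open>The lift [a + n, b + n] is used, because d <= n < a + n < a' + n < b +
        n.\<close>
      then have "crossing n (arc n d (a' + n)) (arc n (a + n) (b + n))"
        using 6 fa ga by (intro crossing.arcs) auto
      then show False using nc(2) 6 arc_shift[OF n1, of a b] fa by simp
    qed
  qed
qed

text \<open>Induction on the right endpoint b. The exponent of y_(b-1) shows that f and g both have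
  arcs ending at b or both have none. If they have, the largest left endpoints differ by
  disjointness of supports, and \<open>inner_arc_maximal\<close> excludes either being the smaller;
  the induction hypothesis rules out arcs ending earlier.\<close>

lemma no_common_inner:
  assumes n: "2 \<le> n" and f: "crossing_free n f" and g: "crossing_free n g"
    and eq: "\<And>i. lead_sum n f i = lead_sum n g i"
    and disj: "\<And>L. L \<in> labels n \<Longrightarrow> f L = 0 \<or> g L = 0"
    and "1 \<le> a" "a < b" "b \<le> n"
  shows "f (arc n a b) = 0 \<and> g (arc n a b) = 0"
  using assms(6-8)
proof (induction b arbitrary: a rule: less_induct)
  case (less b)
  have n1: "1 \<le> n" using n by simp
  define F where "F = {c. 1 \<le> c \<and> c < b \<and> f (arc n c b) > 0}"
  define G where "G = {c. 1 \<le> c \<and> c < b \<and> g (arc n c b) > 0}"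
  have fin: "finite F" "finite G" by (auto simp: F_def G_def)
  have pos: "lead_sum n h (Inr (b - 1)) > 0 \<longleftrightarrow> {c. 1 \<le> c \<and> c < b \<and> h (arc n c b) > 0} \<noteq> {}" for h
  proof
    assume "lead_sum n h (Inr (b - 1)) > 0"
    then obtain L where L: "L \<in> labels n" "h L > 0" "lookup (lead n L) (Inr (b - 1)) > 0"
      unfolding lead_sum_pos_iff[OF n] by blast
    have "b - 1 < n" using less.prems by simp
    from n L(1) this L(3) obtain c where "1 \<le> c" "c \<le> b - 1" "L = arc n c (b - 1 + 1)"
      by (rule lookup_lead_inner)
    then have "1 \<le> c \<and> c < b \<and> h (arc n c b) > 0" using L(2) less.prems by simp
    then show "{c. 1 \<le> c \<and> c < b \<and> h (arc n c b) > 0} \<noteq> {}" by blast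
  next
    assume "{c. 1 \<le> c \<and> c < b \<and> h (arc n c b) > 0} \<noteq> {}"
    then obtain c where c: "1 \<le> c" "c < b" "h (arc n c b) > 0" by blast
    moreover have "arc n c b \<in> labels n" using c less.prems n by (intro arc_labels) auto
    ultimately show "lead_sum n h (Inr (b - 1)) > 0"
      unfolding lead_sum_pos_iff[OF n] using less.prems n1
      by (intro bexI[of _ "arc n c b"]) (auto simp: lead_arc_inner lookup_add)
  qed
  have FG: "F \<noteq> {} \<longleftrightarrow> G \<noteq> {}"
    using pos[of f] pos[of g] eq[of "Inr (b - 1)"] by (simp only: F_def G_def)
  have minf: "f (arc n c d) = 0" and ming: "g (arc n c d) = 0" if "1 \<le> c" "c < d" "d < b" for c d
    using less.IH[OF that(3,1,2)] that less.prems by auto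
  have "F = {}"
  proof (rule ccontr)
    assume "F \<noteq> {}"
    then have "G \<noteq> {}" using FG by simp
    define c where "c = Max F"
    define d where "d = Max G"
    have c: "c \<in> F" and d: "d \<in> G"
      using Max_in[OF fin(1) \<open>F \<noteq> {}\<close>] Max_in[OF fin(2) \<open>G \<noteq> {}\<close>] by (auto simp: c_def d_def)
    have maxf: "f (arc n e b) = 0" if "c < e" "e < b" for e
    proof (rule ccontr)
      assume "f (arc n e b) \<noteq> 0"
      then have "e \<in> F" using that c by (auto simp: F_def)
      from Max_ge[OF fin(1) this] show False using that(1) by (simp add: c_def)
    qed
    have maxg: "g (arc n e b) = 0" if "d < e" "e < b" for e
    proof (rule ccontr)
      assume "g (arc n e b) \<noteq> 0"
      then have "e \<in> G" using that d by (auto simp: G_def)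
      from Max_ge[OF fin(2) this] show False using that(1) by (simp add: d_def)
    qed
    consider "c < d" | "d < c" | "c = d" by linarith
    then show False
    proof cases
      case 1
      show False
        by (rule inner_arc_maximal[OF n f eq, of c b d])
          (use 1 c d less.prems minf maxf in \<open>auto simp: F_def G_def\<close>)
    next
      case 2
      show False
        by (rule inner_arc_maximal[OF n g eq[symmetric], of d b c])
          (use 2 c d less.prems ming maxg in \<open>auto simp: F_def G_def\<close>)
    next
      case 3
      have "arc n c b \<in> labels n" using c less.prems n by (intro arc_labels) (auto simp: F_def)
      then show False using disj 3 c d by (force simp: F_def G_def)
    qed
  qed
  moreover from this FG have "G = {}" by blast
  ultimately show ?case using less.prems by (auto simp: F_def G_def)
qed

text \<open>Take a least possible and then b greatest possible. Any label of f with an endpoint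
  outside a..b would cross the arc [b, a + n] or contradict this choice. Hence a and b can be read
  off as the extreme indices of the B-exponents.\<close>

lemma innermost_wrap:
  assumes n: "2 \<le> n" and f: "crossing_free n f"
    and inner: "\<And>a b. 1 \<le> a \<Longrightarrow> a < b \<Longrightarrow> b \<le> n \<Longrightarrow> f (arc n a b) = 0"
    and ex: "1 \<le> a0" "a0 < b0" "b0 \<le> n" "f (arc n b0 (a0 + n)) > 0"
  obtains a b where "1 \<le> a" "a < b" "b \<le> n" "f (arc n b (a + n)) > 0"
    "\<And>i. lead_sum n f (Inl i) > 0 \<Longrightarrow> a \<le> i \<and> i \<le> b"
    "lead_sum n f (Inl a) > 0" "lead_sum n f (Inl b) > 0"
proof -
  have n1: "1 \<le> n" using n by simp
  define S where "S = {a. \<exists>b. 1 \<le> a \<and> a < b \<and> b \<le> n \<and> f (arc n b (a + n)) > 0}"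
  have S: "finite S" "S \<noteq> {}"
    using ex by (auto simp: S_def intro!: finite_subset[of _ "{..n}"])
  define a where "a = Min S"
  have aS: "a \<in> S" unfolding a_def using S by (rule Min_in)
  define T where "T = {b. 1 \<le> a \<and> a < b \<and> b \<le> n \<and> f (arc n b (a + n)) > 0}"
  have T: "finite T" "T \<noteq> {}"
    using aS by (auto simp: S_def T_def)
  define b where "b = Max T"
  have bT: "b \<in> T" unfolding b_def using T by (rule Max_in)
  have ab: "1 \<le> a" "a < b" "b \<le> n" "f (arc n b (a + n)) > 0" using bT by (auto simp: T_def)
  have abl: "arc n b (a + n) \<in> labels n" using ab n by (intro arc_labels) auto
  have nc: "\<not> crossing n (arc n b (a + n)) L" if "L \<in> labels n" "f L > 0" for L
    using f that ab abl unfolding crossing_free_def by blast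
  have wrap: "a \<le> c \<and> d \<le> b" if cd: "1 \<le> c" "c < d" "d \<le> n" "f (arc n d (c + n)) > 0" for c d
  proof -
    have "c \<in> S" using cd by (auto simp: S_def)
    then have ac: "a \<le> c" using S by (simp add: a_def)
    moreover have "d \<le> b"
    proof (rule ccontr)
      assume db: "\<not> d \<le> b"
      show False
      proof (cases "a = c")
        case True
        then have "d \<in> T" using cd by (auto simp: T_def)
        then show False using T db by (simp add: b_def)
      next
        case False
        then have "crossing n (arc n b (a + n)) (arc n d (c + n))"
          using ab cd ac db by (intro crossing.arcs) auto
        moreover have "arc n d (c + n) \<in> labels n" using cd n by (intro arc_labels) auto
        ultimately show False using nc cd by blast
      qed
    qed
    ultimately show ?thesis by blast
  qed
  have diam: "a \<le> c \<and> c \<le> b" if c: "1 \<le> c" "c \<le> n" "f (bl n c) > 0 \<or> f (rd n c) > 0" for c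
  proof (rule ccontr)
    assume "\<not> (a \<le> c \<and> c \<le> b)"
    then consider "c > b" | "c < a" by linarith
    then obtain q where q: "b < q" "q < a + n" "bl n q = bl n c" "rd n q = rd n c"
    proof cases
      case 1
      then show thesis using that[of c] c ab by simp
    next
      case 2
      then show thesis using that[of "c + n"] c ab bl_shift[of c n] rd_shift[of c n] by simp
    qed
    have "crossing n (arc n b (a + n)) (bl n c)" "crossing n (arc n b (a + n)) (rd n c)"
      using crossing.arc_blue[of b q "a + n" n] crossing.arc_red[of b q "a + n" n] q ab by simp_all
    then show False using nc bl_labels[OF n1, of c] rd_labels[OF n1, of c] c by blast
  qed
  have range: "a \<le> i \<and> i \<le> b" if i: "lead_sum n f (Inl i) > 0" for i
  proof -
    obtain L where L: "L \<in> labels n" "f L > 0" "lookup (lead n L) (Inl i) > 0"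
      using i unfolding lead_sum_pos_iff[OF n] by blast
    from n L(1) show ?thesis
    proof (cases rule: labels_lead_cases)
      case (blue c)
      then have "i = c" using L(3) by (auto simp: lookup_single when_def split: if_splits)
      then show ?thesis using diam[of c] blue L by simp
    next
      case (red c)
      then have "i = c" using L(3) by (auto simp: lookup_single lookup_add when_def split: if_splits)
      then show ?thesis using diam[of c] red L by simp
    next
      case (inner c d)
      then show ?thesis using assms(3)[of c d] L by simp
    next
      case (wrap c d)
      then have "i = c \<or> i = d" using L(3) by (auto simp: lookup_single lookup_add when_def split: if_splits)
      then show ?thesis using \<open>\<And>d c. 1 \<le> c \<Longrightarrow> c < d \<Longrightarrow> d \<le> n \<Longrightarrow> 0 < f (arc n d (c + n)) \<Longrightarrow> a \<le> c \<and> d \<le> b\<close>[of c d] wrap L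
        by auto
    qed
  qed
  have "lead_sum n f (Inl a) > 0" "lead_sum n f (Inl b) > 0"
    unfolding lead_sum_pos_iff[OF n] using abl ab n1
    by (auto intro!: bexI[of _ "arc n b (a + n)"] simp: lead_arc_wrap lookup_add)
  with that ab range show thesis by blast
qed

text \<open>The innermost wrapping arc is given by the least and the greatest endpoint, so \<open>g\<close> can avoid it only by
  having no wrapping arc. Then \<open>g\<close> consists of red diameters, and comparing the total degrees in the \<open>B\<close>
  with the degree in \<open>y\<^sub>n\<close> gives a contradiction.\<close>

lemma no_wrap:
  assumes n: "2 \<le> n" and f: "crossing_free n f" and g: "crossing_free n g"
    and eq: "\<And>i. lead_sum n f i = lead_sum n g i"
    and disj: "\<And>L. L \<in> labels n \<Longrightarrow> f L = 0 \<or> g L = 0"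
    and inner: "\<And>a b. 1 \<le> a \<Longrightarrow> a < b \<Longrightarrow> b \<le> n \<Longrightarrow> f (arc n a b) = 0 \<and> g (arc n a b) = 0"
    and ab: "1 \<le> a0" "a0 < b0" "b0 \<le> n"
  shows "f (arc n b0 (a0 + n)) = 0"
proof (rule ccontr)
  have n1: "1 \<le> n" using n by simp
  have innerf: "\<And>a b. 1 \<le> a \<Longrightarrow> a < b \<Longrightarrow> b \<le> n \<Longrightarrow> f (arc n a b) = 0"
    and innerg: "\<And>a b. 1 \<le> a \<Longrightarrow> a < b \<Longrightarrow> b \<le> n \<Longrightarrow> g (arc n a b) = 0"
    using inner by blast+
  assume "f (arc n b0 (a0 + n)) \<noteq> 0"
  then have f0: "f (arc n b0 (a0 + n)) > 0" by simp
  obtain a b where ab: "1 \<le> a" "a < b" "b \<le> n" "f (arc n b (a + n)) > 0"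
    and range: "\<And>i. lead_sum n f (Inl i) > 0 \<Longrightarrow> a \<le> i \<and> i \<le> b"
    and pos: "lead_sum n f (Inl a) > 0" "lead_sum n f (Inl b) > 0"
    using innermost_wrap[OF n f innerf assms(7-9) f0] by blast
  have abl: "arc n b (a + n) \<in> labels n" using ab n by (intro arc_labels) auto
  have wrapg: "g (arc n d (c + n)) = 0" if cd: "1 \<le> c" "c < d" "d \<le> n" for c d
  proof (rule ccontr)
    assume "g (arc n d (c + n)) \<noteq> 0"
    then have g0: "g (arc n d (c + n)) > 0" by simp
    obtain a' b' where ab': "1 \<le> a'" "a' < b'" "b' \<le> n" "g (arc n b' (a' + n)) > 0"
      and range': "\<And>i. lead_sum n g (Inl i) > 0 \<Longrightarrow> a' \<le> i \<and> i \<le> b'"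
      and pos': "lead_sum n g (Inl a') > 0" "lead_sum n g (Inl b') > 0"
      using innermost_wrap[OF n g innerg cd g0] by blast
    have "a = a'" "b = b'"
      using range[of a'] range[of b'] range'[of a] range'[of b] pos pos' eq by force+
    then show False using disj[OF abl] ab ab' by simp
  qed
  have gdiam: "L = bl n i \<or> L = rd n i"
    if L: "L \<in> labels n" "g L > 0" "lookup (lead n L) (Inl i) > 0" for L i
    using n L(1,3)
  proof (cases rule: lookup_lead_endpoint)
    case (3 d)
    then show ?thesis using inner[of i d] L by simp
  next
    case (4 d)
    then show ?thesis using inner[of d i] L by simp
  next
    case (5 d)
    then show ?thesis using wrapg[of d i] L by simp
  next
    case (6 d)
    then show ?thesis using wrapg[of i d] L by simp
  qed simp_all
  have ga: "g (bl n i) > 0 \<or> g (rd n i) > 0" if "lead_sum n g (Inl i) > 0" for i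
  proof -
    obtain L where L: "L \<in> labels n" "g L > 0" "lookup (lead n L) (Inl i) > 0"
      using lead_sum_pos_iff[OF n, of g] \<open>lead_sum n g (Inl i) > 0\<close> by blast
    from gdiam[OF L] L(2) show ?thesis by auto
  qed
  have d: "g (bl n a) > 0 \<or> g (rd n a) > 0" "g (bl n b) > 0 \<or> g (rd n b) > 0"
    using ga pos eq by simp_all
  have br: "i = j" if ij: "1 \<le> i" "i \<le> n" "1 \<le> j" "j \<le> n" "g (bl n i) > 0" "g (rd n j) > 0" for i j
  proof (rule ccontr)
    assume "i \<noteq> j"
    then have "crossing n (bl n i) (rd n j)"
      using crossing.blue_red[of i j n] crossing.blue_red[of i "j + n" n] rd_shift[of j n] ij by (cases "i < j") auto
    then show False
      using g ij bl_labels[OF n1, of i] rd_labels[OF n1, of j] unfolding crossing_free_def by blast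
  qed
  have "lead_sum n f (Inr n) > 0"
    unfolding lead_sum_pos_iff[OF n] using abl ab n1
    by (auto intro!: bexI[of _ "arc n b (a + n)"] simp: lead_arc_wrap lookup_add)
  then have "lead_sum n g (Inr n) > 0" using eq by simp
  then obtain L where L: "L \<in> labels n" "g L > 0" "lookup (lead n L) (Inr n) > 0"
    unfolding lead_sum_pos_iff[OF n] by blast
  from n L(1) obtain r where r: "1 \<le> r" "r \<le> n" "g (rd n r) > 0"
  proof (cases rule: labels_lead_cases)
    case (blue c)
    then show thesis using L by (simp add: lookup_single)
  next
    case (inner c d)
    then show thesis using assms(6)[of c d] L by simp
  next
    case (wrap c d)
    then show thesis using wrapg[of c d] L by simp
  qed (use L that in auto)
  \<comment> \<open>A blue diameter of g forces all red ones to its vertex, and the red one at r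
    then forces all blue ones to r as well; but g has diameters at the two distinct vertices a and
    b.\<close>
  have noblue: "g (bl n i) = 0" if i: "1 \<le> i" "i \<le> n" for i
  proof (rule ccontr)
    assume "g (bl n i) \<noteq> 0"
    then have gi: "g (bl n i) > 0" by simp
    then have "i = r" using br[of i r] i r by simp
    have e: "c = r" if "c = a \<or> c = b" for c
      using that d br[of c r] br[of i c] ab r gi i \<open>i = r\<close> by auto
    show False using e[of a] e[of b] ab by simp
  qed
  \<comment> \<open>The pair (degree in all B, degree in y_n) is (2, 1) for a wrapping arc, (1, 1)
    for a red and (1, 0) for a blue diameter. So the totals agree for g, which now has only red
    diameters, and differ strictly for f.\<close>
  define bdeg where "bdeg L = (\<Sum>i\<in>{1..n}. lookup (lead n L) (Inl i))" for L
  define ydeg where "ydeg L = lookup (lead n L) (Inr n)" for L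
  have bsum: "(\<Sum>L\<in>labels n. h L * bdeg L) = (\<Sum>i\<in>{1..n}. lead_sum n h (Inl i))" for h
    unfolding bdeg_def lead_sum_def sum_distrib_left by (rule sum.swap)
  have "(\<Sum>L\<in>labels n. f L * ydeg L) < (\<Sum>L\<in>labels n. f L * bdeg L)"
  proof (rule sum_strict_mono_ex1)
    show "finite (labels n)" using finite_labels[OF n] .
    show "\<forall>L\<in>labels n. f L * ydeg L \<le> f L * bdeg L"
    proof
      fix L assume L: "L \<in> labels n"
      from n L show "f L * ydeg L \<le> f L * bdeg L"
      proof (cases rule: labels_lead_cases)
        case (inner c d)
        then show ?thesis using assms(6)[of c d] by simp
      qed (auto simp: ydeg_def bdeg_def lookup_add lookup_single sum.distrib when_def)
    qed
    have "ydeg (arc n b (a + n)) < bdeg (arc n b (a + n))"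
      using ab n1 by (simp add: ydeg_def bdeg_def lead_arc_wrap lookup_add lookup_single sum.distrib when_def)
    then show "\<exists>L\<in>labels n. f L * ydeg L < f L * bdeg L"
      using abl ab by (intro bexI[of _ "arc n b (a + n)"]) auto
  qed
  also have "\<dots> = (\<Sum>L\<in>labels n. g L * bdeg L)"
    unfolding bsum by (simp add: eq)
  also have "\<dots> = (\<Sum>L\<in>labels n. g L * ydeg L)"
  proof (rule sum.cong[OF refl])
    fix L assume L: "L \<in> labels n"
    from n L show "g L * bdeg L = g L * ydeg L"
    proof (cases rule: labels_lead_cases)
      case (blue c)
      then show ?thesis using noblue[of c] by simp
    next
      case (inner c d)
      then show ?thesis using assms(6)[of c d] by simp
    next
      case (wrap c d)
      then show ?thesis using wrapg[of c d] by simp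
    qed (auto simp: ydeg_def bdeg_def lookup_add lookup_single sum.distrib when_def)
  qed
  also have "\<dots> = (\<Sum>L\<in>labels n. f L * ydeg L)"
    using eq[of "Inr n"] by (simp only: lead_sum_def ydeg_def)
  finally show False by simp
qed

text \<open>Without arcs, y_n counts red diameters. If f has a red one at a, then g has a label at
  a, which must be blue by disjointness, and some red one at a vertex other than a; these two
  cross.\<close>

lemma no_red:
  assumes n: "2 \<le> n" and g: "crossing_free n g"
    and eq: "\<And>i. lead_sum n f i = lead_sum n g i"
    and disj: "\<And>L. L \<in> labels n \<Longrightarrow> f L = 0 \<or> g L = 0"
    and arcs: "\<And>a b. 1 \<le> a \<Longrightarrow> a \<le> n \<Longrightarrow> a < b \<Longrightarrow> b < a + n \<Longrightarrow> f (arc n a b) = 0 \<and> g (arc n a b) = 0"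
    and a: "1 \<le> a" "a \<le> n"
  shows "f (rd n a) = 0"
proof (rule ccontr)
  have n1: "1 \<le> n" using n by simp
  assume fa: "f (rd n a) \<noteq> 0"
  have endpoint: "g (bl n i) > 0 \<or> g (rd n i) > 0"
    if i: "1 \<le> i" "i \<le> n" and pos: "lead_sum n g (Inl i) > 0" for i
  proof -
    obtain L where L: "L \<in> labels n" "g L > 0" "lookup (lead n L) (Inl i) > 0"
      using pos unfolding lead_sum_pos_iff[OF n] by blast
    from n L(1) show ?thesis
    proof (cases rule: labels_cases)
      case (arc c d)
      then show ?thesis using arcs[of c d] L by simp
    qed (use L in \<open>auto simp: lead_bl lead_rd lookup_add lookup_single when_def split: if_splits\<close>)
  qed
  have fpos: "lead_sum n f (Inl a) > 0" "lead_sum n f (Inr n) > 0"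
    unfolding lead_sum_pos_iff[OF n] using a fa rd_labels[OF n1, of a]
    by (auto intro!: bexI[of _ "rd n a"] simp: lead_rd lookup_add lookup_single simp del: Un_iff)
  then have ga: "g (bl n a) > 0"
    using endpoint[OF a] eq disj[OF rd_labels[OF n1, of a]] a fa by auto
  obtain L where L: "L \<in> labels n" "g L > 0" "lookup (lead n L) (Inr n) > 0"
    using fpos(2) eq lead_sum_pos_iff[OF n, of g "Inr n"] by auto
  from n L(1) obtain b where b: "1 \<le> b" "b \<le> n" "g (rd n b) > 0"
  proof (cases rule: labels_cases)
    case (arc c d)
    then show thesis using arcs[of c d] L by simp
  qed (use L that in \<open>auto simp: lead_bl lookup_single\<close>)
  have "a \<noteq> b" using disj[OF rd_labels[OF n1, of a]] a fa b by auto
  then have "crossing n (bl n a) (rd n b)"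
    using crossing.blue_red[of a b n] crossing.blue_red[of a "b + n" n] rd_shift[of b n] a b by (cases "a < b") auto
  then show False
    using g a b ga bl_labels[OF n1, of a] rd_labels[OF n1, of b] unfolding crossing_free_def by blast
qed

text \<open>Each kind of label is removed from both f and g before the next: inner arcs, wrapping
  arcs, red diameters. Blue diameters come last, when the B-exponents alone identify them.\<close>

lemma disjoint_lead_sum_zero:
  assumes n: "2 \<le> n" and f: "crossing_free n f" and g: "crossing_free n g"
    and eq: "\<And>i. lead_sum n f i = lead_sum n g i"
    and disj: "\<And>L. L \<in> labels n \<Longrightarrow> f L = 0 \<or> g L = 0"
    and L: "L \<in> labels n"
  shows "f L = 0"
proof -
  have n1: "1 \<le> n" using n by simp
  have inner: "f (arc n a b) = 0 \<and> g (arc n a b) = 0" if "1 \<le> a" "a < b" "b \<le> n" for a b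
    by (rule no_common_inner[OF n f g eq _ that]) (erule disj)
  have disj': "g L = 0 \<or> f L = 0" if "L \<in> labels n" for L
    using disj[OF that] by (rule disj_commute[THEN iffD1])
  have inner': "g (arc n a b) = 0 \<and> f (arc n a b) = 0" if "1 \<le> a" "a < b" "b \<le> n" for a b
    using inner[OF that] by simp
  have wrap: "f (arc n b (a + n)) = 0 \<and> g (arc n b (a + n)) = 0" if "1 \<le> a" "a < b" "b \<le> n" for a b
  proof
    show "f (arc n b (a + n)) = 0"
      by (rule no_wrap[OF n f g eq _ _ that]) (erule disj, (rule inner; assumption))
    show "g (arc n b (a + n)) = 0"
      by (rule no_wrap[OF n g f eq[symmetric] _ _ that]) (erule disj', (rule inner'; assumption))
  qed
  have arcs: "f (arc n a b) = 0 \<and> g (arc n a b) = 0" if ab: "1 \<le> a" "a \<le> n" "a < b" "b < a + n" for a b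
  proof (cases "b \<le> n")
    case True
    then show ?thesis using inner ab by simp
  next
    case False
    then show ?thesis using wrap[of "b - n" a] ab by simp
  qed
  have arcs': "g (arc n a b) = 0 \<and> f (arc n a b) = 0" if "1 \<le> a" "a \<le> n" "a < b" "b < a + n" for a b
    using arcs[OF that] by simp
  have redf: "f (rd n a) = 0" if "1 \<le> a" "a \<le> n" for a
    by (rule no_red[OF n g eq _ _ that]) (erule disj, (rule arcs; assumption))
  have redg: "g (rd n a) = 0" if "1 \<le> a" "a \<le> n" for a
    by (rule no_red[OF n f eq[symmetric] _ _ that]) (erule disj', (rule arcs'; assumption))
  from n L show ?thesis
  proof (cases rule: labels_cases)
    case (blue a)
    show ?thesis
    proof (rule ccontr)
      assume "f L \<noteq> 0"
      then have "lead_sum n f (Inl a) > 0"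
        unfolding lead_sum_pos_iff[OF n] using blue L
        by (auto intro!: bexI[of _ L] simp: lead_bl simp del: Un_iff)
      then obtain M where M: "M \<in> labels n" "g M > 0" "lookup (lead n M) (Inl a) > 0"
        using eq lead_sum_pos_iff[OF n, of g] by auto
      from n M(1) have "M = L"
      proof (cases rule: labels_cases)
        case (blue b)
        then show ?thesis using M \<open>L = bl n a\<close> by (auto simp: lead_bl lookup_single when_def split: if_splits)
      next
        case (red b)
        then show ?thesis using M redg[of b] by simp
      next
        case (arc b c)
        then show ?thesis using M arcs[of b c] by simp
      qed
      then show False using disj[OF L] M \<open>f L \<noteq> 0\<close> by simp
    qed
  next
    case (red a)
    then show ?thesis using redf[of a] by simp
  next
    case (arc a b)
    then show ?thesis using arcs[of a b] by simp
  qed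
qed

lemma crossing_free_determined:
  assumes n: "2 \<le> n" and f: "crossing_free n f" and g: "crossing_free n g"
    and eq: "\<And>i. lead_sum n f i = lead_sum n g i" and L: "L \<in> labels n"
  shows "f L = g L"
proof -
  \<comment> \<open>Cancelling the common labels makes the supports disjoint.\<close>
  define h where "h L = min (f L) (g L)" for L
  have split: "lead_sum n k i = lead_sum n (\<lambda>L. k L - h L) i + lead_sum n h i" if "\<And>L. h L \<le> k L" for k i
    unfolding lead_sum_def sum.distrib[symmetric]
    by (rule sum.cong[OF refl]) (metis add_mult_distrib le_add_diff_inverse2 that)
  have hf: "\<And>L. h L \<le> f L" "\<And>L. h L \<le> g L" by (simp_all add: h_def)
  have eq': "lead_sum n (\<lambda>L. f L - h L) i = lead_sum n (\<lambda>L. g L - h L) i" for i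
    using split[OF hf(1), of i] split[OF hf(2), of i] eq[of i] by simp
  have cf: "crossing_free n (\<lambda>L. f L - h L)" "crossing_free n (\<lambda>L. g L - h L)"
    using f g unfolding crossing_free_def by auto
  have d: "f L - h L = 0 \<or> g L - h L = 0" for L by (auto simp: h_def)
  have d': "g L - h L = 0 \<or> f L - h L = 0" for L by (auto simp: h_def)
  have "f L - h L = 0" by (rule disjoint_lead_sum_zero[OF n cf eq' _ L]) (rule d)
  moreover have "g L - h L = 0" by (rule disjoint_lead_sum_zero[OF n cf(2,1) eq'[symmetric] _ L]) (rule d')
  ultimately show ?thesis by (auto simp: h_def)
qed

section \<open>Linear independence of crossing-free monomials\<close>

text \<open>A weight replaces a monomial order: the top weight occurs in a single monomial, with
  coefficient 1, so products need no tie-breaking.\<close>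

definition leading :: "(('i \<Rightarrow>\<^sub>0 nat) \<Rightarrow> nat) \<Rightarrow> (('i \<Rightarrow>\<^sub>0 nat) \<Rightarrow>\<^sub>0 'k::comm_ring_1) \<Rightarrow> ('i \<Rightarrow>\<^sub>0 nat) \<Rightarrow> bool" where
  "leading W p \<mu> \<longleftrightarrow> (\<exists>q. p = single \<mu> 1 + q \<and> (\<forall>\<kappa>\<in>keys q. W \<kappa> < W \<mu>))"

lemma leading_single: "leading W (single \<mu> 1) \<mu>"
  unfolding leading_def by (rule exI[of _ 0]) simp

lemma leading_one: "leading W 1 0"
  using leading_single[of W 0] by simp

lemma leading_mult:
  assumes W: "\<And>a b. W (a + b) = W a + W b" and "leading W p \<mu>" "leading W q \<nu>"
  shows "leading W (p * q) (\<mu> + \<nu>)"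
proof -
  obtain p' where p: "p = single \<mu> 1 + p'" "\<And>\<kappa>. \<kappa> \<in> keys p' \<Longrightarrow> W \<kappa> < W \<mu>"
    using assms(2) unfolding leading_def by blast
  obtain q' where q: "q = single \<nu> 1 + q'" "\<And>\<kappa>. \<kappa> \<in> keys q' \<Longrightarrow> W \<kappa> < W \<nu>"
    using assms(3) unfolding leading_def by blast
  let ?r = "single \<mu> 1 * q' + (p' * single \<nu> 1 + p' * q')"
  have "p * q = single (\<mu> + \<nu>) 1 + ?r"
    unfolding p(1) q(1) by (simp add: algebra_simps mult_single)
  moreover have "W \<kappa> < W (\<mu> + \<nu>)" if \<kappa>: "\<kappa> \<in> keys ?r" for \<kappa>
  proof -
    have sub: "keys (single \<mu> (1::'b)) \<subseteq> {\<mu>}"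
      "keys (single \<nu> (1::'b)) \<subseteq> {\<nu>}" by simp_all
    consider "\<kappa> \<in> keys (single \<mu> 1 * q')"
      | "\<kappa> \<in> keys (p' * single \<nu> 1)" | "\<kappa> \<in> keys (p' * q')"
      using \<kappa> keys_add[of "single \<mu> 1 * q'" "p' * single \<nu> 1 + p' * q'"]
        keys_add[of "p' * single \<nu> 1" "p' * q'"] by blast
    then show ?thesis
    proof cases
      case 1
      then obtain b where "\<kappa> = \<mu> + b" "b \<in> keys q'"
        using keys_mult[of "single \<mu> 1" q'] sub by blast
      then show ?thesis using q(2) by (simp add: W)
    next
      case 2
      then obtain a where "\<kappa> = a + \<nu>" "a \<in> keys p'"
        using keys_mult[of p' "single \<nu> 1"] sub by blast
      then show ?thesis using p(2) by (simp add: W)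
    next
      case 3
      then obtain a b where "\<kappa> = a + b" "a \<in> keys p'" "b \<in> keys q'"
        using keys_mult[of p' q'] by blast
      then show ?thesis using p(2)[of a] q(2)[of b] by (simp add: W)
    qed
  qed
  ultimately show ?thesis unfolding leading_def by blast
qed

lemma leading_power:
  assumes "\<And>a b. W (a + b) = W a + W b" "leading W p \<mu>"
  shows "leading W (p ^ k) (\<Sum>_<k. \<mu>)"
proof (induction k)
  case 0
  show ?case using leading_one by simp
next
  case (Suc k)
  then show ?case using leading_mult[OF assms(1) Suc assms(2)] by (simp add: mult.commute)
qed

lemma leading_prod:
  assumes "\<And>a b. W (a + b) = W a + W b" "finite A" "\<And>a. a \<in> A \<Longrightarrow> leading W (h a) (\<mu> a)"
  shows "leading W (\<Prod>a\<in>A. h a) (\<Sum>a\<in>A. \<mu> a)"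
  using assms(2,3)
proof (induction A rule: finite_induct)
  case empty
  show ?case using leading_one by simp
next
  case (insert a A)
  then show ?case using leading_mult[OF assms(1), of "h a" "\<mu> a" "prod h A"] by simp
qed

lemma leading_lookup:
  assumes "leading W p \<mu>"
  shows "lookup p \<mu> = 1" "lookup p \<kappa> \<noteq> 0 \<Longrightarrow> \<kappa> = \<mu> \<or> W \<kappa> < W \<mu>"
proof -
  obtain q where q: "p = single \<mu> 1 + q" "\<And>\<kappa>. \<kappa> \<in> keys q \<Longrightarrow> W \<kappa> < W \<mu>"
    using assms unfolding leading_def by blast
  have "lookup q \<mu> = 0" using q(2)[of \<mu>] by (auto simp: in_keys_iff)
  then show "lookup p \<mu> = 1" by (simp add: q(1) lookup_add)
  show "\<kappa> = \<mu> \<or> W \<kappa> < W \<mu>" if "lookup p \<kappa> \<noteq> 0"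
    using that q(2)[of \<kappa>] by (auto simp: q(1) lookup_add lookup_single in_keys_iff when_def split: if_splits)
qed

section \<open>Polynomials in a given set of variables\<close>

definition polys :: "'v set \<Rightarrow> (('v \<Rightarrow>\<^sub>0 nat) \<Rightarrow>\<^sub>0 'k::comm_ring_1) set" where
  "polys X = {p. \<forall>m\<in>keys p. keys m \<subseteq> X}"

lemma polysD: "p \<in> polys X \<Longrightarrow> m \<in> keys p \<Longrightarrow> keys m \<subseteq> X"
  by (simp add: polys_def)

lemma polys_add: "p \<in> polys X \<Longrightarrow> q \<in> polys X \<Longrightarrow> p + q \<in> polys X"
  using keys_add[of p q] unfolding polys_def by blast

lemma polys_uminus: "p \<in> polys X \<Longrightarrow> - p \<in> polys X"
  by (simp add: polys_def in_keys_iff)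

lemma polys_mult:
  assumes "p \<in> polys X" "q \<in> polys X"
  shows "p * q \<in> polys X"
  unfolding polys_def
proof (intro CollectI ballI)
  fix m assume "m \<in> keys (p * q)"
  then obtain a b where "a \<in> keys p" "b \<in> keys q" "m = a + b"
    using keys_mult[of p q] by blast
  then show "keys m \<subseteq> X"
    using keys_add[of a b] polysD[OF assms(1)] polysD[OF assms(2)] by blast
qed

lemma polys_single: "keys m \<subseteq> X \<Longrightarrow> single m c \<in> polys X"
  by (simp add: polys_def)

lemma polys_zero: "0 \<in> polys X"
  by (simp add: polys_def)

lemma polys_one: "1 \<in> polys X"
  using polys_single[of 0 X 1] by simp

lemma polys_sum: "(\<And>a. a \<in> A \<Longrightarrow> h a \<in> polys X) \<Longrightarrow> sum h A \<in> polys X"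
proof (induction A rule: infinite_finite_induct)
  case (insert a A)
  then show ?case using polys_add[of "h a" X "sum h A"] by simp
qed (simp_all add: polys_zero)

lemma polys_prod: "(\<And>a. a \<in> A \<Longrightarrow> h a \<in> polys X) \<Longrightarrow> prod h A \<in> polys X"
proof (induction A rule: infinite_finite_induct)
  case (insert a A)
  then show ?case using polys_mult[of "h a" X "prod h A"] by simp
qed (simp_all add: polys_one)

lemma polys_power: "p \<in> polys X \<Longrightarrow> p ^ k \<in> polys X"
  using polys_prod[of "{..<k}" "\<lambda>_. p" X] by simp

lemma lookup_scalar_mult: "lookup (single 0 c * p) m = c * lookup p m"
proof (induction p rule: poly_mapping_induct_single)
  case (single p m' c')
  then show ?case by (simp add: distrib_left lookup_add mult_single lookup_single when_def)
qed simp

section \<open>Expansion of the cluster variables in B and y\<close>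

context D_model
begin

definition By_family :: "nat + nat \<Rightarrow> 'f" where
  "By_family i = (case i of Inl a \<Rightarrow> B a | Inr a \<Rightarrow> y a)"

lemma alg_indep_By: "alg_indep \<iota> By_family Idx"
proof -
  \<comment> \<open>In \<open>fam j\<close> the first j edges are already replaced by y_1, ..., y_j;
    each step divides one member by a product of two blue diameters.\<close>
  define fam where "fam j i = (case i of Inl a \<Rightarrow> B a | Inr a \<Rightarrow> if a \<le> j then y a else A a (a + 1))" for j i
  have "alg_indep \<iota> (fam j) Idx" if "j \<le> n" for j
    using that
  proof (induction j)
    case 0
    have "alg_indep \<iota> initial_family Idx \<longleftrightarrow> alg_indep \<iota> (fam 0) Idx"
      by (rule alg_indep_cong) (auto simp: fam_def initial_family_def)
    then show ?case using alg_indep_initial by simp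
  next
    case (Suc j)
    let ?i = "Inr (Suc j) :: nat + nat"
    let ?d = "B (Suc j) * B (Suc j + 1)"
    \<comment> \<open>The second divisor may be B_(n+1), which is B_1; general positive indices are
      therefore reduced to 1..n.\<close>
    have Bgen: "B a \<in> generated \<iota> (fam j ` (Idx - {?i}))" if a: "1 \<le> a" for a
    proof -
      obtain a0 k where a0: "1 \<le> a0" "a0 \<le> n" "a = a0 + k * n" using shift_reduce[OF n1 a] by blast
      then have "B a = fam j (Inl a0)" by (simp add: fam_def bl_shift_mult)
      moreover have "Inl a0 \<in> Idx - {?i}" using a0 by auto
      ultimately show ?thesis by (metis generated.generator image_eqI)
    qed
    have "alg_indep \<iota> ((fam j)(?i := fam j ?i / ?d)) Idx"
      using Suc B_nonzero[of "Suc j"] B_nonzero[of "Suc j + 1"]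
      by (intro alg_indep_scale[OF \<iota>] generated.mult Bgen) auto
    moreover have "(fam j)(?i := fam j ?i / ?d) = fam (Suc j)"
      by (auto simp: fun_eq_iff fam_def y_def split: sum.split)
    ultimately show ?case by simp
  qed
  then have "alg_indep \<iota> (fam n) Idx" by simp
  moreover have "alg_indep \<iota> By_family Idx \<longleftrightarrow> alg_indep \<iota> (fam n) Idx"
    by (rule alg_indep_cong) (auto simp: fam_def By_family_def)
  ultimately show ?thesis by simp
qed

text \<open>Weight i on y_i and 0 on every B, which realizes y_1 < ... < y_n.\<close>

definition Wy :: "(nat + nat \<Rightarrow>\<^sub>0 nat) \<Rightarrow> nat" where
  "Wy \<mu> = (\<Sum>i\<in>{1..n}. i * lookup \<mu> (Inr i))"

lemma Wy_add: "Wy (\<mu> + \<nu>) = Wy \<mu> + Wy \<nu>"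
  by (simp add: Wy_def lookup_add distrib_left sum.distrib)

definition bvar :: "nat \<Rightarrow> (nat + nat \<Rightarrow>\<^sub>0 nat) \<Rightarrow>\<^sub>0 'k" where
  "bvar a = single (single (Inl a) 1) 1"

definition yvar :: "nat \<Rightarrow> (nat + nat \<Rightarrow>\<^sub>0 nat) \<Rightarrow>\<^sub>0 'k" where
  "yvar a = single (single (Inr a) 1) 1"

lemma poly_eval_vars: "poly_eval \<iota> By_family (bvar a) = B a" "poly_eval \<iota> By_family (yvar a) = y a"
  using \<iota> by (simp_all add: bvar_def yvar_def poly_eval_single[OF \<iota>] mono_eval_single By_family_def field_embedding_def)

lemma leading_sum_y:
  assumes S: "S \<subseteq> {1..n}" "j \<in> S" "\<And>i. i \<in> S \<Longrightarrow> i \<le> j"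
  shows "leading Wy (\<Sum>i\<in>S. yvar i) (single (Inr j) 1)"
proof -
  have fin: "finite S" using S(1) by (rule finite_subset) simp
  have W: "Wy (single (Inr i) 1) = i" if "i \<in> S" for i
  proof -
    have "Wy (single (Inr i) 1) = (\<Sum>k\<in>{1..n}. if k = i then i else 0)"
      unfolding Wy_def by (rule sum.cong) (auto simp: lookup_single when_def)
    then show ?thesis using that S(1) by (simp add: subset_iff)
  qed
  have "(\<Sum>i\<in>S. yvar i) = single (single (Inr j) 1) 1 + (\<Sum>i\<in>S - {j}. yvar i)"
    using fin S(2) by (simp add: sum.remove yvar_def)
  moreover have "Wy \<kappa> < Wy (single (Inr j) 1)" if \<kappa>: "\<kappa> \<in> keys (\<Sum>i\<in>S - {j}. yvar i)" for \<kappa>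
  proof -
    obtain i where i: "i \<in> S - {j}" "\<kappa> \<in> keys (yvar i)"
      using \<kappa> keys_sum[of yvar "S - {j}"] by blast
    then have "\<kappa> = single (Inr i) 1" by (simp add: yvar_def)
    then show ?thesis using W[of i] W[OF S(2)] S(3)[of i] i by auto
  qed
  ultimately show ?thesis unfolding leading_def by blast
qed

lemma vars_in_polys: "a \<in> {1..n} \<Longrightarrow> bvar a \<in> polys Idx" "a \<in> {1..n} \<Longrightarrow> yvar a \<in> polys Idx"
  by (auto simp: bvar_def yvar_def intro!: polys_single)

lemma label_poly:
  assumes L: "L \<in> labels n"
  shows "\<exists>p\<in>polys Idx. poly_eval \<iota> By_family p = x L \<and> leading Wy p (lead n L)"
proof -
  have arc: "\<exists>p\<in>polys Idx. poly_eval \<iota> By_family p = B a * B b * (\<Sum>i\<in>S. y i) \<and>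
      leading Wy p (single (Inl a) 1 + single (Inl b) 1 + single (Inr j) 1)"
    if "a \<in> {1..n}" "b \<in> {1..n}" "S \<subseteq> {1..n}" "j \<in> S" "\<And>i. i \<in> S \<Longrightarrow> i \<le> j" for a b S j
  proof (intro bexI conjI)
    show "poly_eval \<iota> By_family (bvar a * bvar b * (\<Sum>i\<in>S. yvar i)) = B a * B b * (\<Sum>i\<in>S. y i)"
      by (simp add: poly_eval_mult[OF \<iota>] poly_eval_sum[OF \<iota>] poly_eval_vars)
    show "leading Wy (bvar a * bvar b * (\<Sum>i\<in>S. yvar i))
        (single (Inl a) 1 + single (Inl b) 1 + single (Inr j) 1)"
      using leading_mult[OF Wy_add leading_mult[OF Wy_add leading_single leading_single] leading_sum_y[OF that(3,4)]]
        that(5) by (simp add: bvar_def)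
    show "bvar a * bvar b * (\<Sum>i\<in>S. yvar i) \<in> polys Idx"
      by (intro polys_mult polys_sum vars_in_polys) (use that in auto)
  qed
  from n2 L show ?thesis
  proof (cases rule: labels_lead_cases)
    case (blue a)
    then show ?thesis
      using vars_in_polys(1)[of a] poly_eval_vars(1)[of a] leading_single
      by (intro bexI[of _ "bvar a"]) (auto simp: bvar_def)
  next
    case (red a)
    show ?thesis
    proof (intro bexI conjI)
      show "poly_eval \<iota> By_family (bvar a * (\<Sum>i\<in>{1..n}. yvar i)) = x L"
        using red R_eq[of a] by (simp add: poly_eval_mult[OF \<iota>] poly_eval_sum[OF \<iota>] poly_eval_vars \<tau>_def)
      have "leading Wy (\<Sum>i\<in>{1..n}. yvar i) (single (Inr n) 1)"
        by (rule leading_sum_y) (use n1 in auto)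
      from leading_mult[OF Wy_add leading_single this]
      show "leading Wy (bvar a * (\<Sum>i\<in>{1..n}. yvar i)) (lead n L)"
        using red by (simp add: bvar_def)
      show "bvar a * (\<Sum>i\<in>{1..n}. yvar i) \<in> polys Idx"
        by (intro polys_mult polys_sum vars_in_polys) (use red in auto)
    qed
  next
    case (inner a b)
    then have "x L = B a * B b * (\<Sum>i\<in>{a..<b}. y i)" using A_eq[of a b] by simp
    moreover have "a \<in> {1..n}" "b \<in> {1..n}" "{a..<b} \<subseteq> {1..n}" "b - 1 \<in> {a..<b}"
      using inner by auto
    moreover have
      "i \<le> b - 1" if "i \<in> {a..<b}" for i using inner that by auto
    ultimately show ?thesis using arc[of a b "{a..<b}" "b - 1"] inner(5) by metis
  next
    case (wrap a b)
    \<comment> \<open>The indices beyond n are moved back to 1..a-1. Since a < b these are disjoint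
      from b..n, so no y_i occurs twice and y_n is the greatest.\<close>
    have "(\<Sum>i\<in>{b..<a + n}. y i) = (\<Sum>i\<in>{b..<1 + n}. y i) + (\<Sum>i\<in>{1 + n..<a + n}. y i)"
      using wrap by (intro sum_y_split) auto
    also have "(\<Sum>i\<in>{1 + n..<a + n}. y i) = (\<Sum>i\<in>{1..<a}. y i)" by (rule sum_y_shift) simp
    also have "(\<Sum>i\<in>{b..<1 + n}. y i) + (\<Sum>i\<in>{1..<a}. y i) = (\<Sum>i\<in>{b..<1 + n} \<union> {1..<a}. y i)"
      using wrap by (intro sum.union_disjoint[symmetric]) auto
    finally have S: "(\<Sum>i\<in>{b..<a + n}. y i) = (\<Sum>i\<in>{b..<1 + n} \<union> {1..<a}. y i)" .
    have "x L = B b * B a * (\<Sum>i\<in>{b..<a + n}. y i)"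
      using wrap A_eq[of b "a + n"] bl_shift[of a n] by simp
    then have "x L = B a * B b * (\<Sum>i\<in>{b..<1 + n} \<union> {1..<a}. y i)" unfolding S by simp
    moreover have "a \<in> {1..n}" "b \<in> {1..n}" "{b..<1 + n} \<union> {1..<a} \<subseteq> {1..n}" "n \<in> {b..<1 + n} \<union> {1..<a}"
      using wrap by auto
    moreover have "i \<le> n" if "i \<in> {b..<1 + n} \<union> {1..<a}" for i using that wrap by auto
    ultimately show ?thesis using arc[of a b "{b..<1 + n} \<union> {1..<a}" n] wrap(5) by metis
  qed
qed

lemma monomial_value_labels:
  assumes "keys m \<subseteq> all_variables s0"
  shows "monomial_value m = (\<Prod>L\<in>labels n. x L ^ lookup m (x L))"
proof -
  have "monomial_value m = (\<Prod>v\<in>x ` labels n. v ^ lookup m v)"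
    unfolding monomial_value_eq_mono_eval using assms finite_labels[OF n2]
    by (intro mono_eval_superset) (auto simp: all_variables_eq)
  then show ?thesis by (simp add: prod.reindex[OF inj_x])
qed

text \<open>Among the monomials of p one is chosen whose leading exponent has greatest weight. No
  other monomial of p can contribute to this exponent after expansion in B and y, so its coefficient
  survives in a polynomial that vanishes by independence of B and y.\<close>

lemma crossing_free_monomials_independent:
  assumes p: "p \<in> polys (all_variables s0)" "poly_value \<iota> p = 0"
    and cf: "\<And>m. m \<in> keys p \<Longrightarrow> crossing_free n (\<lambda>L. lookup m (x L))"
  shows "p = 0"
proof (rule ccontr)
  assume "p \<noteq> 0"
  define e where "e m L = lookup m (x L)" for m :: "'f \<Rightarrow>\<^sub>0 nat" and L
  obtain G where G: "\<And>L. L \<in> labels n \<Longrightarrow> G L \<in> polys Idx"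
    "\<And>L. L \<in> labels n \<Longrightarrow> poly_eval \<iota> By_family (G L) = x L"
    "\<And>L. L \<in> labels n \<Longrightarrow> leading Wy (G L) (lead n L)"
    using label_poly by metis
  define P where "P m = (\<Prod>L\<in>labels n. G L ^ e m L)" for m
  define \<Lambda> where "\<Lambda> m = (\<Sum>L\<in>labels n. \<Sum>_<e m L. lead n L)" for m
  have lead_P: "leading Wy (P m) (\<Lambda> m)" for m
    unfolding P_def \<Lambda>_def
    by (rule leading_prod[OF Wy_add finite_labels[OF n2]]) (rule leading_power[OF Wy_add G(3)])
  have lookup_\<Lambda>: "lookup (\<Lambda> m) i = lead_sum n (e m) i" for m i
    by (simp add: \<Lambda>_def lookup_sum lead_sum_def)
  have eval_P: "poly_eval \<iota> By_family (P m) = monomial_value m" if "m \<in> keys p" for m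
  proof -
    have "keys m \<subseteq> all_variables s0" using polysD[OF p(1) that] .
    then show ?thesis
      unfolding P_def poly_eval_prod[OF \<iota>] poly_eval_power[OF \<iota>]
      by (subst monomial_value_labels) (auto simp: G(2) e_def intro!: prod.cong)
  qed
  define Q where "Q = (\<Sum>m\<in>keys p. single 0 (lookup p m) * P m)"
  have "Q \<in> polys Idx"
    unfolding Q_def P_def by (intro polys_sum polys_mult polys_prod polys_power polys_single G(1)) auto
  moreover have "poly_eval \<iota> By_family Q = 0"
    using p(2) by (simp add: Q_def poly_eval_sum[OF \<iota>] poly_eval_mult[OF \<iota>] poly_eval_single[OF \<iota>] eval_P poly_value_def)
  ultimately have "Q = 0" using alg_indep_poly_eval[OF alg_indep_By] by (simp add: polys_def)
  have "keys p \<noteq> {}" using \<open>p \<noteq> 0\<close> by simp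
  then obtain m0 where m0: "m0 \<in> keys p"
    and max: "\<And>m. m \<in> keys p \<Longrightarrow> Wy (\<Lambda> m) \<le> Wy (\<Lambda> m0)"
  proof -
    let ?S = "(\<lambda>m. Wy (\<Lambda> m)) ` keys p"
    have "finite ?S" by simp
    moreover have "?S \<noteq> {}" using \<open>keys p \<noteq> {}\<close> by blast
    ultimately have "Max ?S \<in> ?S" by (rule Max_in)
    then obtain m0 where "m0 \<in> keys p" "Wy (\<Lambda> m0) = Max ?S" by force
    then show thesis using that[of m0] Max_ge[OF \<open>finite ?S\<close>] by simp
  qed
  \<comment> \<open>A contribution from m needs the exponent to be the leading one of m or to weigh
    less. Maximality leaves equality of leading exponents, and crossing-freeness then gives m =
    m0.\<close>
  have other: "lookup (P m) (\<Lambda> m0) = 0" if m: "m \<in> keys p" "m \<noteq> m0" for m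
  proof (rule ccontr)
    assume "lookup (P m) (\<Lambda> m0) \<noteq> 0"
    then have "\<Lambda> m0 = \<Lambda> m" using leading_lookup(2)[OF lead_P[of m]] max[OF m(1)] by force
    then have "lead_sum n (e m0) i = lead_sum n (e m) i" for i using lookup_\<Lambda> by metis
    then have ee: "e m0 L = e m L" if "L \<in> labels n" for L
      using crossing_free_determined[OF n2 _ _ _ that, of "e m0" "e m"] cf m0 m(1) unfolding e_def by blast
    have "m0 = m"
    proof (rule poly_mapping_eqI)
      fix v
      show "lookup m0 v = lookup m v"
      proof (cases "v \<in> x ` labels n")
        case True
        then show ?thesis using ee by (auto simp: e_def)
      next
        case False
        then have "v \<notin> keys m0" "v \<notin> keys m"
          using polysD[OF p(1) m0] polysD[OF p(1) m(1)] all_variables_eq by auto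
        then show ?thesis by (simp add: in_keys_iff)
      qed
    qed
    then show False using m(2) by simp
  qed
  have "0 = lookup Q (\<Lambda> m0)" using \<open>Q = 0\<close> by simp
  also have "\<dots> = (\<Sum>m\<in>keys p. lookup p m * lookup (P m) (\<Lambda> m0))"
    by (simp add: Q_def lookup_sum lookup_scalar_mult)
  also have "\<dots> = (\<Sum>m\<in>keys p. if m = m0 then lookup p m0 else 0)"
    using other leading_lookup(1)[OF lead_P[of m0]] by (intro sum.cong) auto
  also have "\<dots> = lookup p m0" using m0 by simp
  finally show False using m0 by (simp add: in_keys_iff)
qed

end

section \<open>Initial ideals\<close>

lemma carrier_poly_ring: "carrier (poly_ring X) = polys X"
  by (simp add: poly_ring_def polys_def)

lemma cring_poly_ring: "cring (poly_ring X :: (('v \<Rightarrow>\<^sub>0 nat) \<Rightarrow>\<^sub>0 'k::comm_ring_1) ring)"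
proof (intro cringI abelian_groupI comm_monoidI)
  fix p :: "('v \<Rightarrow>\<^sub>0 nat) \<Rightarrow>\<^sub>0 'k" assume "p \<in> carrier (poly_ring X)"
  then show "\<exists>q\<in>carrier (poly_ring X). q \<oplus>\<^bsub>poly_ring X\<^esub> p = \<zero>\<^bsub>poly_ring X\<^esub>"
    using polys_uminus by (intro bexI[of _ "- p"]) (auto simp: carrier_poly_ring, simp add: poly_ring_def)
qed (simp_all add: carrier_poly_ring polys_add polys_mult polys_zero polys_one,
    simp_all add: poly_ring_def polys_zero polys_one polys_add polys_mult algebra_simps)

lemma ideal_poly_ringI:
  fixes I :: "(('v \<Rightarrow>\<^sub>0 nat) \<Rightarrow>\<^sub>0 'k::comm_ring_1) set"
  assumes "I \<subseteq> polys X" "0 \<in> I" "\<And>p q. p \<in> I \<Longrightarrow> q \<in> I \<Longrightarrow> p + q \<in> I"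
    and mult: "\<And>p q. p \<in> polys X \<Longrightarrow> q \<in> I \<Longrightarrow> p * q \<in> I"
  shows "ideal I (poly_ring X)"
proof -
  interpret cring "poly_ring X :: (('v \<Rightarrow>\<^sub>0 nat) \<Rightarrow>\<^sub>0 'k) ring" by (rule cring_poly_ring)
  show ?thesis
  proof (rule idealI)
    show "ring (poly_ring X :: (('v \<Rightarrow>\<^sub>0 nat) \<Rightarrow>\<^sub>0 'k) ring)" by (rule ring_axioms)
    show "subgroup I (add_monoid (poly_ring X))"
    proof (rule subgroup.intro)
      show "I \<subseteq> carrier (add_monoid (poly_ring X))" using assms(1) by (simp add: carrier_poly_ring)
      show "p \<otimes>\<^bsub>add_monoid (poly_ring X)\<^esub> q \<in> I" if "p \<in> I" "q \<in> I" for p q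
        using assms(3)[OF that] by (simp add: poly_ring_def)
      show "\<one>\<^bsub>add_monoid (poly_ring X)\<^esub> \<in> I" using assms(2) by (simp add: poly_ring_def)
      show "inv\<^bsub>add_monoid (poly_ring X)\<^esub> p \<in> I" if p: "p \<in> I" for p
      proof -
        have "(- p) \<oplus>\<^bsub>poly_ring X\<^esub> p = \<zero>\<^bsub>poly_ring X\<^esub>" by (simp add: poly_ring_def)
        then have "\<ominus>\<^bsub>poly_ring X\<^esub> p = - p"
          using p assms(1) polys_uminus by (intro minus_equality) (auto simp: carrier_poly_ring)
        moreover have "- p \<in> I" using mult[OF polys_uminus[OF polys_one] p] by simp
        ultimately show ?thesis by (simp add: a_inv_def)
      qed
    qed
    show "q \<otimes>\<^bsub>poly_ring X\<^esub> p \<in> I" if "p \<in> I" "q \<in> carrier (poly_ring X)" for p q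
      using mult[of q p] that by (simp add: carrier_poly_ring) (simp add: poly_ring_def)
    show "p \<otimes>\<^bsub>poly_ring X\<^esub> q \<in> I" if "p \<in> I" "q \<in> carrier (poly_ring X)" for p q
      using mult[of q p] that by (simp add: carrier_poly_ring) (simp add: poly_ring_def mult.commute)
  qed
qed

lemma ideal_poly_ringD:
  assumes "ideal I (poly_ring X)"
  shows "0 \<in> I" "p \<in> I \<Longrightarrow> q \<in> I \<Longrightarrow> p + q \<in> I" "p \<in> polys X \<Longrightarrow> q \<in> I \<Longrightarrow> p * q \<in> I"
proof -
  interpret ideal I "poly_ring X" by (rule assms)
  show "0 \<in> I" using additive_subgroup.zero_closed[OF is_additive_subgroup] by (simp add: poly_ring_def)
  show "p + q \<in> I" if "p \<in> I" "q \<in> I"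
    using additive_subgroup.a_closed[OF is_additive_subgroup that] by (simp add: poly_ring_def)
  show "p * q \<in> I" if "p \<in> polys X" "q \<in> I"
    using I_l_closed[of q p] that by (simp add: carrier_poly_ring) (simp add: poly_ring_def)
qed

section \<open>Monomial weights and initial forms\<close>

lemma monomial_weight_superset:
  assumes "finite A" "keys m \<subseteq> A"
  shows "monomial_weight \<omega> m = (\<Sum>v\<in>A. lookup \<omega> v * real (lookup m v))"
  unfolding monomial_weight_def using assms
  by (intro sum.mono_neutral_left) (auto simp: in_keys_iff)

lemma monomial_weight_add: "monomial_weight \<omega> (m + m') = monomial_weight \<omega> m + monomial_weight \<omega> m'"
proof -
  let ?A = "keys m \<union> keys m'"
  have "monomial_weight \<omega> (m + m') = (\<Sum>v\<in>?A. lookup \<omega> v * real (lookup (m + m') v))"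
    by (rule monomial_weight_superset) (auto simp: keys_add)
  then show ?thesis
    by (simp add: monomial_weight_superset[of ?A m] monomial_weight_superset[of ?A m'] lookup_add
        distrib_left sum.distrib)
qed

lemma monomial_weight_zero [simp]: "monomial_weight \<omega> 0 = 0"
  by (simp add: monomial_weight_def)

lemma monomial_weight_var: "monomial_weight \<omega> (var_monomial v) = lookup \<omega> v"
  by (simp add: monomial_weight_def)

lemma lookup_initial_form:
  "lookup (initial_form \<omega> f) m =
    (if \<forall>m'\<in>keys f. monomial_weight \<omega> m' \<le> monomial_weight \<omega> m
     then lookup f m else 0)"
proof -
  let ?S = "{m \<in> keys f. \<forall>m'\<in>keys f. monomial_weight \<omega> m' \<le> monomial_weight \<omega> m}"
  have "finite ?S" by simp
  then have "lookup (initial_form \<omega> f) m = (if m \<in> ?S then lookup f m else 0)"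
    by (simp add: initial_form_def lookup_sum lookup_single when_def)
  then show ?thesis by (auto simp: in_keys_iff)
qed

lemma keys_sum_list: "keys (sum_list (map h xs)) \<subseteq> (\<Union>a\<in>set xs. keys (h a))"
proof (induction xs)
  case (Cons a xs)
  then show ?case using keys_add[of "h a" "sum_list (map h xs)"] by auto
qed simp

lemma polys_sum_list: "(\<And>a. a \<in> set xs \<Longrightarrow> h a \<in> polys X) \<Longrightarrow> sum_list (map h xs) \<in> polys X"
  by (induction xs) (simp_all add: polys_zero polys_add)

lemma poly_eval_sum_list:
  assumes "field_embedding \<iota>"
  shows "poly_eval \<iota> g (sum_list (map h xs)) = (\<Sum>a\<leftarrow>xs. poly_eval \<iota> g (h a))"
  by (induction xs) (simp_all add: poly_eval_add[OF assms])

text \<open>Keeps \<open>var_monomial v\<close> in the form in which it is stated.\<close>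

declare One_nat_def [simp del]

context D_model
begin

abbreviation "X \<equiv> all_variables s0"

definition label_monomial :: "label list \<Rightarrow> 'f \<Rightarrow>\<^sub>0 nat" where
  "label_monomial K = (\<Sum>L\<leftarrow>K. var_monomial (x L))"

lemma monomial_value_add: "monomial_value (m + m') = monomial_value m * (monomial_value m' :: 'f)"
  by (simp add: monomial_value_eq_mono_eval mono_eval_add)

lemma monomial_value_label_monomial: "monomial_value (label_monomial K) = prod_list (map x K)"
  by (induction K)
    (simp_all add: label_monomial_def monomial_value_add monomial_value_var, simp add: monomial_value_eq_mono_eval)

lemma monomial_weight_label_monomial:
  "monomial_weight \<omega> (label_monomial K) = (\<Sum>L\<leftarrow>K. lookup \<omega> (x L))"
  by (induction K) (simp_all add: label_monomial_def monomial_weight_add monomial_weight_var)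

lemma keys_label_monomial:
  assumes "set K \<subseteq> labels n"
  shows "keys (label_monomial K) \<subseteq> X"
proof -
  have "keys (label_monomial K) \<subseteq> (\<Union>L\<in>set K. keys (var_monomial (x L)))"
    unfolding label_monomial_def by (rule keys_sum_list)
  then show ?thesis using assms unfolding all_variables_eq by auto
qed

text \<open>Divisibility by a generator of the incompatibility ideal, with the cofactor m'
  explicit.\<close>

definition bad :: "('f \<Rightarrow>\<^sub>0 nat) \<Rightarrow> bool" where
  "bad m \<longleftrightarrow> (\<exists>L M m'. crossing n L M \<and> m = var_monomial (x L) + var_monomial (x M) + m')"

lemma not_bad_crossing_free:
  assumes "\<not> bad m"
  shows "crossing_free n (\<lambda>L. lookup m (x L))"
  unfolding crossing_free_def
proof (intro ballI impI notI)
  fix L M assume *: "L \<in> labels n" "M \<in> labels n" "lookup m (x L) > 0"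
    "lookup m (x M) > 0" "crossing n L M"
  have "L \<noteq> M" using *(5) not_crossing_self[OF n2] by blast
  then have "x L \<noteq> x M" using inj_onD[OF inj_x] *(1,2) by blast
  \<comment> \<open>Truncated subtraction is exact here: the two variables are distinct and each has
    positive exponent in m.\<close>
  then have "m = var_monomial (x L) + var_monomial (x M) + (m - (var_monomial (x L) + var_monomial (x M)))"
    using *(3,4) by (intro poly_mapping_eqI) (auto simp: lookup_add lookup_minus lookup_single when_def)
  then show False using assms *(5) unfolding bad_def by blast
qed

text \<open>By degree. This keeps single variables out of the incompatibility ideal, which is what
  yields inequalities on the cone.\<close>

lemma not_bad_var: "\<not> bad (var_monomial v)"
proof
  assume "bad (var_monomial v)"
  then obtain L M m' where *: "var_monomial v = var_monomial (x L) + var_monomial (x M) + m'"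
    unfolding bad_def by blast
  have e: "lookup (var_monomial v) w = lookup (var_monomial (x L) + var_monomial (x M) + m') w" for w
    using * by simp
  have "v = x L" using e[of "x L"] by (auto simp: lookup_add lookup_single when_def split: if_splits)
  moreover have "v = x M" using e[of "x M"] by (auto simp: lookup_add lookup_single when_def split: if_splits)
  ultimately show False using e[of v] by (simp add: lookup_add lookup_single)
qed

lemma cluster_ideal_eq: "cluster_ideal \<iota> s0 = {p \<in> polys X. poly_value \<iota> p = 0}"
  by (simp add: cluster_ideal_def a_kernel_def' carrier_poly_ring cluster_algebra_def)

lemma bad_add: "bad m \<Longrightarrow> bad (m' + m)"
proof -
  assume "bad m"
  then obtain L M m'' where "crossing n L M" "m = var_monomial (x L) + var_monomial (x M) + m''"
    unfolding bad_def by blast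
  then have "crossing n L M" "m' + m = var_monomial (x L) + var_monomial (x M) + (m'' + m')"
    by (simp_all add: add_ac)
  then show "bad (m' + m)" unfolding bad_def by blast
qed

lemma incompatible_iff:
  assumes "v \<in> cluster_variables s0" "w \<in> cluster_variables s0"
  shows "\<not> (\<exists>C\<in>clusters s0. v \<in> C \<and> w \<in> C) \<longleftrightarrow>
    (\<exists>L M. crossing n L M \<and> (v = x L \<and> w = x M \<or> v = x M \<and> w = x L))"
proof -
  obtain L M where LM: "L \<in> cluster_labels n" "M \<in> cluster_labels n" "v = x L" "w = x M"
    using assms unfolding cluster_variables_eq by blast
  have inj: "inj_on x (cluster_labels n)" using inj_x by (rule inj_on_subset) simp
  have cl: "clusters s0 = (`) x ` triangulations n" using model by (simp add: polygon_model_def)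
  have mem: "x N \<in> x ` T \<longleftrightarrow> N \<in> T" if "T \<in> triangulations n" "N \<in> cluster_labels n" for T N
    using that by (intro inj_on_image_mem_iff[OF inj]) (auto simp: triangulations_def noncrossing_def)
  have "(\<exists>C\<in>clusters s0. v \<in> C \<and> w \<in> C) \<longleftrightarrow> (\<exists>T\<in>triangulations n. L \<in> T \<and> M \<in> T)"
    unfolding cl using LM mem by auto
  also have "\<dots> \<longleftrightarrow> \<not> crossing n L M \<and> \<not> crossing n M L"
    by (rule incompatible_iff_crossing[OF n2 LM(1,2)])
  finally have 1: "\<not> (\<exists>C\<in>clusters s0. v \<in> C \<and> w \<in> C) \<longleftrightarrow> crossing n L M \<or> crossing n M L" by blast
  have "L' = L \<and> M' = M" if "crossing n L' M'" "v = x L'" "w = x M'" for L' M'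
    using inj_onD[OF inj] LM that crossing_imp(1,2)[OF n2 that(1)] by metis
  moreover have "L' = M \<and> M' = L" if "crossing n L' M'" "v = x M'" "w = x L'" for L' M'
    using inj_onD[OF inj] LM that crossing_imp(1,2)[OF n2 that(1)] by metis
  ultimately show ?thesis unfolding 1 using LM(3,4) by blast
qed

lemma ideal_bad:
  "ideal {p \<in> polys X :: (('f \<Rightarrow>\<^sub>0 nat) \<Rightarrow>\<^sub>0 'k) set. \<forall>m\<in>keys p. bad m} (poly_ring X)"
proof (rule ideal_poly_ringI)
  fix p q :: "('f \<Rightarrow>\<^sub>0 nat) \<Rightarrow>\<^sub>0 'k"
  assume "p \<in> {p \<in> polys X. \<forall>m\<in>keys p. bad m}" "q \<in> {p \<in> polys X. \<forall>m\<in>keys p. bad m}"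
  then show "p + q \<in> {p \<in> polys X. \<forall>m\<in>keys p. bad m}"
    using keys_add[of p q] polys_add by blast
next
  fix p q :: "('f \<Rightarrow>\<^sub>0 nat) \<Rightarrow>\<^sub>0 'k"
  assume p: "p \<in> polys X" and q: "q \<in> {p \<in> polys X. \<forall>m\<in>keys p. bad m}"
  have "bad m" if "m \<in> keys (p * q)" for m
    using keys_mult[of p q] that q bad_add by blast
  then show "p * q \<in> {p \<in> polys X. \<forall>m\<in>keys p. bad m}"
    using p q polys_mult by blast
qed (auto simp: polys_zero)

text \<open>The ideal is generated by monomials, so membership can be tested term by term.\<close>

lemma incompatibility_ideal_eq:
  "incompatibility_ideal \<iota> s0 = {p \<in> polys X. \<forall>m\<in>keys p. bad m}" (is "_ = ?J")
proof -
  interpret cring "poly_ring X :: (('f \<Rightarrow>\<^sub>0 nat) \<Rightarrow>\<^sub>0 'k) ring" by (rule cring_poly_ring)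
  define S :: "(('f \<Rightarrow>\<^sub>0 nat) \<Rightarrow>\<^sub>0 'k) set" where "S = {var_poly v * var_poly w | v w.
         v \<in> cluster_variables s0 \<and> w \<in> cluster_variables s0 \<and>
         \<not> (\<exists>C\<in>clusters s0. v \<in> C \<and> w \<in> C)}"
  have SP: "S \<subseteq> carrier (poly_ring X)"
  proof
    fix p assume "p \<in> S"
    then obtain v w where "p = var_poly v * var_poly w" "v \<in> cluster_variables s0" "w \<in> cluster_variables s0"
      unfolding S_def by blast
    then show "p \<in> carrier (poly_ring X)"
      unfolding carrier_poly_ring by (simp only:) (intro polys_mult polys_single; simp)
  qed
  have eq: "incompatibility_ideal \<iota> s0 = genideal (poly_ring X) S"
    by (simp add: incompatibility_ideal_def S_def)
  have I: "ideal (genideal (poly_ring X) S) (poly_ring X)" by (rule genideal_ideal[OF SP])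
  have "S \<subseteq> ?J"
  proof
    fix p assume "p \<in> S"
    then obtain v w where vw: "p = var_poly v * var_poly w" "v \<in> cluster_variables s0" "w \<in> cluster_variables s0"
      "\<not> (\<exists>C\<in>clusters s0. v \<in> C \<and> w \<in> C)" unfolding S_def by blast
    obtain L M where LM: "crossing n L M" "v = x L \<and> w = x M \<or> v = x M \<and> w = x L"
      using iffD1[OF incompatible_iff[OF vw(2,3)] vw(4)] by (elim exE conjE) (rule that)
    then have "var_monomial v + var_monomial w = var_monomial (x L) + var_monomial (x M) + 0"
      by (auto simp: add.commute)
    then have "bad (var_monomial v + var_monomial w)"
      unfolding bad_def using LM(1) by blast
    moreover have "p = single (var_monomial v + var_monomial w) 1"
      by (simp add: vw(1) mult_single)
    moreover have "p \<in> polys X" using SP \<open>p \<in> S\<close> by (auto simp: carrier_poly_ring)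
    ultimately show "p \<in> ?J" by simp
  qed
  then have "genideal (poly_ring X) S \<subseteq> ?J" by (rule genideal_minimal[OF ideal_bad])
  moreover have "?J \<subseteq> genideal (poly_ring X) S"
  proof
    fix p assume p: "p \<in> ?J"
    have single_in: "single m c \<in> genideal (poly_ring X) S" if m: "m \<in> keys p" for m c
    proof -
      obtain L M m' where LM: "crossing n L M" "m = var_monomial (x L) + var_monomial (x M) + m'"
        using p m unfolding bad_def by blast
      have v: "x L \<in> cluster_variables s0" "x M \<in> cluster_variables s0"
        using crossing_imp(1,2)[OF n2 LM(1)] unfolding cluster_variables_eq by auto
      then have "\<not> (\<exists>C\<in>clusters s0. x L \<in> C \<and> x M \<in> C)" using iffD2[OF incompatible_iff[OF v]] LM(1) by blast
      then have "var_poly (x L) * var_poly (x M) \<in> S" using v unfolding S_def by blast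
      then have "var_poly (x L) * var_poly (x M) \<in> genideal (poly_ring X) S"
        using genideal_self[OF SP] by blast
      moreover have "keys m' \<subseteq> X"
      proof -
        have "keys m' \<subseteq> keys m" by (auto simp: LM(2) in_keys_iff lookup_add)
        then show ?thesis using p polysD[of p X m] m by blast
      qed
      ultimately have "single m' c * (var_poly (x L) * var_poly (x M)) \<in> genideal (poly_ring X) S"
        by (rule ideal_poly_ringD(3)[OF I polys_single, rotated])
      then show ?thesis by (simp add: mult_single LM(2) add_ac)
    qed
    have "(\<Sum>m\<in>A. single m (lookup p m)) \<in> genideal (poly_ring X) S"
      if "finite A" "A \<subseteq> keys p" for A
      using that
    proof (induction A rule: finite_induct)
      case empty
      show ?case using ideal_poly_ringD(1)[OF I] by simp
    next
      case (insert m A)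
      then show ?case using ideal_poly_ringD(2)[OF I single_in] by simp
    qed
    from this[of "keys p"] show "p \<in> genideal (poly_ring X) S"
      using poly_mapping_sum_single[of p] by simp
  qed
  ultimately show ?thesis unfolding eq by blast
qed

text \<open>The condition covers every admissible expansion \<open>Ks\<close>, so none has to be
  fixed. This costs nothing, since the weight drop and homogeneity are part of
  \<open>rewrites_to\<close>.\<close>

definition decreasing :: "('f \<Rightarrow>\<^sub>0 real) \<Rightarrow> bool" where
  "decreasing \<theta> \<longleftrightarrow> (\<forall>L M Ks. crossing n L M \<longrightarrow> rewrites_to L M Ks \<longrightarrow> (\<forall>K\<in>set Ks.
    (\<Sum>N\<leftarrow>K. lookup \<theta> (x N)) < lookup \<theta> (x L) + lookup \<theta> (x M)))"

definition total_wt :: "('f \<Rightarrow>\<^sub>0 nat) \<Rightarrow> nat" where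
  "total_wt m = (\<Sum>L\<in>labels n. wt n L * lookup m (x L))"

lemma total_wt_add: "total_wt (m + m') = total_wt m + total_wt m'"
  by (simp add: total_wt_def lookup_add distrib_left sum.distrib)

lemma total_wt_var:
  assumes "L \<in> labels n"
  shows "total_wt (var_monomial (x L)) = wt n L"
proof -
  have "total_wt (var_monomial (x L)) = (\<Sum>M\<in>labels n. if M = L then wt n L else 0)"
    unfolding total_wt_def
    by (rule sum.cong) (use inj_onD[OF inj_x] assms in \<open>auto simp: lookup_single when_def\<close>)
  then show ?thesis using assms finite_labels[OF n2] by simp
qed

lemma total_wt_label_monomial: "set K \<subseteq> labels n \<Longrightarrow> total_wt (label_monomial K) = (\<Sum>L\<leftarrow>K. wt n L)"
proof (induction K)
  case Nil
  show ?case by (simp add: label_monomial_def total_wt_def)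
next
  case (Cons L K)
  then show ?case
    using total_wt_add[of "var_monomial (x L)" "label_monomial K"] total_wt_var[of L]
    by (simp add: label_monomial_def)
qed

text \<open>A normal form of m modulo the relations, supported on crossing-free monomials. The
  strict drop for bad m and the exact form for the others allow a top-weight coefficient to be
  followed through the reduction.\<close>

definition straightens_to :: "('f \<Rightarrow>\<^sub>0 real) \<Rightarrow> ('f \<Rightarrow>\<^sub>0 nat) \<Rightarrow> (('f \<Rightarrow>\<^sub>0 nat) \<Rightarrow>\<^sub>0 'k) \<Rightarrow> bool" where
  "straightens_to \<theta> m p \<longleftrightarrow> p \<in> polys X \<and> poly_value \<iota> p = monomial_value m \<and>
    (\<forall>\<kappa>\<in>keys p. \<not> bad \<kappa> \<and> monomial_weight \<theta> \<kappa> \<le> monomial_weight \<theta> m \<and>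
      (bad m \<longrightarrow> monomial_weight \<theta> \<kappa> < monomial_weight \<theta> m)) \<and>
    (\<not> bad m \<longrightarrow> p = single m 1)"

text \<open>Induction on the natural number \<open>total_wt\<close>, which each rewriting of a
  crossing pair lowers; the strict drop of the real weight \<theta> is carried along.\<close>

lemma straighten:
  assumes \<theta>: "decreasing \<theta>" and m: "keys m \<subseteq> X"
  shows "\<exists>p. straightens_to \<theta> m p"
  using m
proof (induction "total_wt m" arbitrary: m rule: less_induct)
  case less
  show ?case
  proof (cases "bad m")
    case False
    then show ?thesis
      using \<iota> less.prems unfolding poly_value_eq_poly_eval monomial_value_eq_mono_eval
      by (intro exI[of _ "single m 1"])
        (auto simp: straightens_to_def poly_value_eq_poly_eval monomial_value_eq_mono_eval
          poly_eval_single[OF \<iota>] field_embedding_def intro: polys_single)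
  next
    case True
    then obtain L M m' where LM: "crossing n L M" and m_eq: "m = var_monomial (x L) + var_monomial (x M) + m'"
      unfolding bad_def by blast
    have lab: "L \<in> labels n" "M \<in> labels n" using crossing_imp(1,2)[OF n2 LM] by auto
    obtain Ks where Ks: "rewrites_to L M Ks" using crossing_rewrites[OF LM] by blast
    have "keys m' \<subseteq> keys m" by (auto simp: m_eq in_keys_iff lookup_add)
    then have m': "keys m' \<subseteq> X" using less.prems by blast
    have "\<exists>p\<in>polys X. poly_value \<iota> p = monomial_value (label_monomial K + m') \<and>
        (\<forall>\<kappa>\<in>keys p. \<not> bad \<kappa> \<and> monomial_weight \<theta> \<kappa> < monomial_weight \<theta> m)"
      if K: "K \<in> set Ks" for K
    proof -
      have sK: "set K \<subseteq> labels n" and wK: "(\<Sum>N\<leftarrow>K. wt n N) < wt n L + wt n M"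
        using Ks K unfolding rewrites_to_def by auto
      have "total_wt (label_monomial K + m') < total_wt m"
        using wK unfolding m_eq total_wt_add total_wt_label_monomial[OF sK]
        by (simp add: total_wt_var[OF lab(1)] total_wt_var[OF lab(2)])
      moreover have "keys (label_monomial K + m') \<subseteq> X"
        using keys_add[of "label_monomial K" m'] keys_label_monomial[OF sK] m' by blast
      ultimately obtain p where p: "p \<in> polys X" "poly_value \<iota> p = monomial_value (label_monomial K + m')"
        "\<forall>\<kappa>\<in>keys p. \<not> bad \<kappa> \<and> monomial_weight \<theta> \<kappa> \<le> monomial_weight \<theta> (label_monomial K + m')"
        using less.hyps[of "label_monomial K + m'"] unfolding straightens_to_def by blast
      have "monomial_weight \<theta> (label_monomial K + m') < monomial_weight \<theta> m"
        using \<theta> LM Ks K unfolding decreasing_def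
        by (simp add: m_eq monomial_weight_add monomial_weight_var monomial_weight_label_monomial)
      then show ?thesis using p by (intro bexI[of _ p]) fastforce+
    qed
    then obtain P where P: "\<And>K. K \<in> set Ks \<Longrightarrow> P K \<in> polys X"
      "\<And>K. K \<in> set Ks \<Longrightarrow> poly_value \<iota> (P K) = monomial_value (label_monomial K + m')"
      "\<And>K \<kappa>. K \<in> set Ks \<Longrightarrow> \<kappa> \<in> keys (P K) \<Longrightarrow> \<not> bad \<kappa> \<and> monomial_weight \<theta> \<kappa> < monomial_weight \<theta> m"
      by metis
    define p where "p = (\<Sum>K\<leftarrow>Ks. P K)"
    have "poly_value \<iota> p = (\<Sum>K\<leftarrow>Ks. poly_value \<iota> (P K))"
      unfolding p_def poly_value_eq_poly_eval by (rule poly_eval_sum_list[OF \<iota>])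
    also have "\<dots> = (\<Sum>K\<leftarrow>Ks. prod_list (map x K) * monomial_value m')"
      by (rule arg_cong[of _ _ sum_list], rule map_cong)
        (simp_all add: P(2) monomial_value_add monomial_value_label_monomial)
    also have "\<dots> = (\<Sum>K\<leftarrow>Ks. prod_list (map x K)) * monomial_value m'"
      by (simp add: sum_list_mult_const)
    also have "\<dots> = monomial_value m"
      using Ks by (simp add: rewrites_to_def m_eq monomial_value_add monomial_value_var)
    finally have "poly_value \<iota> p = monomial_value m" .
    moreover have "p \<in> polys X" unfolding p_def using P(1) by (intro polys_sum_list)
    moreover have "\<not> bad \<kappa> \<and> monomial_weight \<theta> \<kappa> < monomial_weight \<theta> m" if \<kappa>: "\<kappa> \<in> keys p" for \<kappa>
    proof -
      obtain K where "K \<in> set Ks" "\<kappa> \<in> keys (P K)"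
        using \<kappa> keys_sum_list[of P Ks] unfolding p_def by blast
      then show ?thesis using P(3) by blast
    qed
    ultimately show ?thesis
      using True by (intro exI[of _ p]) (auto simp: straightens_to_def less_imp_le)
  qed
qed

text \<open>Straightening all terms of f gives a combination of crossing-free monomials with value
  0, hence 0. A crossing-free term m0 of top weight would keep its coefficient: bad terms straighten
  to weights strictly below their own, and other crossing-free terms stay as they are.\<close>

lemma initial_form_bad:
  assumes \<theta>: "decreasing \<theta>" and f: "f \<in> polys X" "poly_value \<iota> f = 0"
    and m0: "m0 \<in> keys (initial_form \<theta> f)"
  shows "bad m0"
proof (rule ccontr)
  assume nb: "\<not> bad m0"
  have m0f: "m0 \<in> keys f"
    and max: "\<And>m. m \<in> keys f \<Longrightarrow> monomial_weight \<theta> m \<le> monomial_weight \<theta> m0"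
    using m0 by (auto simp: in_keys_iff lookup_initial_form split: if_splits)
  have "\<forall>m\<in>keys f. \<exists>p. straightens_to \<theta> m p"
    using straighten[OF \<theta>] polysD[OF f(1)] by blast
  then obtain P where "\<forall>m\<in>keys f. straightens_to \<theta> m (P m)"
    by (rule bchoice[THEN exE])
  then have P: "\<And>m. m \<in> keys f \<Longrightarrow> P m \<in> polys X"
    "\<And>m. m \<in> keys f \<Longrightarrow> poly_value \<iota> (P m) = monomial_value m"
    "\<And>m \<kappa>. m \<in> keys f \<Longrightarrow> \<kappa> \<in> keys (P m) \<Longrightarrow>
      \<not> bad \<kappa> \<and> (bad m \<longrightarrow> monomial_weight \<theta> \<kappa> < monomial_weight \<theta> m)"
    "\<And>m. m \<in> keys f \<Longrightarrow> \<not> bad m \<Longrightarrow> P m = single m 1"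
    unfolding straightens_to_def by blast+
  define g where "g = (\<Sum>m\<in>keys f. single 0 (lookup f m) * P m)"
  have "g \<in> polys X"
    unfolding g_def by (intro polys_sum polys_mult polys_single P(1)) auto
  moreover have "poly_value \<iota> g = 0"
  proof -
    have "poly_value \<iota> g = (\<Sum>m\<in>keys f. \<iota> (lookup f m) * poly_value \<iota> (P m))"
      unfolding g_def poly_value_eq_poly_eval
      by (simp add: poly_eval_sum[OF \<iota>] poly_eval_mult[OF \<iota>] poly_eval_single[OF \<iota>])
    also have "\<dots> = poly_value \<iota> f"
      unfolding poly_value_def[of _ f] by (rule sum.cong) (simp_all add: P(2))
    finally show ?thesis using f(2) by simp
  qed
  moreover have "crossing_free n (\<lambda>L. lookup \<kappa> (x L))" if \<kappa>: "\<kappa> \<in> keys g" for \<kappa>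
  proof -
    obtain m where m: "m \<in> keys f"
      "\<kappa> \<in> keys (single 0 (lookup f m) * P m)"
      using \<kappa> keys_sum[of "\<lambda>m. single 0 (lookup f m) * P m" "keys f"]
      unfolding g_def by blast
    then have "\<kappa> \<in> keys (P m)" by (auto simp: in_keys_iff lookup_scalar_mult)
    then show ?thesis using P(3)[OF m(1)] not_bad_crossing_free by blast
  qed
  ultimately have "g = 0" by (rule crossing_free_monomials_independent)
  have other: "lookup (P m) m0 = 0" if m: "m \<in> keys f" "m \<noteq> m0" for m
  proof (cases "bad m")
    case True
    then have "m0 \<notin> keys (P m)" using P(3)[OF m(1), of m0] max[OF m(1)] by force
    then show ?thesis by (simp add: in_keys_iff)
  next
    case False
    then show ?thesis using P(4)[OF m(1)] m(2) by (simp add: lookup_single)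
  qed
  have "0 = lookup g m0" using \<open>g = 0\<close> by simp
  also have "\<dots> = (\<Sum>m\<in>keys f. lookup f m * lookup (P m) m0)"
    by (simp add: g_def lookup_sum lookup_scalar_mult)
  also have "\<dots> = (\<Sum>m\<in>keys f. if m = m0 then lookup f m0 else 0)"
    using other P(4)[OF m0f nb] by (intro sum.cong) auto
  also have "\<dots> = lookup f m0" using m0f by simp
  finally show False using m0f by (simp add: in_keys_iff)
qed

lemma initial_form_in_polys: "f \<in> polys X \<Longrightarrow> initial_form \<theta> f \<in> polys X"
  unfolding polys_def by (auto simp: in_keys_iff lookup_initial_form split: if_splits)

lemma poly_value_label_relation:
  "poly_value \<iota> (single (var_monomial (x L) + var_monomial (x M)) 1
      - (\<Sum>K\<leftarrow>Ks. single (label_monomial K) 1)) = x L * x M - (\<Sum>K\<leftarrow>Ks. prod_list (map x K))"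
proof -
  have one: "\<iota> 1 = 1" using \<iota> by (simp add: field_embedding_def)
  show ?thesis
    unfolding poly_value_eq_poly_eval poly_eval_diff[OF \<iota>] poly_eval_sum_list[OF \<iota>] poly_eval_single[OF \<iota>] one
    by (simp add: monomial_value_eq_mono_eval[symmetric] monomial_value_add monomial_value_var
        monomial_value_label_monomial)
qed

text \<open>One inclusion holds because initial forms of ideal members have only bad terms. For the
  other, every crossing product is the initial form of its straightening relation, whose remaining
  terms are strictly lighter.\<close>

lemma initial_ideal_eq:
  assumes \<theta>: "decreasing \<theta>"
  shows "initial_ideal X \<theta> (cluster_ideal \<iota> s0) = incompatibility_ideal \<iota> s0"
proof
  interpret cring "poly_ring X :: (('f \<Rightarrow>\<^sub>0 nat) \<Rightarrow>\<^sub>0 'k) ring" by (rule cring_poly_ring)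
  let ?I = "cluster_ideal \<iota> s0"
  have sub: "initial_form \<theta> ` ?I \<subseteq> carrier (poly_ring X)"
    unfolding carrier_poly_ring cluster_ideal_eq using initial_form_in_polys by blast
  show "initial_ideal X \<theta> ?I \<subseteq> incompatibility_ideal \<iota> s0"
    unfolding initial_ideal_def incompatibility_ideal_eq
  proof (rule genideal_minimal[OF ideal_bad])
    show "initial_form \<theta> ` ?I \<subseteq> {p \<in> polys X. \<forall>m\<in>keys p. bad m}"
      using initial_form_bad[OF \<theta>] initial_form_in_polys unfolding cluster_ideal_eq by blast
  qed
  show "incompatibility_ideal \<iota> s0 \<subseteq> initial_ideal X \<theta> ?I"
    unfolding incompatibility_ideal_def initial_ideal_def
  proof (rule genideal_minimal[OF genideal_ideal[OF sub]], safe)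
    fix v w assume vw: "v \<in> cluster_variables s0" "w \<in> cluster_variables s0"
      "\<not> (\<exists>C\<in>clusters s0. v \<in> C \<and> w \<in> C)"
    obtain L M where LM: "crossing n L M" "v = x L \<and> w = x M \<or> v = x M \<and> w = x L"
      using iffD1[OF incompatible_iff[OF vw(1,2)] vw(3)] by (elim exE conjE) (rule that)
    obtain Ks where Ks: "rewrites_to L M Ks" using crossing_rewrites[OF LM(1)] by blast
    let ?m = "var_monomial (x L) + var_monomial (x M)"
    define f :: "('f \<Rightarrow>\<^sub>0 nat) \<Rightarrow>\<^sub>0 'k" where
      "f = single ?m 1 - (\<Sum>K\<leftarrow>Ks. single (label_monomial K) 1)"
    have lab: "L \<in> labels n" "M \<in> labels n" using crossing_imp(1,2)[OF n2 LM(1)] by auto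
    have less: "monomial_weight \<theta> (label_monomial K) < monomial_weight \<theta> ?m" if "K \<in> set Ks" for K
      using \<theta> LM Ks that unfolding decreasing_def
      by (simp add: monomial_weight_add monomial_weight_var monomial_weight_label_monomial)
    have "single ?m 1 \<in> polys X"
    proof (rule polys_single)
      have "keys ?m \<subseteq> {x L, x M}"
        using keys_add[of "var_monomial (x L)" "var_monomial (x M)"] by auto
      then show "keys ?m \<subseteq> X" using lab unfolding all_variables_eq by auto
    qed
    moreover have "(\<Sum>K\<leftarrow>Ks. single (label_monomial K) (1::'k)) \<in> polys X"
      using Ks by (intro polys_sum_list polys_single keys_label_monomial) (auto simp: rewrites_to_def)
    ultimately have "f \<in> polys X"
      unfolding f_def using polys_add polys_uminus by (metis (no_types, lifting) add_uminus_conv_diff)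
    moreover have "poly_value \<iota> f = 0"
      using Ks unfolding f_def poly_value_label_relation by (simp add: rewrites_to_def)
    ultimately have "f \<in> ?I" unfolding cluster_ideal_eq by simp
    have low: "\<kappa> = ?m \<or> monomial_weight \<theta> \<kappa> < monomial_weight \<theta> ?m" if "\<kappa> \<in> keys f" for \<kappa>
    proof (cases "\<kappa> = ?m")
      case False
      then have "\<kappa> \<in> keys (\<Sum>K\<leftarrow>Ks. single (label_monomial K) (1::'k))"
        using that by (auto simp: f_def in_keys_iff lookup_minus lookup_single when_def split: if_splits)
      then obtain K where "K \<in> set Ks" "\<kappa> = label_monomial K"
        using keys_sum_list[of "\<lambda>K. single (label_monomial K) (1::'k)" Ks] by auto
      then show ?thesis using less by blast
    qed simp
    \<comment> \<open>No term of the expansion cancels the crossing product, as all of them have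
      strictly smaller weight.\<close>
    have fm: "lookup f ?m = 1"
    proof -
      have "?m \<notin> keys (\<Sum>K\<leftarrow>Ks. single (label_monomial K) (1::'k))"
        using keys_sum_list[of "\<lambda>K. single (label_monomial K) (1::'k)" Ks] less by force
      then show ?thesis by (simp add: f_def lookup_minus in_keys_iff)
    qed
    have "initial_form \<theta> f = single ?m 1"
    proof (rule poly_mapping_eqI)
      fix \<kappa>
      show "lookup (initial_form \<theta> f) \<kappa> = lookup (single ?m 1) \<kappa>"
      proof (cases "\<kappa> = ?m")
        case True
        then show ?thesis using low fm by (force simp: lookup_initial_form)
      next
        case False
        have fmk: "?m \<in> keys f" using fm by (simp add: in_keys_iff)
        have "lookup (initial_form \<theta> f) \<kappa> = 0"
        proof (rule ccontr)
          assume "lookup (initial_form \<theta> f) \<kappa> \<noteq> 0"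
          then have "\<kappa> \<in> keys f" "monomial_weight \<theta> ?m \<le> monomial_weight \<theta> \<kappa>"
            using fmk by (auto simp: lookup_initial_form in_keys_iff split: if_splits)
          then show False using low[of \<kappa>] False by simp
        qed
        then show ?thesis using False by (simp add: lookup_single)
      qed
    qed
    moreover have "var_poly v * var_poly w = single ?m (1::'k)"
      using LM(2) by (auto simp: mult_single add.commute)
    ultimately show "var_poly v * var_poly w \<in> genideal (poly_ring X) (initial_form \<theta> ` ?I)"
      using genideal_self[OF sub] \<open>f \<in> ?I\<close> by (metis image_eqI subsetD)
  qed
qed

end

section \<open>The lineality space\<close>

lemma lookup_scaleR: "lookup (r *\<^sub>R f) v = r * (lookup f v :: real)"
proof -
  have "finite {i. r *\<^sub>R lookup f i \<noteq> 0}"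
    by (rule finite_subset[OF _ finite_keys[of f]]) (auto simp: in_keys_iff)
  then show ?thesis by (simp add: scaleR_poly_mapping_def)
qed

text \<open>A coordinate is bounded by the norm, a sum of absolute values over the support.
  Continuity of coordinates lets conditions on them pass to the closure.\<close>

lemma bounded_linear_lookup: "bounded_linear (\<lambda>f. lookup f v :: real)"
proof (rule bounded_linear_intro[of _ 1])
  fix f :: "'a \<Rightarrow>\<^sub>0 real"
  show "norm (lookup f v) \<le> norm f * 1"
  proof (cases "v \<in> keys f")
    case True
    then have "norm (lookup f v) \<le> (\<Sum>w\<in>keys f. norm (lookup f w))"
      by (intro member_le_sum) auto
    then show ?thesis by (simp add: norm_poly_mapping_def dist_poly_mapping_def)
  qed (simp add: in_keys_iff)
qed (simp_all add: lookup_add lookup_scaleR)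

lemma continuous_on_lookup: "continuous_on S (\<lambda>f. lookup f v :: real)"
  by (rule bounded_linear.continuous_on[OF bounded_linear_lookup continuous_on_id])

lemma keys_scaleR: "keys (r *\<^sub>R f) \<subseteq> keys (f :: _ \<Rightarrow>\<^sub>0 real)"
  by (auto simp: in_keys_iff lookup_scaleR)

section \<open>Coordinates and independence of the vectors in K(D_n)\<close>

context D_model
begin

abbreviation "E \<equiv> vertex_vec n x"
abbreviation "U \<equiv> diam_vec n x"

lemma lookup_basis_vec:
  "L \<in> labels n \<Longrightarrow> M \<in> labels n \<Longrightarrow> lookup (basis_vec x L) (x M) = (if L = M then 1 else 0)"
  using inj_onD[OF inj_x] by (auto simp: basis_vec_def lookup_single when_def)

lemma keys_basis_vec: "L \<in> labels n \<Longrightarrow> keys (basis_vec x L) \<subseteq> X"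
  unfolding all_variables_eq basis_vec_def by auto

lemma vertex_vec_eq:
  assumes "i \<in> {1..n}"
  shows "E i = basis_vec x (bl n i) + basis_vec x (rd n i) +
    (\<Sum>Y | Orbit Y \<in> labels n \<and> i \<in> \<Union> Y. basis_vec x (Orbit Y))"
proof -
  have "seg n i (antipode n i) = bl n i" "red n i = rd n i"
    using assms by (auto simp: seg_def red_def bl_def rd_def antipode_def pt_id)
  moreover have "Orbit Y \<in> diagonal_pair_labels n \<union> edge_labels n \<longleftrightarrow> Orbit Y \<in> labels n" for Y
    by (auto simp: cluster_labels_def)
  ultimately show ?thesis by (simp add: vertex_vec_def)
qed

lemma finite_orbits: "finite {Y. Orbit Y \<in> labels n \<and> P Y}"
proof (rule finite_subset)
  show "{Y. Orbit Y \<in> labels n \<and> P Y} \<subseteq> (\<lambda>L. case L of Orbit Y \<Rightarrow> Y | _ \<Rightarrow> {}) ` labels n"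
    by (force simp: image_iff)
qed (use finite_labels[OF n2] in simp)

lemma lookup_vertex_vec:
  assumes i: "i \<in> {1..n}" and M: "M \<in> labels n"
  shows "lookup (E i) (x M) = cnt i M"
proof -
  have lab: "bl n i \<in> labels n" "rd n i \<in> labels n" using i bl_in_labels rd_in_labels by auto
  have "lookup (\<Sum>Y | Orbit Y \<in> labels n \<and> i \<in> \<Union> Y. basis_vec x (Orbit Y)) (x M)
      = (\<Sum>Y | Orbit Y \<in> labels n \<and> i \<in> \<Union> Y. if Orbit Y = M then 1 else 0)"
    unfolding lookup_sum by (rule sum.cong) (use M lookup_basis_vec in auto)
  also have "\<dots> = (case M of Orbit Y \<Rightarrow> cnt i M | _ \<Rightarrow> 0)"
  proof (cases M)
    case (Orbit Y)
    have "(\<Sum>Z | Orbit Z \<in> labels n \<and> i \<in> \<Union> Z. if Orbit Z = M then 1 else (0::real))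
        = (\<Sum>Z | Orbit Z \<in> labels n \<and> i \<in> \<Union> Z. if Z = Y then 1 else 0)"
      using Orbit by simp
    also have "\<dots> = (if i \<in> \<Union> Y then 1 else 0)"
      using finite_orbits[of "\<lambda>Z. i \<in> \<Union> Z"] M Orbit by simp
    finally show ?thesis using Orbit by simp
  qed simp_all
  finally have O: "lookup (\<Sum>Y | Orbit Y \<in> labels n \<and> i \<in> \<Union> Y. basis_vec x (Orbit Y)) (x M)
      = (case M of Orbit Y \<Rightarrow> cnt i M | _ \<Rightarrow> 0)" .
  have e: "lookup (E i) (x M)
      = (if bl n i = M then 1 else 0) + (if rd n i = M then 1 else 0) + (case M of Orbit Y \<Rightarrow> cnt i M | _ \<Rightarrow> 0)"
    unfolding vertex_vec_eq[OF i] lookup_add O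
    by (simp add: lookup_basis_vec[OF lab(1) M] lookup_basis_vec[OF lab(2) M])
  have ind: "ind n i a = (if i = a then 1 else 0)" if "1 \<le> a" "a \<le> n" for a
    using that i by (auto simp: ind_def pt_id)
  from n2 M show ?thesis
  proof (cases rule: labels_cases)
    case (blue a)
    have "bl n i = bl n a \<longleftrightarrow> i = a" using bl_inject[of i n a] i blue by auto
    then show ?thesis
      using e blue label_neqs ind[of a] by (simp add: cnt_bl_rd) (simp add: bl_def)
  next
    case (red a)
    have "rd n i = rd n a \<longleftrightarrow> i = a" using bl_inject[of i n a] i red by auto
    then show ?thesis
      using e red label_neqs ind[of a] by (simp add: cnt_bl_rd) (simp add: rd_def)
  next
    case (arc a b)
    then show ?thesis using e label_neqs by (simp add: arc_def orbit_def)
  qed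
qed

lemma keys_vertex_vec: "i \<in> {1..n} \<Longrightarrow> keys (E i) \<subseteq> X"
proof -
  assume i: "i \<in> {1..n}"
  have lab: "bl n i \<in> labels n" "rd n i \<in> labels n" using i bl_in_labels rd_in_labels by auto
  show ?thesis
    unfolding vertex_vec_eq[OF i]
  proof (intro order_trans[OF keys_add] Un_least)
    show "keys (\<Sum>Y | Orbit Y \<in> labels n \<and> i \<in> \<Union> Y. basis_vec x (Orbit Y)) \<subseteq> X"
      by (rule order_trans[OF keys_sum]) (use keys_basis_vec in blast)
  qed (use keys_basis_vec lab in blast)+
qed

lemma diameters_labels: "l \<in> diameters n \<Longrightarrow> Blue l \<in> labels n" "l \<in> diameters n \<Longrightarrow> Red l \<in> labels n"
  by (auto simp: cluster_labels_def)

lemma lookup_diam_vec: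
  assumes M: "M \<in> labels n"
  shows "lookup U (x M) = sgn_label M"
proof -
  have fin: "finite (diameters n)" by (simp add: diameters_eq[OF n1])
  have b: "lookup (\<Sum>l\<in>diameters n. basis_vec x (Blue l)) (x M)
      = (\<Sum>l\<in>diameters n. if Blue l = M then 1 else 0)"
    unfolding lookup_sum by (rule sum.cong) (simp_all only: lookup_basis_vec[OF diameters_labels(1) M])
  have r: "lookup (\<Sum>l\<in>diameters n. basis_vec x (Red l)) (x M)
      = (\<Sum>l\<in>diameters n. if Red l = M then 1 else 0)"
    unfolding lookup_sum by (rule sum.cong) (simp_all only: lookup_basis_vec[OF diameters_labels(2) M])
  show ?thesis
    unfolding diam_vec_def lookup_minus b r
  proof (cases M)
    case (Blue d)
    then have "d \<in> diameters n"
      using M by (auto simp: cluster_labels_def diagonal_pair_labels_def edge_labels_def orbit_def)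
    then show "(\<Sum>l\<in>diameters n. if Blue l = M then 1 else 0) - (\<Sum>l\<in>diameters n. if Red l = M then 1 else 0)
        = sgn_label M"
      using Blue fin by simp
  next
    case (Red d)
    then have "d \<in> diameters n"
      using M by (auto simp: cluster_labels_def diagonal_pair_labels_def edge_labels_def orbit_def)
    then show "(\<Sum>l\<in>diameters n. if Blue l = M then 1 else 0) - (\<Sum>l\<in>diameters n. if Red l = M then 1 else 0)
        = sgn_label M"
      using Red fin by simp
  qed simp
qed

lemma keys_diam_vec: "keys U \<subseteq> X"
  unfolding diam_vec_def
proof (intro order_trans[OF keys_diff] Un_least)
  show "keys (\<Sum>l\<in>diameters n. basis_vec x (Blue l)) \<subseteq> X"
    by (rule order_trans[OF keys_sum]) (use keys_basis_vec diameters_labels in blast)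
  show "keys (\<Sum>l\<in>diameters n. basis_vec x (Red l)) \<subseteq> X"
    by (rule order_trans[OF keys_sum]) (use keys_basis_vec diameters_labels in blast)
qed

lemma K_D_integer: "K_D n x \<subseteq> integer_vectors X"
proof
  fix v assume "v \<in> K_D n x"
  then consider i where "i \<in> {1..n}" "v = E i" | "v = U" by (auto simp: K_D_def)
  then show "v \<in> integer_vectors X"
  proof cases
    case (1 i)
    have "lookup v w \<in> \<int>" for w
    proof (cases "w \<in> X")
      case True
      then obtain M where M: "M \<in> labels n" "w = x M" unfolding all_variables_eq by blast
      have "cnt i M \<in> \<int>" by (cases M) auto
      then show ?thesis using 1 M lookup_vertex_vec by simp
    next
      case False
      then have "w \<notin> keys v" using 1 keys_vertex_vec by blast
      then show ?thesis by (simp add: in_keys_iff)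
    qed
    then show ?thesis using 1 keys_vertex_vec by (simp add: integer_vectors_def)
  next
    case 2
    have "lookup v w \<in> \<int>" for w
    proof (cases "w \<in> X")
      case True
      then obtain M where M: "M \<in> labels n" "w = x M" unfolding all_variables_eq by blast
      have "sgn_label M \<in> \<int>" by (cases M) auto
      then show ?thesis using 2 M lookup_diam_vec by simp
    next
      case False
      then have "w \<notin> keys v" using 2 keys_diam_vec by blast
      then show ?thesis by (simp add: in_keys_iff)
    qed
    then show ?thesis using 2 keys_diam_vec by (simp add: integer_vectors_def)
  qed
qed

lemma sum_cnt:
  assumes "1 \<le> a" "a \<le> n"
  shows "(\<Sum>i\<in>{1..n}. c i * ind n i a) = c a"
proof -
  have "(\<Sum>i\<in>{1..n}. c i * ind n i a) = (\<Sum>i\<in>{1..n}. if i = a then c i else 0)"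
    by (rule sum.cong) (use assms in \<open>auto simp: ind_def pt_id\<close>)
  then show ?thesis using assms by simp
qed

lemma lookup_combination:
  assumes "M \<in> labels n"
  shows "lookup ((\<Sum>i\<in>{1..n}. c i *\<^sub>R E i) + d *\<^sub>R U) (x M)
    = (\<Sum>i\<in>{1..n}. c i * cnt i M) + d * sgn_label M"
proof -
  have "(\<Sum>i\<in>{1..n}. c i * lookup (E i) (x M)) = (\<Sum>i\<in>{1..n}. c i * cnt i M)"
    by (rule sum.cong) (simp_all only: lookup_vertex_vec[OF _ assms])
  then show ?thesis by (simp add: lookup_add lookup_sum lookup_scaleR lookup_diam_vec[OF assms])
qed

lemma E_U_distinct: "inj_on E {1..n}" "U \<notin> E ` {1..n}"
proof -
  show "inj_on E {1..n}"
  proof (rule inj_onI)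
    fix i j assume ij: "i \<in> {1..n}" "j \<in> {1..n}" "E i = E j"
    have "cnt i (bl n i) = cnt j (bl n i)"
      using lookup_vertex_vec[OF ij(1) bl_in_labels] lookup_vertex_vec[OF ij(2) bl_in_labels] ij by simp
    then show "i = j" using ij by (auto simp: cnt_bl_rd ind_def pt_id split: if_splits)
  qed
  show "U \<notin> E ` {1..n}"
  proof
    assume "U \<in> E ` {1..n}"
    then obtain i where i: "i \<in> {1..n}" "U = E i" by blast
    have "cnt i (rd n i) = sgn_label (rd n i)"
      using lookup_vertex_vec[OF i(1) rd_in_labels] lookup_diam_vec[OF rd_in_labels] i by simp
    then show False by (simp add: cnt_bl_rd sgn_label_simps ind_def split: if_splits)
  qed
qed

text \<open>The coordinates at the blue and the red diameter of a vertex a read u(E_a) + u(U) = 0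
  and u(E_a) - u(U) = 0.\<close>

lemma independent_K_D: "independent (K_D n x)"
proof
  have fin: "finite (K_D n x)" by (simp add: K_D_def)
  assume "dependent (K_D n x)"
  then obtain u where u: "\<exists>v\<in>K_D n x. u v \<noteq> 0" "(\<Sum>v\<in>K_D n x. u v *\<^sub>R v) = 0"
    using dependent_finite[OF fin] by blast
  have "(\<Sum>v\<in>K_D n x. u v *\<^sub>R v) = (\<Sum>v\<in>E ` {1..n}. u v *\<^sub>R v) + u U *\<^sub>R U"
    unfolding K_D_def using E_U_distinct(2) by (simp add: add.commute)
  also have "(\<Sum>v\<in>E ` {1..n}. u v *\<^sub>R v) = (\<Sum>i\<in>{1..n}. u (E i) *\<^sub>R E i)"
    by (simp add: sum.reindex[OF E_U_distinct(1)])
  finally have z: "(\<Sum>i\<in>{1..n}. u (E i) *\<^sub>R E i) + u U *\<^sub>R U = 0" using u(2) by simp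
  have Z: "(\<Sum>i\<in>{1..n}. u (E i) * cnt i M) + u U * sgn_label M = 0" if "M \<in> labels n" for M
    using lookup_combination[OF that, of "\<lambda>i. u (E i)" "u U"] z by simp
  have e: "u (E a) + u U = 0" "u (E a) - u U = 0" if "a \<in> {1..n}" for a
    using that Z[OF bl_in_labels[of a]] Z[OF rd_in_labels[of a]] sum_cnt[of a "\<lambda>i. u (E i)"]
    by (simp_all add: cnt_bl_rd sgn_label_simps)
  have "u U = 0" using e[of 1] n1 by simp
  moreover have "u (E a) = 0" if "a \<in> {1..n}" for a using e[OF that] by simp
  ultimately show False using u(1) unfolding K_D_def by blast
qed

text \<open>Weights for which both sides of every rewriting relation are homogeneous of the same
  degree. The condition is linear, so it passes from K(D_n) to its span.\<close>

definition balanced :: "('f \<Rightarrow>\<^sub>0 real) \<Rightarrow> bool" where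
  "balanced v \<longleftrightarrow> keys v \<subseteq> X \<and> (\<forall>L M Ks. crossing n L M \<longrightarrow> rewrites_to L M Ks \<longrightarrow>
    (\<forall>K\<in>set Ks. (\<Sum>N\<leftarrow>K. lookup v (x N)) = lookup v (x L) + lookup v (x M)))"

lemma sum_list_lookup_cong:
  assumes "set K \<subseteq> labels n" "\<And>M. M \<in> labels n \<Longrightarrow> lookup v (x M) = h M"
  shows "(\<Sum>N\<leftarrow>K. lookup v (x N)) = sum_list (map h K)"
  using assms by (intro arg_cong[of _ _ sum_list] map_cong) auto

lemma balanced_K_D:
  assumes "v \<in> K_D n x"
  shows "balanced v"
  unfolding balanced_def
proof (intro conjI allI impI ballI)
  show "keys v \<subseteq> X"
    using assms K_D_integer by (auto simp: integer_vectors_def)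
  fix L M Ks K assume *: "crossing n L M" "rewrites_to L M Ks" "K \<in> set Ks"
  have K: "set K \<subseteq> labels n" using * unfolding rewrites_to_def by blast
  have lab: "L \<in> labels n" "M \<in> labels n" using crossing_imp(1,2)[OF n2 *(1)] by auto
  from assms consider i where "i \<in> {1..n}" "v = E i" | "v = U" by (auto simp: K_D_def)
  then show "(\<Sum>N\<leftarrow>K. lookup v (x N)) = lookup v (x L) + lookup v (x M)"
  proof cases
    case (1 i)
    have "(\<Sum>N\<leftarrow>K. lookup v (x N)) = sum_list (map (cnt i) K)"
      by (rule sum_list_lookup_cong[OF K]) (simp only: 1 lookup_vertex_vec)
    then show ?thesis
      using * 1 by (simp only: rewrites_to_def lookup_vertex_vec[OF 1(1) lab(1)] lookup_vertex_vec[OF 1(1) lab(2)])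
  next
    case 2
    have "(\<Sum>N\<leftarrow>K. lookup v (x N)) = sum_list (map sgn_label K)"
      by (rule sum_list_lookup_cong[OF K]) (simp only: 2 lookup_diam_vec)
    then show ?thesis
      using * 2 by (simp only: rewrites_to_def lookup_diam_vec[OF lab(1)] lookup_diam_vec[OF lab(2)])
  qed
qed

lemma subspace_balanced: "subspace {v. balanced v}"
proof (rule subspaceI)
  show "0 \<in> {v. balanced v}" by (simp add: balanced_def)
next
  fix v w assume "v \<in> {v. balanced v}" "w \<in> {v. balanced v}"
  then have *: "balanced v" "balanced w" by simp_all
  show "v + w \<in> {v. balanced v}"
    unfolding balanced_def mem_Collect_eq
  proof (intro conjI allI impI ballI)
    show "keys (v + w) \<subseteq> X" using * keys_add[of v w] unfolding balanced_def by blast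
    fix L M Ks K assume "crossing n L M" "rewrites_to L M Ks" "K \<in> set Ks"
    then have "(\<Sum>N\<leftarrow>K. lookup v (x N)) = lookup v (x L) + lookup v (x M)"
      "(\<Sum>N\<leftarrow>K. lookup w (x N)) = lookup w (x L) + lookup w (x M)"
      using * unfolding balanced_def by blast+
    then show "(\<Sum>N\<leftarrow>K. lookup (v + w) (x N))
        = lookup (v + w) (x L) + lookup (v + w) (x M)"
      by (simp add: lookup_add sum_list_addf)
  qed
next
  fix c v assume "v \<in> {v. balanced v}"
  then have *: "balanced v" by simp
  show "c *\<^sub>R v \<in> {v. balanced v}"
    unfolding balanced_def mem_Collect_eq
  proof (intro conjI allI impI ballI)
    show "keys (c *\<^sub>R v) \<subseteq> X" using * keys_scaleR[of c v] unfolding balanced_def by blast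
    fix L M Ks K assume "crossing n L M" "rewrites_to L M Ks" "K \<in> set Ks"
    then have "(\<Sum>N\<leftarrow>K. lookup v (x N)) = lookup v (x L) + lookup v (x M)"
      using * unfolding balanced_def by blast
    then show "(\<Sum>N\<leftarrow>K. lookup (c *\<^sub>R v) (x N))
        = lookup (c *\<^sub>R v) (x L) + lookup (c *\<^sub>R v) (x M)"
      by (simp add: lookup_scaleR sum_list_const_mult distrib_left)
  qed
qed

lemma balanced_span: "v \<in> span (K_D n x) \<Longrightarrow> balanced v"
  using span_minimal[OF _ subspace_balanced] balanced_K_D by blast

definition \<omega> :: "'f \<Rightarrow>\<^sub>0 real" where
  "\<omega> = (\<Sum>L\<in>labels n. single (x L) (real (wt n L)))"

lemma lookup_\<omega>:
  assumes M: "M \<in> labels n"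
  shows "lookup \<omega> (x M) = real (wt n M)"
proof -
  have "lookup \<omega> (x M) = (\<Sum>L\<in>labels n. if L = M then real (wt n M) else 0)"
    unfolding \<omega>_def lookup_sum
    by (rule sum.cong) (use M inj_onD[OF inj_x] in \<open>auto simp: lookup_single when_def\<close>)
  then show ?thesis using M finite_labels[OF n2] by simp
qed

lemma keys_\<omega>: "keys \<omega> \<subseteq> X"
  unfolding \<omega>_def all_variables_eq by (rule order_trans[OF keys_sum]) auto

text \<open>Each rewriting leaves the v-weight unchanged, so any positive multiple of \<omega>
  supplies the strict drop.\<close>

lemma decreasing_add_balanced:
  assumes t: "t > 0" and v: "balanced v"
  shows "decreasing (t *\<^sub>R \<omega> + v)"
  unfolding decreasing_def
proof (intro allI impI ballI)
  fix L M Ks K assume *: "crossing n L M" "rewrites_to L M Ks" "K \<in> set Ks"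
  have K: "set K \<subseteq> labels n" "(\<Sum>N\<leftarrow>K. wt n N) < wt n L + wt n M"
    using * unfolding rewrites_to_def by blast+
  have lab: "L \<in> labels n" "M \<in> labels n" using crossing_imp(1,2)[OF n2 *(1)] by auto
  have "(\<Sum>N\<leftarrow>K. lookup \<omega> (x N)) = (\<Sum>N\<leftarrow>K. real (wt n N))"
    by (rule sum_list_lookup_cong[OF K(1)]) (rule lookup_\<omega>)
  also have "\<dots> = real (\<Sum>N\<leftarrow>K. wt n N)" by (induction K) simp_all
  also have "\<dots> < real (wt n L) + real (wt n M)" using K(2) by linarith
  finally have "t * (\<Sum>N\<leftarrow>K. lookup \<omega> (x N))
      < t * (lookup \<omega> (x L) + lookup \<omega> (x M))"
    using t by (simp only: lookup_\<omega>[OF lab(1)] lookup_\<omega>[OF lab(2)]) simp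
  moreover have "(\<Sum>N\<leftarrow>K. lookup v (x N)) = lookup v (x L) + lookup v (x M)"
    using v * unfolding balanced_def by blast
  ultimately show "(\<Sum>N\<leftarrow>K. lookup (t *\<^sub>R \<omega> + v) (x N))
      < lookup (t *\<^sub>R \<omega> + v) (x L) + lookup (t *\<^sub>R \<omega> + v) (x M)"
    by (simp add: lookup_add lookup_scaleR sum_list_addf sum_list_const_mult distrib_left)
qed

text \<open>v is the limit of t \<omega> + v as t tends to 0 from above, and for all these weights
  the initial ideal is the incompatibility ideal.\<close>

lemma balanced_in_cone:
  assumes v: "balanced v"
  shows "v \<in> groebner_cone \<iota> s0"
  unfolding groebner_cone_def closure_approachable
proof (intro allI impI)
  fix e :: real assume e: "e > 0"
  \<comment> \<open>The summand 1 keeps the denominator positive and makes t times the norm of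
    \<omega> strictly less than e.\<close>
  define t where "t = e / (norm \<omega> + 1)"
  have t: "t > 0" using e by (simp add: t_def add_nonneg_pos)
  have "dist (t *\<^sub>R \<omega> + v) v = t * norm \<omega>" using t by (simp add: dist_norm)
  also have "\<dots> < t * (norm \<omega> + 1)" using t by simp
  also have "\<dots> = e"
  proof -
    have "norm \<omega> + 1 \<noteq> 0" using norm_ge_zero[of \<omega>] by linarith
    then show ?thesis by (simp add: t_def)
  qed
  finally have "dist (t *\<^sub>R \<omega> + v) v < e" .
  moreover have "keys (t *\<^sub>R \<omega> + v) \<subseteq> X"
    using keys_add[of "t *\<^sub>R \<omega>" v] keys_scaleR[of t \<omega>] keys_\<omega> v unfolding balanced_def by blast
  ultimately show "\<exists>\<theta>\<in>{\<omega>. keys \<omega> \<subseteq> X \<and>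
      initial_ideal X \<omega> (cluster_ideal \<iota> s0) = incompatibility_ideal \<iota> s0}. dist \<theta> v < e"
    using initial_ideal_eq[OF decreasing_add_balanced[OF t v]] by blast
qed

text \<open>If an arc outweighed the product of the two diameters, the initial form of the relation
  would consist of single variables only, whereas each of its terms must be divisible by a crossing
  pair.\<close>

lemma blue_red_weight:
  assumes \<theta>: "initial_ideal X \<theta> (cluster_ideal \<iota> s0) = incompatibility_ideal \<iota> s0"
    and p: "1 \<le> p" "p < q" "q < p + n" and N: "N = arc n p q \<or> N = arc n q (p + n)"
  shows "lookup \<theta> (x N) \<le> lookup \<theta> (B p) + lookup \<theta> (R q)"
proof (rule ccontr)
  interpret cring "poly_ring X :: (('f \<Rightarrow>\<^sub>0 nat) \<Rightarrow>\<^sub>0 'k) ring" by (rule cring_poly_ring)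
  assume "\<not> ?thesis"
  then have gt: "lookup \<theta> (x N) > lookup \<theta> (B p) + lookup \<theta> (R q)" by simp
  let ?m = "var_monomial (B p) + var_monomial (R q)"
  define m1 where "m1 = var_monomial (A p q)"
  define m2 where "m2 = var_monomial (A q (p + n))"
  define f :: "('f \<Rightarrow>\<^sub>0 nat) \<Rightarrow>\<^sub>0 'k" where
    "f = single ?m 1 - (\<Sum>K\<leftarrow>[[arc n p q], [arc n q (p + n)]]. single (label_monomial K) 1)"
  have f_eq: "f = single ?m 1 - (single m1 1 + single m2 1)"
    by (simp add: f_def label_monomial_def m1_def m2_def)
  have lab: "bl n p \<in> labels n" "rd n q \<in> labels n" "arc n p q \<in> labels n" "arc n q (p + n) \<in> labels n"
    using p bl_in_labels[of p] rd_in_labels[of q] arc_in_labels'[of p q] arc_in_labels'[of q "p + n"] by simp_all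
  have "keys ?m \<subseteq> {B p, R q}"
    using keys_add[of "var_monomial (B p)" "var_monomial (R q)"] by auto
  then have mX: "keys ?m \<subseteq> X" "keys m1 \<subseteq> X" "keys m2 \<subseteq> X"
    using lab unfolding all_variables_eq m1_def m2_def by auto
  have "f \<in> polys X"
    unfolding f_eq diff_conv_add_uminus by (intro polys_add polys_uminus polys_single mX)
  moreover have "poly_value \<iota> f = 0"
    unfolding f_def poly_value_label_relation using blue_red_exchange[OF p] by simp
  ultimately have "f \<in> cluster_ideal \<iota> s0" unfolding cluster_ideal_eq by simp
  moreover have "initial_form \<theta> ` cluster_ideal \<iota> s0 \<subseteq> carrier (poly_ring X)"
    unfolding carrier_poly_ring cluster_ideal_eq using initial_form_in_polys by blast
  ultimately have "initial_form \<theta> f \<in> incompatibility_ideal \<iota> s0"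
    using genideal_self unfolding \<theta>[symmetric] initial_ideal_def by blast
  then have inbad: "bad m" if "m \<in> keys (initial_form \<theta> f)" for m
    using that unfolding incompatibility_ideal_eq by blast
  have keysf: "keys f \<subseteq> {?m, m1, m2}"
    by (auto simp: f_eq in_keys_iff lookup_minus lookup_add lookup_single when_def split: if_splits)
  have nm: "?m \<noteq> var_monomial v" for v
  proof
    assume "?m = var_monomial v"
    moreover have "bad ?m"
      unfolding bad_def using crossing.blue_red[OF p] by (metis add.right_neutral)
    ultimately show False using not_bad_var[of v] by simp
  qed
  define mN where "mN = var_monomial (x N)"
  have "mN = m1 \<or> mN = m2" using N by (auto simp: mN_def m1_def m2_def)
  \<comment> \<open>The coefficient is minus the number of the monomials \<open>m1\<close>,
    \<open>m2\<close> that equal \<open>mN\<close>, which is nonzero in characteristic zero.\<close>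
  then have mN: "mN \<in> keys f"
    using nm by (auto simp: f_eq m1_def m2_def in_keys_iff lookup_minus lookup_add lookup_single when_def)
  obtain \<kappa> where \<kappa>: "\<kappa> \<in> keys f"
    "\<And>m. m \<in> keys f \<Longrightarrow> monomial_weight \<theta> m \<le> monomial_weight \<theta> \<kappa>"
  proof -
    let ?S = "monomial_weight \<theta> ` keys f"
    have fin: "finite ?S" and ne: "?S \<noteq> {}" using mN by auto
    obtain \<kappa> where "\<kappa> \<in> keys f" "monomial_weight \<theta> \<kappa> = Max ?S"
      using Max_in[OF fin ne] by force
    then show thesis using that[of \<kappa>] Max_ge[OF fin] by simp
  qed
  have "monomial_weight \<theta> ?m < monomial_weight \<theta> mN"
    using gt by (simp add: mN_def monomial_weight_add monomial_weight_var)
  then have "\<kappa> \<noteq> ?m" using \<kappa>(2)[OF mN] by auto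
  then have "\<kappa> = m1 \<or> \<kappa> = m2" using \<kappa>(1) keysf by blast
  then have "\<not> bad \<kappa>" using not_bad_var by (auto simp: m1_def m2_def)
  moreover have "\<kappa> \<in> keys (initial_form \<theta> f)"
    using \<kappa> by (simp add: in_keys_iff lookup_initial_form)
  ultimately show False using inbad by blast
qed

text \<open>Both conditions hold on the set whose closure is the cone and are closed conditions on
  coordinates.\<close>

lemma cone_inequality:
  assumes "\<theta> \<in> groebner_cone \<iota> s0"
  shows "v \<notin> X \<Longrightarrow> lookup \<theta> v = 0"
    and "1 \<le> p \<Longrightarrow> p < q \<Longrightarrow> q < p + n \<Longrightarrow> N = arc n p q \<or> N = arc n q (p + n) \<Longrightarrow>
      lookup \<theta> (x N) \<le> lookup \<theta> (B p) + lookup \<theta> (R q)"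
proof -
  let ?G = "{\<omega>. keys \<omega> \<subseteq> X \<and>
       initial_ideal X \<omega> (cluster_ideal \<iota> s0) = incompatibility_ideal \<iota> s0}"
  have in_closed: "\<theta> \<in> H" if "closed H" "?G \<subseteq> H" for H
    using closure_minimal[OF that(2,1)] assms unfolding groebner_cone_def by blast
  show "lookup \<theta> v = 0" if v: "v \<notin> X"
  proof -
    have "closed {\<theta> :: 'f \<Rightarrow>\<^sub>0 real. lookup \<theta> v = 0}"
      by (intro closed_Collect_eq continuous_on_lookup continuous_on_const)
    from in_closed[OF this] show ?thesis using v by (auto simp: in_keys_iff subset_iff)
  qed
  show "lookup \<theta> (x N) \<le> lookup \<theta> (B p) + lookup \<theta> (R q)"
    if p: "1 \<le> p" "p < q" "q < p + n" "N = arc n p q \<or> N = arc n q (p + n)"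
  proof -
    have "closed {\<theta> :: 'f \<Rightarrow>\<^sub>0 real. lookup \<theta> (x N)
        \<le> lookup \<theta> (B p) + lookup \<theta> (R q)}"
      by (intro closed_Collect_le continuous_on_add continuous_on_lookup)
    from in_closed[OF this] show ?thesis using blue_red_weight[OF _ p] by blast
  qed
qed

text \<open>The inequalities for w and -w combine to equations, which express every arc coordinate
  by those of diameters. The diameter coordinates then determine the coefficients of E_i and
  u^diam.\<close>

lemma lineality_subset_span:
  assumes "w \<in> lineality_space (groebner_cone \<iota> s0)"
  shows "w \<in> span (K_D n x)"
proof -
  have w: "w \<in> groebner_cone \<iota> s0" "- w \<in> groebner_cone \<iota> s0"
    using assms by (auto simp: lineality_space_def)
  let ?w = "\<lambda>L. lookup w (x L)"
  have arc: "?w (arc n p q) = ?w (bl n p) + ?w (rd n q)" "?w (arc n q (p + n)) = ?w (bl n p) + ?w (rd n q)"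
    if p: "1 \<le> p" "p < q" "q < p + n" for p q
    using cone_inequality(2)[OF w(1) p, of "arc n p q"] cone_inequality(2)[OF w(2) p, of "arc n p q"]
      cone_inequality(2)[OF w(1) p, of "arc n q (p + n)"] cone_inequality(2)[OF w(2) p, of "arc n q (p + n)"]
    by simp_all
  \<comment> \<open>The arc [j, i + n] is a term of two relations, blue_i red_j and blue_j red_i,
    and comparing them gives the claim.\<close>
  have swap: "?w (bl n i) + ?w (rd n j) = ?w (bl n j) + ?w (rd n i)" if ij: "1 \<le> i" "i < j" "j \<le> n" for i j
    using arc(2)[of i j] arc(1)[of j "i + n"] ij rd_shift[of i n] by simp
  \<comment> \<open>Half the common difference blue - red is the coefficient of u^diam; half the sum
    blue + red at i is the coefficient of E_i.\<close>
  define d where "d = (?w (bl n 1) - ?w (rd n 1)) / 2"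
  define c where "c i = (?w (bl n i) + ?w (rd n i)) / 2" for i
  have diff: "?w (bl n i) - ?w (rd n i) = 2 * d" if "1 \<le> i" "i \<le> n" for i
    using swap[of 1 i] that by (cases "i = 1") (auto simp: d_def)
  have br: "?w (bl n i) = c i + d" "?w (rd n i) = c i - d" if "1 \<le> i" "i \<le> n" for i
    using diff[OF that] by (simp_all add: c_def field_simps)
  define v where "v = (\<Sum>i\<in>{1..n}. c i *\<^sub>R E i) + d *\<^sub>R U"
  have "v \<in> span (K_D n x)"
    unfolding v_def by (intro span_add span_sum span_scale span_base) (auto simp: K_D_def)
  moreover have "w = v"
  proof (rule poly_mapping_eqI)
    fix z
    show "lookup w z = lookup v z"
    proof (cases "z \<in> X")
      case False
      have "keys v \<subseteq> X"
        using balanced_span[OF \<open>v \<in> span (K_D n x)\<close>] by (simp add: balanced_def)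
      then have "z \<notin> keys v" using False by blast
      then show ?thesis using cone_inequality(1)[OF w(1) False] by (simp add: in_keys_iff)
    next
      case True
      then obtain M where M: "M \<in> labels n" "z = x M" unfolding all_variables_eq by blast
      have lv: "lookup v z = (\<Sum>i\<in>{1..n}. c i * cnt i M) + d * sgn_label M"
        unfolding v_def M(2) by (rule lookup_combination[OF M(1)])
      from n2 M(1) show ?thesis
      proof (cases rule: labels_cases)
        case (blue a)
        then show ?thesis
          unfolding lv using M br[of a] sum_cnt[of a c] by (simp add: cnt_bl_rd sgn_label_simps)
      next
        case (red a)
        then show ?thesis
          unfolding lv using M br[of a] sum_cnt[of a c] by (simp add: cnt_bl_rd sgn_label_simps)
      next
        case (arc a b)
        \<comment> \<open>The representative of b in 1..n, since the vectors E_i are indexed there.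
          In the arc coordinate (c a + d) + (c b' - d) the contribution of d cancels.\<close>
        define b' where "b' = (if b \<le> n then b else b - n)"
        have b': "1 \<le> b'" "b' \<le> n" "rd n b = rd n b'" "ind n i b = ind n i b'" for i
          using arc rd_shift[of "b - n" n] ind_shift[of "b - n" n i] by (auto simp: b'_def)
        have "(\<Sum>i\<in>{1..n}. c i * cnt i M) = (\<Sum>i\<in>{1..n}. c i * ind n i a) + (\<Sum>i\<in>{1..n}. c i * ind n i b')"
          using arc by (simp add: cnt_arc[OF n1] b'(4) distrib_left sum.distrib)
        also have "\<dots> = c a + c b'" using sum_cnt[of a c] sum_cnt[of b' c] arc b' by simp
        finally show ?thesis
          unfolding lv using M arc \<open>\<And>q p. 1 \<le> p \<Longrightarrow> p < q \<Longrightarrow> q < p + n \<Longrightarrow> ?w (arc n p q) = ?w (bl n p) + ?w (rd n q)\<close>[of a b]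
            br(1)[of a] br(2)[of b'] b' by (simp add: sgn_label_simps)
      qed
    qed
  qed
  ultimately show ?thesis by simp
qed

lemma span_eq_lineality: "span (K_D n x) = lineality_space (groebner_cone \<iota> s0)"
proof
  show "span (K_D n x) \<subseteq> lineality_space (groebner_cone \<iota> s0)"
  proof
    fix v assume v: "v \<in> span (K_D n x)"
    have "v \<in> groebner_cone \<iota> s0" "- v \<in> groebner_cone \<iota> s0"
      using balanced_in_cone[OF balanced_span] v span_neg by blast+
    then show "v \<in> lineality_space (groebner_cone \<iota> s0)"
      unfolding lineality_space_def by (metis IntI image_eqI minus_minus)
  qed
  show "lineality_space (groebner_cone \<iota> s0) \<subseteq> span (K_D n x)"
    using lineality_subset_span by blast
qed

end

theorem proposition5p1p2:
  fixes \<iota> :: "'k::field_char_0 \<Rightarrow> 'f::field"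
    and s0 :: "'f seed"
    and n :: nat
    and x :: "label \<Rightarrow> 'f"
  assumes "n \<ge> 4"
    and "geometric_seed \<iota> s0"
    and "polygon_model n s0 x"
  shows "K_D n x \<subseteq> integer_vectors (all_variables s0) \<and>
    independent (K_D n x) \<and>
    span (K_D n x) = lineality_space (groebner_cone \<iota> s0)"
proof -
  interpret D_model \<iota> s0 n x
    using assms by unfold_locales simp_all
  show ?thesis
    using K_D_integer independent_K_D span_eq_lineality by blast
qed

end
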